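(* Let $\boldsymbol\Lambda$, $\mathbf c$ be given by either choice (i) or choice (ii) of the context, with the discrete spaces described there. In choice (i) assume in addition that the mesh sequence $\mathcal T_h^{\mathcal B}$ is such that the $L^2(\mathcal B)$-projection $P_0$ from $H^1(\mathcal B)^d$ onto $S_h$ is $H^1$-stable, i.e. $|P_0\mathbf v|_{1,\mathcal B}\le c|\mathbf v|_{1,\mathcal B}$ for all $\mathbf v\in H^1(\mathcal B)^d$, with $c$ independent of $h_s$. Then there exists a constant $\kappa_1>0$, independent of $h_x$ and $h_s$, such that $$\inf_{\mathbf U_h\in\mathbb K_{\mathbb B,h}}\ \sup_{\mathbf V_h\in\mathbb K_{\mathbb B,h}}\frac{\mathbb A(\mathbf U_h,\mathbf V_h)}{|||\mathbf U_h|||_{\mathbb V}\,|||\mathbf V_h|||_{\mathbb V}}\ge\kappa_1$$ (infimum and supremum over nonzero elements).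
   Context: $d\in\{2,3\}$; $\Omega,\mathcal B\subset\mathbb R^d$ are bounded Lipschitz polytopal domains; $\overline{\mathbf X}\in W^{1,\infty}(\mathcal B)^d$ is invertible onto its image with Lipschitz inverse, and the closure of $\overline{\mathbf X}(\mathcal B)$ is contained in $\Omega$. $\mathbf v(\overline{\mathbf X})=\mathbf v\circ\overline{\mathbf X}$. $(\cdot,\cdot)$, $(\cdot,\cdot)_{\mathcal B}$ are the $L^2(\Omega)$, $L^2(\mathcal B)$ scalar products; $\|\cdot\|_1$, $\|\cdot\|_{1,\mathcal B}$ the $H^1(\Omega)$, $H^1(\mathcal B)$ norms and $|\cdot|_{1,\mathcal B}$ the $H^1(\mathcal B)$ seminorm; $L^2_0(\Omega)$ the zero-mean functions in $L^2(\Omega)$. $\mathbf a_f(\mathbf u,\mathbf v)=\alpha(\mathbf u,\mathbf v)+\nu(\nabla_{\rm sym}\mathbf u,\nabla_{\rm sym}\mathbf v)$ and $\mathbf a_s(\mathbf X,\mathbf Y)=\beta(\mathbf X,\mathbf Y)_{\mathcal B}+\gamma(\nabla_s\mathbf X,\nabla_s\mathbf Y)_{\mathcal B}$, with constants $\alpha,\nu,\gamma>0$, $\beta\ge0$, $\nabla_{\rm sym}\mathbf u=\frac12(\nabla\mathbf u+\nabla\mathbf u^\top)$. Discretization: $\mathcal T_h$ and $\mathcal T_h^{\mathcal B}$ are families of (shape-)regular simplicial meshes of $\Omega$ and $\mathcal B$, with meshsizes $h_x$ and $h_s$. $V_h\subset H^1_0(\Omega)^d$, $Q_h\subset L^2_0(\Omega)$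 are finite element spaces on $\mathcal T_h$ that are stable for the Stokes problem: there is $\overline\beta_{\rm div}>0$ independent of $h_x$ with $\sup_{\mathbf v_h\in V_h}({\rm div}\,\mathbf v_h,q_h)/\|\mathbf v_h\|_1\ge\overline\beta_{\rm div}\|q_h\|_0$ for all $q_h\in Q_h$. $S_h=\{\mathbf Y\in H^1(\mathcal B)^d:\mathbf Y|_T\in P^1(T)^d\ \forall T\in\mathcal T_h^{\mathcal B}\}$ and $\boldsymbol\Lambda_h=S_h$. Choice (i): $\boldsymbol\Lambda=(H^1(\mathcal B)^d)'$ with the dual norm, $\mathbf c$ the duality pairing, so that $\mathbf c(\boldsymbol\mu_h,\mathbf Y)=(\boldsymbol\mu_h,\mathbf Y)_{\mathcal B}$ for $\boldsymbol\mu_h\in\boldsymbol\Lambda_h$, $\mathbf Y\in H^1(\mathcal B)^d$. Choice (ii): $\boldsymbol\Lambda=H^1(\mathcal B)^d$ with its norm, $\mathbf c(\boldsymbol\mu,\mathbf Y)=(\nabla_s\boldsymbol\mu,\nabla_s\mathbf Y)_{\mathcal B}+(\boldsymbol\mu,\mathbf Y)_{\mathcal B}$. $\mathbb V_h=V_h\times S_h\times\boldsymbol\Lambda_h$, with norm $|||(\mathbf v,\mathbf Y,\boldsymbol\mu)|||_{\mathbb V}=(\|\mathbf v\|_1^2+\|\mathbf Y\|_{1,\mathcal B}^2+\|\boldsymbol\mu\|_{\boldsymbol\Lambda}^2)^{1/2}$. For $\mathbf U=(\mathbf u,\mathbf X,\boldsymbol\lambda)$, $\mathbf V=(\mathbf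 v,\mathbf Y,\boldsymbol\mu)$: $\mathbb A(\mathbf U,\mathbf V)=\mathbf a_f(\mathbf u,\mathbf v)+\mathbf a_s(\mathbf X,\mathbf Y)+\mathbf c(\boldsymbol\lambda,\mathbf v(\overline{\mathbf X})-\mathbf Y)-\mathbf c(\boldsymbol\mu,\mathbf u(\overline{\mathbf X})-\mathbf X)$. $\mathbb K_{\mathbb B,h}=\{(\mathbf v_h,\mathbf Y_h,\boldsymbol\mu_h)\in\mathbb V_h:({\rm div}\,\mathbf v_h,q_h)=0\ \forall q_h\in Q_h\}$. *)

theory Defs
  imports "HOL-Analysis.Analysis"
begin

text \<open>
  Elements of the function spaces are represented by functions on the whole of \<open>real^'n\<close>, whose
  values outside the domain are irrelevant and which are only meaningful up to null sets. The norms
  below are therefore seminorms on representatives, and ``nonzero element'' means ``norm different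
  from 0''.
\<close>

text \<open>Near each boundary point the domain is, up to a choice of the ``vertical'' unit direction
  \<open>e\<close>, the strict epigraph of a Lipschitz function of the coordinates orthogonal to \<open>e\<close>.\<close>

definition lipschitz_boundary :: "(real^'n) set \<Rightarrow> bool" where
  "lipschitz_boundary D \<longleftrightarrow>
     (\<forall>x \<in> frontier D. \<exists>e r L (g :: real^'n \<Rightarrow> real).
        norm e = 1 \<and> 0 < r \<and> L-lipschitz_on UNIV g \<and>
        (\<forall>y \<in> ball x r. y \<in> D \<longleftrightarrow> g (y - (y \<bullet> e) *\<^sub>R e) < y \<bullet> e))"

definition lipschitz_polytopal_domain :: "(real^'n) set \<Rightarrow> bool" where
  "lipschitz_polytopal_domain D \<longleftrightarrow>
     open D \<and> connected D \<and> D \<noteq> {} \<and> bounded D \<and> lipschitz_boundary D \<and>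
     (\<exists>P. finite P \<and> (\<forall>p \<in> P. polytope p) \<and> closure D = \<Union>P)"

definition L2_space :: "(real^'n) set \<Rightarrow> (real^'n \<Rightarrow> 'b::euclidean_space) set" where
  "L2_space D = {f. f \<in> borel_measurable (lebesgue_on D) \<and>
                    integrable (lebesgue_on D) (\<lambda>x. (norm (f x))\<^sup>2)}"

text \<open>For matrix-valued functions the inner product of the library is the Frobenius product.\<close>

definition L2_inner ::
  "(real^'n) set \<Rightarrow> (real^'n \<Rightarrow> 'b::euclidean_space) \<Rightarrow> (real^'n \<Rightarrow> 'b) \<Rightarrow> real" where
  "L2_inner D f g = (\<integral>x. f x \<bullet> g x \<partial>lebesgue_on D)"

definition L2_norm :: "(real^'n) set \<Rightarrow> (real^'n \<Rightarrow> 'b::euclidean_space) \<Rightarrow> real" where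
  "L2_norm D f = sqrt (L2_inner D f f)"

definition L2_zero_mean :: "(real^'n) set \<Rightarrow> (real^'n \<Rightarrow> real) set" where
  "L2_zero_mean D = {q \<in> L2_space D. (\<integral>x. q x \<partial>lebesgue_on D) = 0}"

definition Linf_space :: "(real^'n) set \<Rightarrow> (real^'n \<Rightarrow> 'b::euclidean_space) set" where
  "Linf_space D = {f. f \<in> borel_measurable (lebesgue_on D) \<and>
                      (\<exists>C. AE x in lebesgue_on D. norm (f x) \<le> C)}"

definition partial_deriv :: "'n \<Rightarrow> (real^'n \<Rightarrow> real) \<Rightarrow> real^'n \<Rightarrow> real" where
  "partial_deriv j f x = frechet_derivative f (at x) (axis j 1)"

primrec C_k :: "nat \<Rightarrow> (real^'n \<Rightarrow> real) \<Rightarrow> bool" where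
  "C_k 0 f \<longleftrightarrow> continuous_on UNIV f"
| "C_k (Suc k) f \<longleftrightarrow> (\<forall>x. f differentiable (at x)) \<and> (\<forall>j. C_k k (partial_deriv j f))"

definition test_functions :: "(real^'n) set \<Rightarrow> (real^'n \<Rightarrow> real) set" where
  "test_functions D = {\<phi>. (\<forall>k. C_k k \<phi>) \<and>
     compact (closure {x. \<phi> x \<noteq> 0}) \<and> closure {x. \<phi> x \<noteq> 0} \<subseteq> D}"

definition test_fields :: "(real^'n) set \<Rightarrow> (real^'n \<Rightarrow> real^'n) set" where
  "test_fields D = {\<phi>. \<forall>i. (\<lambda>x. \<phi> x $ i) \<in> test_functions D}"

text \<open>The entry \<open>G x $ i $ j\<close> is the weak derivative of the \<open>i\<close>-th component in direction \<open>j\<close>. The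
  relation is only used for \<open>f\<close> and \<open>G\<close> both square integrable or both essentially bounded, so that
  the integrands are integrable.\<close>

definition has_weak_gradient ::
  "(real^'n) set \<Rightarrow> (real^'n \<Rightarrow> real^'n) \<Rightarrow> (real^'n \<Rightarrow> real^'n^'n) \<Rightarrow> bool" where
  "has_weak_gradient D f G \<longleftrightarrow>
     (\<forall>\<phi> \<in> test_functions D. \<forall>i j.
        (\<integral>x. f x $ i * partial_deriv j \<phi> x \<partial>lebesgue_on D) =
        - (\<integral>x. G x $ i $ j * \<phi> x \<partial>lebesgue_on D))"

definition W1inf_space :: "(real^'n) set \<Rightarrow> (real^'n \<Rightarrow> real^'n) set" where
  "W1inf_space D = {f \<in> Linf_space D. \<exists>G \<in> Linf_space D. has_weak_gradient D f G}"

definition H1_space :: "(real^'n) set \<Rightarrow> (real^'n \<Rightarrow> real^'n) set" where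
  "H1_space D = {f \<in> L2_space D. \<exists>G \<in> L2_space D. has_weak_gradient D f G}"

text \<open>A representative of the weak gradient, which is unique up to null sets.\<close>

definition weak_grad :: "(real^'n) set \<Rightarrow> (real^'n \<Rightarrow> real^'n) \<Rightarrow> real^'n \<Rightarrow> real^'n^'n" where
  "weak_grad D f = (SOME G. G \<in> L2_space D \<and> has_weak_gradient D f G)"

definition sym_grad :: "(real^'n) set \<Rightarrow> (real^'n \<Rightarrow> real^'n) \<Rightarrow> real^'n \<Rightarrow> real^'n^'n" where
  "sym_grad D f x = (1/2) *\<^sub>R (weak_grad D f x + transpose (weak_grad D f x))"

definition weak_div :: "(real^'n) set \<Rightarrow> (real^'n \<Rightarrow> real^'n) \<Rightarrow> real^'n \<Rightarrow> real" where
  "weak_div D f x = trace (weak_grad D f x)"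

definition H1_inner ::
  "(real^'n) set \<Rightarrow> (real^'n \<Rightarrow> real^'n) \<Rightarrow> (real^'n \<Rightarrow> real^'n) \<Rightarrow> real" where
  "H1_inner D f g = L2_inner D (weak_grad D f) (weak_grad D g) + L2_inner D f g"

definition H1_norm :: "(real^'n) set \<Rightarrow> (real^'n \<Rightarrow> real^'n) \<Rightarrow> real" where
  "H1_norm D f = sqrt (H1_inner D f f)"

definition H1_seminorm :: "(real^'n) set \<Rightarrow> (real^'n \<Rightarrow> real^'n) \<Rightarrow> real" where
  "H1_seminorm D f = L2_norm D (weak_grad D f)"

definition H10_space :: "(real^'n) set \<Rightarrow> (real^'n \<Rightarrow> real^'n) set" where
  "H10_space D = {f \<in> H1_space D. \<exists>\<phi> :: nat \<Rightarrow> real^'n \<Rightarrow> real^'n.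
     (\<forall>n. \<phi> n \<in> test_fields D) \<and> (\<lambda>n. H1_norm D (\<lambda>x. f x - \<phi> n x)) \<longlonglongrightarrow> 0}"

definition simplicial_mesh :: "(real^'n) set \<Rightarrow> (real^'n) set set \<Rightarrow> bool" where
  "simplicial_mesh D T \<longleftrightarrow>
     triangulation T \<and> (\<forall>K \<in> T. int CARD('n) simplex K) \<and> \<Union>T = closure D"

definition inradius :: "(real^'n) set \<Rightarrow> real" where
  "inradius K = Sup {r. 0 \<le> r \<and> (\<exists>x. cball x r \<subseteq> K)}"

definition shape_regular_family :: "('i \<Rightarrow> (real^'n) set set) \<Rightarrow> bool" where
  "shape_regular_family T \<longleftrightarrow> (\<exists>\<sigma>. \<forall>i. \<forall>K \<in> T i. diameter K \<le> \<sigma> * inradius K)"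

definition finite_element_space ::
  "(real^'n) set \<Rightarrow> (real^'n) set set \<Rightarrow> (real^'n \<Rightarrow> 'b::euclidean_space) set \<Rightarrow> bool" where
  "finite_element_space D T W \<longleftrightarrow>
     (\<lambda>x. 0) \<in> W \<and>
     (\<forall>u \<in> W. \<forall>v \<in> W. (\<lambda>x. u x + v x) \<in> W) \<and>
     (\<forall>c. \<forall>u \<in> W. (\<lambda>x. c *\<^sub>R u x) \<in> W) \<and>
     (\<exists>F \<subseteq> W. finite F \<and>
        (\<forall>u \<in> W. \<exists>c. AE x in lebesgue_on D. u x = (\<Sum>f \<in> F. c f *\<^sub>R f x))) \<and>
     (\<forall>u \<in> W. \<forall>K \<in> T. \<exists>p. polynomial_function p \<and> (AE x in lebesgue_on K. u x = p x))"

definition P1_space :: "(real^'n) set \<Rightarrow> (real^'n) set set \<Rightarrow> (real^'n \<Rightarrow> real^'n) set" where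
  "P1_space D T = {Y \<in> H1_space D. \<forall>K \<in> T. \<exists>(A :: real^'n^'n) b.
                     AE x in lebesgue_on K. Y x = A *v x + b}"

text \<open>The quotient vanishes for \<open>v\<close> of norm 0, because division by 0 yields 0.\<close>

definition stokes_inf_sup ::
  "(real^'n) set \<Rightarrow> real \<Rightarrow> (real^'n \<Rightarrow> real^'n) set \<Rightarrow> (real^'n \<Rightarrow> real) set \<Rightarrow> bool" where
  "stokes_inf_sup D \<beta> Vh Qh \<longleftrightarrow>
     (\<forall>q \<in> Qh. ereal (\<beta> * L2_norm D q) \<le>
        (SUP v \<in> Vh. ereal (L2_inner D (weak_div D v) q / H1_norm D v)))"

text \<open>The \<open>L\<^sup>2\<close>-projection is unique up to null sets.\<close>

definition L2_projection ::
  "(real^'n) set \<Rightarrow> (real^'n \<Rightarrow> real^'n) set \<Rightarrow> (real^'n \<Rightarrow> real^'n) \<Rightarrow> real^'n \<Rightarrow> real^'n" where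
  "L2_projection D S v = (SOME p. p \<in> S \<and> (\<forall>Y \<in> S. L2_inner D p Y = L2_inner D v Y))"

text \<open>With \<open>Dual_Pairing\<close> the multiplier space is the dual of \<open>H\<^sup>1\<close>, and \<open>\<mu>\<close> in \<open>L\<^sup>2\<close> is identified with
  the functional \<open>Y \<mapsto> (\<mu>, Y)\<close>, so that the duality pairing and the dual norm only have to be given for
  these functionals. With \<open>H1_Product\<close> the multiplier space is \<open>H\<^sup>1\<close> itself.\<close>

datatype coupling = Dual_Pairing | H1_Product

definition dual_norm :: "(real^'n) set \<Rightarrow> ((real^'n \<Rightarrow> real^'n) \<Rightarrow> real) \<Rightarrow> real" where
  "dual_norm D l = (SUP Y \<in> {Y \<in> H1_space D. H1_norm D Y \<noteq> 0}. \<bar>l Y\<bar> / H1_norm D Y)"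

fun coupling_form ::
  "coupling \<Rightarrow> (real^'n) set \<Rightarrow> (real^'n \<Rightarrow> real^'n) \<Rightarrow> (real^'n \<Rightarrow> real^'n) \<Rightarrow> real" where
  "coupling_form Dual_Pairing B \<mu> Y = L2_inner B \<mu> Y"
| "coupling_form H1_Product B \<mu> Y = H1_inner B \<mu> Y"

fun multiplier_norm :: "coupling \<Rightarrow> (real^'n) set \<Rightarrow> (real^'n \<Rightarrow> real^'n) \<Rightarrow> real" where
  "multiplier_norm Dual_Pairing B \<mu> = dual_norm B (L2_inner B \<mu>)"
| "multiplier_norm H1_Product B \<mu> = H1_norm B \<mu>"

type_synonym 'n field = "real^'n \<Rightarrow> real^'n"

definition a_f :: "(real^'n) set \<Rightarrow> real \<Rightarrow> real \<Rightarrow> 'n::finite field \<Rightarrow> 'n field \<Rightarrow> real" where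
  "a_f \<Omega> \<alpha> \<nu> u v = \<alpha> * L2_inner \<Omega> u v + \<nu> * L2_inner \<Omega> (sym_grad \<Omega> u) (sym_grad \<Omega> v)"

definition a_s :: "(real^'n) set \<Rightarrow> real \<Rightarrow> real \<Rightarrow> 'n::finite field \<Rightarrow> 'n field \<Rightarrow> real" where
  "a_s B \<beta> \<gamma> X Y = \<beta> * L2_inner B X Y + \<gamma> * L2_inner B (weak_grad B X) (weak_grad B Y)"

definition form_A ::
  "coupling \<Rightarrow> (real^'n) set \<Rightarrow> (real^'n) set \<Rightarrow> 'n field \<Rightarrow> real \<Rightarrow> real \<Rightarrow> real \<Rightarrow> real \<Rightarrow>
   'n field \<times> 'n field \<times> 'n field \<Rightarrow> 'n::finite field \<times> 'n field \<times> 'n field \<Rightarrow> real" where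
  "form_A ch \<Omega> B Xbar \<alpha> \<nu> \<beta> \<gamma> = (\<lambda>(u, X, \<kappa>) (v, Y, \<mu>).
     a_f \<Omega> \<alpha> \<nu> u v + a_s B \<beta> \<gamma> X Y
     + coupling_form ch B \<kappa> (\<lambda>s. v (Xbar s) - Y s)
     - coupling_form ch B \<mu> (\<lambda>s. u (Xbar s) - X s))"

definition norm_V ::
  "coupling \<Rightarrow> (real^'n) set \<Rightarrow> (real^'n) set \<Rightarrow> 'n::finite field \<times> 'n field \<times> 'n field \<Rightarrow> real" where
  "norm_V ch \<Omega> B = (\<lambda>(v, Y, \<mu>).
     sqrt ((H1_norm \<Omega> v)\<^sup>2 + (H1_norm B Y)\<^sup>2 + (multiplier_norm ch B \<mu>)\<^sup>2))"

definition kernel_B ::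
  "(real^'n) set \<Rightarrow> 'n field set \<Rightarrow> (real^'n \<Rightarrow> real) set \<Rightarrow> 'n field set \<Rightarrow>
   ('n::finite field \<times> 'n field \<times> 'n field) set" where
  "kernel_B \<Omega> Vh Qh Sh = {(v, Y, \<mu>). v \<in> Vh \<and> Y \<in> Sh \<and> \<mu> \<in> Sh \<and>
     (\<forall>q \<in> Qh. L2_inner \<Omega> (weak_div \<Omega> v) q = 0)}"

end

(*
  Fix U_h = (u, X, lambda) and suppose that A(U_h, V_h) <= kappa |||U_h||| |||V_h||| for all V_h. Three
  test functions give a contradiction for small kappa. With V_h = U_h the coupling terms cancel, so
  Korn's inequality bounds ||u||_1 and |X|_1. With V_h = (0, 0, m), where m is the constant field
  given by the integral of X, both choices of c reduce to the L^2 product because the gradient of m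
  vanishes; this bounds m, since composition with Xbar is bounded in L^2, and Poincare's inequality
  then bounds X in H^1 even for beta = 0. With V_h = (0, Y, 0) the norm of lambda is bounded by
  choosing Y = -lambda, or Y as the L^2 projection of an almost maximizer of the dual norm. Since the
  test functions are used one at a time, no chain rule for the weak gradient of u o Xbar is needed.

  Weak gradients are only known through test functions. The density of test functions in L^2 makes
  them unique. Poincare's inequality follows on a convex set by bounding the translates f(x + h) - f(x),
  and spreads along overlapping convex sets to the connected domain, which is covered up to a null set
  by the interiors of finitely many polytopes.
*)
theory Submission
  imports Defs
begin

text \<open>The second and third test functions have zero velocity, so they meet the divergence
  constraint of the kernel by themselves; only the first one inherits it from U_h. For compactly
  supported fields Korn's inequality is an identity: with M the gradient, the integral of M : M^T is
  that of the squared divergence. The bound for the composition with \<open>Xbar\<close> holds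
  because preimages under \<open>Xbar\<close> are images under its Lipschitz inverse, and a
  Lipschitz map enlarges measure by a bounded factor. Mean values are avoided in Poincare's
  inequality: the double integral of (f x - f y)^2 over a product of two sets is estimated instead,
  because such estimates can be chained through any set of positive measure. The obstacle there is
  that polytopes cover only the closure of the domain. A slit could run through their interiors; the
  Lipschitz boundary excludes this, as the domain lies on one side of its boundary.\<close>

section \<open>Test functions\<close>

lemma partial_deriv_eq: "(f has_derivative f') (at x) \<Longrightarrow> partial_deriv j f x = f' (axis j 1)"
  unfolding partial_deriv_def by (metis frechet_derivative_at)

lemma C_k_differentiable: "C_k (Suc n) f \<Longrightarrow> f differentiable (at x)"
  by simp

lemma C_k_has_derivative:
  fixes f :: "real^'n \<Rightarrow> real"
  assumes "C_k (Suc n) f"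
  shows "(f has_derivative (\<lambda>h. \<Sum>j\<in>UNIV. h $ j * partial_deriv j f x)) (at x)"
proof -
  let ?D = "frechet_derivative f (at x)"
  have D: "(f has_derivative ?D) (at x)"
    using C_k_differentiable[OF assms] frechet_derivative_works by blast
  then have lin: "linear ?D" by (rule has_derivative_linear)
  have "?D h = (\<Sum>j\<in>UNIV. h $ j * partial_deriv j f x)" for h
  proof -
    have "?D h = ?D (\<Sum>j\<in>UNIV. h $ j *\<^sub>R axis j 1)"
      using basis_expansion[of h] by (simp add: scalar_mult_eq_scaleR)
    also have "\<dots> = (\<Sum>j\<in>UNIV. h $ j * ?D (axis j 1))"
      by (simp add: linear_sum[OF lin] linear_cmul[OF lin])
    finally show ?thesis by (simp add: partial_deriv_def)
  qed
  then have "?D = (\<lambda>h. \<Sum>j\<in>UNIV. h $ j * partial_deriv j f x)" by auto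
  with D show ?thesis by simp
qed

text \<open>The recursive clause of \<open>C_k\<close> speaks of the partial derivatives, so
  continuity of the function itself has to be recovered. The product rule depends on this, because
  each of its terms keeps one factor undifferentiated.\<close>

lemma C_k_lower: "C_k (Suc n) f \<Longrightarrow> C_k n f"
proof (induction n arbitrary: f)
  case 0
  then show ?case
    by (simp add: continuous_at_imp_continuous_on differentiable_imp_continuous_within)
next
  case (Suc n)
  then show ?case by simp
qed

lemma C_k_continuous: "C_k n f \<Longrightarrow> continuous_on UNIV f"
proof (induction n)
  case (Suc n)
  then show ?case using C_k_lower by blast
qed simp

lemma C_k_const: "C_k n (\<lambda>x. c)"
proof (induction n arbitrary: c)
  case (Suc n)
  have "partial_deriv j (\<lambda>x. c) = (\<lambda>x. 0)" for j :: 'a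
    by (rule ext, subst partial_deriv_eq[OF has_derivative_const]) simp
  then show ?case using Suc by simp
qed simp

lemma partial_deriv_add:
  assumes "f differentiable (at x)" "g differentiable (at x)"
  shows "partial_deriv j (\<lambda>x. f x + g x) x = partial_deriv j f x + partial_deriv j g x"
proof -
  have "((\<lambda>x. f x + g x) has_derivative (\<lambda>h. frechet_derivative f (at x) h
          + frechet_derivative g (at x) h)) (at x)"
    by (intro has_derivative_add) (use assms frechet_derivative_works in blast)+
  from partial_deriv_eq[OF this] show ?thesis by (simp add: partial_deriv_def)
qed

lemma partial_deriv_mult:
  fixes f g :: "real^'n \<Rightarrow> real"
  assumes "f differentiable (at x)" "g differentiable (at x)"
  shows "partial_deriv j (\<lambda>x. f x * g x) x = f x * partial_deriv j g x + partial_deriv j f x * g x"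
proof -
  have "((\<lambda>x. f x * g x) has_derivative (\<lambda>h. f x * frechet_derivative g (at x) h
          + frechet_derivative f (at x) h * g x)) (at x)"
    by (intro has_derivative_mult) (use assms frechet_derivative_works in blast)+
  from partial_deriv_eq[OF this] show ?thesis by (simp add: partial_deriv_def)
qed

lemma C_k_add: "C_k n f \<Longrightarrow> C_k n g \<Longrightarrow> C_k n (\<lambda>x. f x + g x)"
proof (induction n arbitrary: f g)
  case 0 then show ?case by (auto intro: continuous_intros)
next
  case (Suc n)
  then have "partial_deriv j (\<lambda>x. f x + g x) = (\<lambda>x. partial_deriv j f x + partial_deriv j g x)" for j
    by (auto simp: partial_deriv_add)
  with Suc show ?case by auto
qed

lemma C_k_mult: "C_k n f \<Longrightarrow> C_k n g \<Longrightarrow> C_k n (\<lambda>x. f x * g x)"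
proof (induction n arbitrary: f g)
  case 0 then show ?case by (auto intro: continuous_intros)
next
  case (Suc n)
  then have eq: "partial_deriv j (\<lambda>x. f x * g x) =
      (\<lambda>x. f x * partial_deriv j g x + partial_deriv j f x * g x)" for j
    by (auto simp: partial_deriv_mult)
  have "C_k n f" "C_k n g" using Suc.prems C_k_lower by blast+
  with Suc show ?case by (auto simp: eq intro!: C_k_add)
qed

lemma C_k_minus: "C_k n f \<Longrightarrow> C_k n (\<lambda>x. - f x)"
  using C_k_mult[OF C_k_const[of n "-1"], of f] by simp

lemma C_k_prod: "finite I \<Longrightarrow> (\<And>i. i \<in> I \<Longrightarrow> C_k n (f i)) \<Longrightarrow> C_k n (\<lambda>x. \<Prod>i\<in>I. f i x)"
  by (induction I rule: finite_induct) (auto intro: C_k_const C_k_mult)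

lemma C_k_power: "C_k n f \<Longrightarrow> C_k n (\<lambda>x. f x ^ m)"
  by (induction m) (auto intro: C_k_const C_k_mult)

text \<open>A whole sequence \<open>h\<close>, each member the derivative of the one before, is
  assumed so that the induction on \<open>n\<close> can shift \<open>k\<close>; no general chain
  rule for \<open>C_k\<close> has to be proved.\<close>

lemma C_k_coordinate:
  assumes "\<And>k t. ((h k :: real \<Rightarrow> real) has_real_derivative h (Suc k) t) (at t)"
  shows "C_k n (\<lambda>x :: real^'n. h k (x $ i))"
proof (induction n arbitrary: k)
  case 0
  have "continuous_on UNIV (h k)"
    using assms by (meson DERIV_isCont continuous_at_imp_continuous_on)
  then have "continuous_on UNIV (h k \<circ> (\<lambda>x :: real^'n. x $ i))"
    by (intro continuous_on_compose continuous_intros) (auto intro: continuous_on_subset)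
  then show ?case by (simp add: o_def)
next
  case (Suc n)
  have D: "((\<lambda>x :: real^'n. h k (x $ i)) has_derivative (\<lambda>v. v $ i * h (Suc k) (x $ i))) (at x)" for x
  proof -
    have "(h k has_derivative (\<lambda>v. v * h (Suc k) (x $ i))) (at (x $ i))"
      using assms[of k "x $ i"] by (simp add: has_field_derivative_def mult_commute_abs)
    from has_derivative_compose[OF bounded_linear_imp_has_derivative[OF bounded_linear_vec_nth] this]
    show ?thesis .
  qed
  have "partial_deriv j (\<lambda>x :: real^'n. h k (x $ i)) = (\<lambda>x. axis j 1 $ i * h (Suc k) (x $ i))" for j
    by (rule ext, rule partial_deriv_eq[OF D])
  then show ?case using Suc D by (auto simp: differentiable_def intro!: C_k_mult C_k_const)
qed

lemma partial_deriv_translate: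
  assumes "f differentiable (at (x + a))"
  shows "partial_deriv j (\<lambda>x. f (x + a)) x = partial_deriv j f (x + a)"
proof -
  have 1: "((\<lambda>x. x + a) has_derivative (\<lambda>h. h)) (at x)"
    by (auto intro!: derivative_eq_intros)
  have "((\<lambda>x. f (x + a)) has_derivative frechet_derivative f (at (x + a))) (at x)"
    using has_derivative_compose[OF 1] assms frechet_derivative_works by blast
  from partial_deriv_eq[OF this] show ?thesis by (simp add: partial_deriv_def)
qed

lemma C_k_translate:
  fixes a :: "real^'n"
  shows "C_k n f \<Longrightarrow> C_k n (\<lambda>x. f (x + a))"
proof (induction n arbitrary: f)
  case 0
  then show ?case
    by (auto intro!: continuous_on_compose2[of UNIV f UNIV "\<lambda>x. x + a"] continuous_intros)
next
  case (Suc n)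
  have eq: "partial_deriv j (\<lambda>x. f (x + a)) = (\<lambda>x. partial_deriv j f (x + a))" for j
    using Suc.prems by (auto simp: partial_deriv_translate)
  have "(\<lambda>x. f (x + a)) differentiable at x" for x
    using Suc.prems differentiable_chain_at[of "\<lambda>x. x + a" x f]
    by (auto simp: o_def intro!: derivative_intros)
  then show ?case using Suc by (auto simp: eq)
qed

text \<open>The functions p(1/t) exp(-1/t), extended by 0 to t \<le> 0, are closed under
  differentiation, so smoothness of exp(-1/t), the case \<open>p = 1\<close>, comes down to one
  derivative formula.\<close>

definition exp_tail :: "real poly \<Rightarrow> real \<Rightarrow> real" where
  "exp_tail p t = (if t > 0 then poly p (inverse t) * exp (- inverse t) else 0)"

lemma poly_mult_exp_tendsto_0: "((\<lambda>s. poly p s * exp (- s)) \<longlongrightarrow> (0::real)) at_top"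
proof (induction p)
  case 0 then show ?case by simp
next
  case (pCons a p)
  have P: "((\<lambda>s. s ^ k * exp (- s)) \<longlongrightarrow> (0::real)) at_top" for k
    using tendsto_power_div_exp_0[of k] by (simp add: exp_minus divide_inverse)
  have 1: "((\<lambda>s. (\<Sum>i\<le>degree (pCons a p). coeff (pCons a p) i * (s ^ i * exp (- s)))) \<longlongrightarrow>
      (\<Sum>i\<le>degree (pCons a p). coeff (pCons a p) i * 0)) at_top"
    by (intro tendsto_sum tendsto_mult tendsto_const P)
  show ?case
    using 1 by (simp add: poly_altdef sum_distrib_right mult.assoc)
qed

text \<open>With s = 1/t the derivative in t is -s^2 times the one in s, which turns p(s) exp(-s)
  into s^2 (p(s) - p'(s)) exp(-s); \<open>[:0, 0, 1:]\<close> is s^2.\<close>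

lemma exp_tail_has_derivative:
  "(exp_tail p has_real_derivative exp_tail ([:0, 0, 1:] * (p - pderiv p)) t) (at t)"
proof (cases t "0::real" rule: linorder_cases)
  case less
  have "((\<lambda>_. 0) has_real_derivative 0) (at t)" by simp
  then have "(exp_tail p has_real_derivative 0) (at t)"
    by (rule has_field_derivative_transform_within_open[where S = "{..<0}"])
      (use less in \<open>auto simp: exp_tail_def\<close>)
  then show ?thesis using less by (simp add: exp_tail_def)
next
  case greater
  have "((\<lambda>t. poly p (inverse t) * exp (- inverse t)) has_real_derivative
      exp_tail ([:0, 0, 1:] * (p - pderiv p)) t) (at t)"
    using greater
    by (auto intro!: derivative_eq_intros DERIV_chain2[where f = "poly p"] poly_DERIV
        simp: exp_tail_def algebra_simps power2_eq_square)
  then show ?thesis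
    by (rule has_field_derivative_transform_within_open[where S = "{0<..}"])
      (use greater in \<open>auto simp: exp_tail_def\<close>)
next
  case equal
  have "((\<lambda>h. exp_tail p h / h) \<longlongrightarrow> 0) (at_right 0)"
  proof -
    \<comment> \<open>The leading coefficient 0 multiplies the polynomial by 1/h, the factor that
      the difference quotient brings in.\<close>
    have "((\<lambda>h. poly (pCons 0 p) (inverse h) * exp (- inverse h)) \<longlongrightarrow> 0) (at_right 0)"
      using filterlim_compose[OF poly_mult_exp_tendsto_0 filterlim_inverse_at_top_right] .
    then show ?thesis
      by (rule Lim_transform_eventually)
        (auto simp: eventually_at_filter exp_tail_def field_simps)
  qed
  moreover have "((\<lambda>h. exp_tail p h / h) \<longlongrightarrow> 0) (at_left 0)"
    by (rule tendsto_eventually) (auto simp: eventually_at_filter exp_tail_def)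
  ultimately have "((\<lambda>h. exp_tail p h / h) \<longlongrightarrow> 0) (at 0)"
    by (simp add: filterlim_at_split)
  then show ?thesis using equal by (simp add: has_field_derivative_iff exp_tail_def)
qed

definition bump_deriv :: "nat \<Rightarrow> real \<Rightarrow> real" where
  "bump_deriv k = exp_tail (((\<lambda>p. [:0, 0, 1:] * (p - pderiv p)) ^^ k) 1)"

lemma bump_deriv_DERIV: "(bump_deriv k has_real_derivative bump_deriv (Suc k) t) (at t)"
  unfolding bump_deriv_def using exp_tail_has_derivative by simp

lemma bump_deriv_0: "bump_deriv 0 t = (if t > 0 then exp (- inverse t) else 0)"
  by (simp add: bump_deriv_def exp_tail_def)

definition box_bump :: "real^'n \<Rightarrow> real^'n \<Rightarrow> real^'n \<Rightarrow> real" where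
  "box_bump a b x = (\<Prod>i\<in>UNIV. bump_deriv 0 (x $ i - a $ i) * bump_deriv 0 (b $ i - x $ i))"

lemma C_k_box_bump:
  fixes a b :: "real^'n"
  shows "C_k n (box_bump a b)"
proof -
  have "((\<lambda>t. bump_deriv k (t - c)) has_real_derivative bump_deriv (Suc k) (t - c) * 1) (at t)"
    for k c t
    by (rule DERIV_chain2[OF bump_deriv_DERIV]) (auto intro!: derivative_eq_intros)
  then have 1: "C_k n (\<lambda>x :: real^'n. bump_deriv 0 (x $ i - a $ i))" for i
    by (intro C_k_coordinate[of "\<lambda>k t. bump_deriv k (t - a $ i)" n 0 i]) simp
  \<comment> \<open>The sign (-1)^k collects the inner derivatives of c - t, so that in the
    reflected family each member is again the derivative of the one before.\<close>
  have "((\<lambda>t. (-1) ^ k * bump_deriv k (c - t)) has_real_derivative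
      (-1) ^ k * (bump_deriv (Suc k) (c - t) * (-1))) (at t)" for k c t
    by (rule DERIV_cmult, rule DERIV_chain2[OF bump_deriv_DERIV])
      (auto intro!: derivative_eq_intros)
  then have 2: "C_k n (\<lambda>x :: real^'n. bump_deriv 0 (b $ i - x $ i))" for i
    using C_k_coordinate[of "\<lambda>k t. (-1) ^ k * bump_deriv k (b $ i - t)" n 0 i] by simp
  show ?thesis
    unfolding box_bump_def[abs_def] by (intro C_k_prod C_k_mult 1 2) auto
qed

lemma box_bump_range: "0 \<le> box_bump a b x" "box_bump a b x \<le> 1"
  by (auto simp: box_bump_def bump_deriv_0 intro!: prod_nonneg prod_le_1 mult_le_one)

lemma box_bump_pos_iff: "box_bump a b x > 0 \<longleftrightarrow> x \<in> box a b"
proof -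
  have "box_bump a b x \<noteq> 0 \<longleftrightarrow> x \<in> box a b"
    by (auto simp: box_bump_def bump_deriv_0 mem_box_cart split: if_splits)
  then show ?thesis using box_bump_range(1)[of a b x] by auto
qed

section \<open>Closure properties of the test functions\<close>

lemma test_functionsI:
  assumes "\<And>k. C_k k \<phi>" "compact K" "K \<subseteq> D" "\<And>x. x \<notin> K \<Longrightarrow> \<phi> x = 0"
  shows "\<phi> \<in> test_functions D"
proof -
  have "closure {x. \<phi> x \<noteq> 0} \<subseteq> K"
    using assms by (intro closure_minimal) (auto intro: compact_imp_closed)
  moreover from this have "compact (closure {x. \<phi> x \<noteq> 0})"
    using compact_Int_closed[OF assms(2) closed_closure, of "{x. \<phi> x \<noteq> 0}"]
    by (simp add: inf.absorb2)
  ultimately show ?thesis using assms unfolding test_functions_def by blast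
qed

lemma test_functions_C_k: "\<phi> \<in> test_functions D \<Longrightarrow> C_k k \<phi>"
  by (simp add: test_functions_def)

lemma test_functionsE:
  assumes "\<phi> \<in> test_functions D"
  obtains K where "compact K" "K \<subseteq> D" "\<forall>x. x \<notin> K \<longrightarrow> \<phi> x = 0"
proof
  let ?K = "closure {x. \<phi> x \<noteq> 0}"
  show "compact ?K" "?K \<subseteq> D" using assms by (auto simp: test_functions_def)
  show "\<forall>x. x \<notin> ?K \<longrightarrow> \<phi> x = 0" using closure_subset[of "{x. \<phi> x \<noteq> 0}"] by blast
qed

lemma partial_deriv_zero_outside:
  assumes "closed K" "\<forall>x. x \<notin> K \<longrightarrow> \<phi> x = 0" "x \<notin> K"
  shows "partial_deriv j \<phi> x = 0"
proof -
  have "((\<lambda>_. 0) has_derivative (\<lambda>_. 0)) (at x)" by simp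
  then have "(\<phi> has_derivative (\<lambda>_. 0)) (at x)"
    by (rule has_derivative_transform_within_open[where s = "- K"]) (use assms in auto)
  then show ?thesis by (simp add: partial_deriv_eq)
qed

lemma test_functions_partial_deriv:
  assumes "\<phi> \<in> test_functions D"
  shows "partial_deriv j \<phi> \<in> test_functions D"
proof -
  obtain K where K: "compact K" "K \<subseteq> D" "\<forall>x. x \<notin> K \<longrightarrow> \<phi> x = 0"
    by (rule test_functionsE[OF assms])
  have "C_k k (partial_deriv j \<phi>)" for k
    using test_functions_C_k[OF assms, of "Suc k"] by simp
  then show ?thesis
    using K partial_deriv_zero_outside[OF compact_imp_closed[OF K(1)] K(3)]
    by (intro test_functionsI[of _ K]) auto
qed

lemma test_functions_mono: "D \<subseteq> E \<Longrightarrow> test_functions D \<subseteq> test_functions E"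
  by (auto simp: test_functions_def)

lemma test_functions_translate:
  assumes "\<phi> \<in> test_functions D" "\<And>x. x \<in> D \<Longrightarrow> x - a \<in> E"
  shows "(\<lambda>x. \<phi> (x + a)) \<in> test_functions E"
proof -
  obtain K where K: "compact K" "K \<subseteq> D" "\<forall>x. x \<notin> K \<longrightarrow> \<phi> x = 0"
    by (rule test_functionsE[OF assms(1)])
  show ?thesis
  proof (rule test_functionsI)
    show "compact ((\<lambda>x. x - a) ` K)" 
      using compact_translation[OF K(1), of "-a"] by simp
    show "(\<lambda>x. x - a) ` K \<subseteq> E" using assms(2) K by auto
    fix x assume "x \<notin> (\<lambda>x. x - a) ` K"
    then have "x + a \<notin> K" by (metis add_diff_cancel_right' image_eqI)
    then show "\<phi> (x + a) = 0" using K by auto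
  qed (intro C_k_translate test_functions_C_k[OF assms(1)])
qed

lemma test_functions_add:
  assumes "f \<in> test_functions D" "g \<in> test_functions D"
  shows "(\<lambda>x. f x + g x) \<in> test_functions D"
proof -
  obtain K where K: "compact K" "K \<subseteq> D" "\<forall>x. x \<notin> K \<longrightarrow> f x = 0"
    by (rule test_functionsE[OF assms(1)])
  obtain L where L: "compact L" "L \<subseteq> D" "\<forall>x. x \<notin> L \<longrightarrow> g x = 0"
    by (rule test_functionsE[OF assms(2)])
  show ?thesis
    by (rule test_functionsI[of _ "K \<union> L"]) (use K L assms in \<open>auto intro: C_k_add test_functions_C_k\<close>)
qed

lemma test_functions_scale:
  assumes "f \<in> test_functions D"
  shows "(\<lambda>x. c * f x) \<in> test_functions D"
proof -
  obtain K where K: "compact K" "K \<subseteq> D" "\<forall>x. x \<notin> K \<longrightarrow> f x = 0"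
    by (rule test_functionsE[OF assms(1)])
  show ?thesis
    by (rule test_functionsI[of _ K]) (use K assms in \<open>auto intro: C_k_mult C_k_const test_functions_C_k\<close>)
qed

lemma test_functions_zero: "(\<lambda>x. 0) \<in> test_functions D"
  by (rule test_functionsI[of _ "{}"]) (auto intro: C_k_const)

lemma test_functions_box_union:
  fixes I :: "((real^'n) \<times> (real^'n)) set"
  assumes "finite I" "\<And>a b. (a, b) \<in> I \<Longrightarrow> cbox a b \<subseteq> D"
  shows "(\<lambda>x. 1 - (\<Prod>(a, b)\<in>I. (1 - box_bump a b x) ^ m)) \<in> test_functions D"
proof (rule test_functionsI)
  show "compact (\<Union>(a, b)\<in>I. cbox a b)" using assms(1) by auto
  show "(\<Union>(a, b)\<in>I. cbox a b) \<subseteq> D" using assms(2) by auto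
next
  fix x assume x: "x \<notin> (\<Union>(a, b)\<in>I. cbox a b)"
  have "box_bump a b x = 0" if "(a, b) \<in> I" for a b
  proof -
    have "x \<notin> box a b" using that x box_subset_cbox by blast
    then show ?thesis using box_bump_pos_iff[of a b x] box_bump_range(1)[of a b x] by auto
  qed
  then have "(\<Prod>(a, b)\<in>I. (1 - box_bump a b x) ^ m) = 1"
    by (intro prod.neutral) auto
  then show "1 - (\<Prod>(a, b)\<in>I. (1 - box_bump a b x) ^ m) = 0" by simp
next
  fix k
  have "C_k k (\<lambda>x. (case p of (a, b) \<Rightarrow> (1 - box_bump a b x) ^ m))" for p :: "(real^'n) \<times> (real^'n)"
    using C_k_power[OF C_k_add[OF C_k_const[of k 1] C_k_minus[OF C_k_box_bump]]]
    by (cases p) simp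
  from C_k_add[OF C_k_const[of k 1] C_k_minus[OF C_k_prod[OF assms(1) this]]]
  show "C_k k (\<lambda>x. 1 - (\<Prod>(a, b)\<in>I. (1 - box_bump a b x) ^ m))" by simp
qed

section \<open>Translation and integration by parts\<close>

lemma continuous_borel_measurable_lebesgue:
  "continuous_on UNIV f \<Longrightarrow> f \<in> borel_measurable lebesgue"
  by (intro measurable_completion) (simp add: borel_measurable_continuous_onI)

text \<open>Borel measurability is asked for because translation invariance is expressed through an
  image measure of \<open>lborel\<close>; for this reason the Poincare argument works with Borel
  representatives.\<close>

lemma integral_lebesgue_translate:
  fixes f :: "'a::euclidean_space \<Rightarrow> real"
  assumes [measurable]: "f \<in> borel_measurable borel"
  shows "(\<integral>x. f (x + a) \<partial>lebesgue) = (\<integral>x. f x \<partial>lebesgue)"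
proof -
  have "(\<integral>x. f x \<partial>lborel) = (\<integral>x. f x \<partial>distr lborel borel ((+) a))"
    by (simp add: lborel_distr_plus)
  also have "\<dots> = (\<integral>x. f (a + x) \<partial>lborel)"
    by (rule integral_distr) auto
  finally show ?thesis by (simp add: integral_completion add.commute)
qed

lemma test_functions_continuous: "\<phi> \<in> test_functions D \<Longrightarrow> continuous_on UNIV \<phi>"
  by (rule C_k_continuous[OF test_functions_C_k])

lemma test_functions_measurable: "\<phi> \<in> test_functions D \<Longrightarrow> \<phi> \<in> borel_measurable borel"
  by (intro borel_measurable_continuous_onI test_functions_continuous)

lemma test_functions_bounded:
  assumes "\<phi> \<in> test_functions D"
  obtains C where "C \<ge> 0" "\<forall>x. \<bar>\<phi> x\<bar> \<le> C"
proof -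
  obtain K where K: "compact K" "K \<subseteq> D" "\<forall>x. x \<notin> K \<longrightarrow> \<phi> x = 0"
    by (rule test_functionsE[OF assms])
  have "compact (\<phi> ` K)"
    using test_functions_continuous[OF assms] K(1) continuous_on_subset compact_continuous_image
    by blast
  then obtain C where C: "\<forall>x\<in>K. \<bar>\<phi> x\<bar> \<le> C"
    using compact_imp_bounded[of "\<phi> ` K"] by (auto simp: bounded_iff)
  have "\<bar>\<phi> x\<bar> \<le> max 0 C" for x
    by (cases "x \<in> K") (use C K(3) in \<open>auto simp: le_max_iff_disj\<close>)
  then show ?thesis using that[of "max 0 C"] by simp
qed

lemma integrable_mult_bounded:
  fixes f g :: "'a \<Rightarrow> real"
  assumes "integrable M f" "g \<in> borel_measurable M" "\<And>x. \<bar>g x\<bar> \<le> C"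
  shows "integrable M (\<lambda>x. f x * g x)"
proof (rule Bochner_Integration.integrable_bound)
  show "integrable M (\<lambda>x. C * f x)" using assms(1) by simp
  show "AE x in M. norm (f x * g x) \<le> norm (C * f x)"
    using assms(3) by (auto simp: abs_mult mult.commute[of "\<bar>f _\<bar>"] intro!: mult_right_mono AE_I2
        intro: order_trans[OF _ abs_ge_self])
qed (use assms(2) borel_measurable_integrable[OF assms(1)] in measurable)

lemma integrable_mult_test_function:
  assumes "integrable lebesgue f" "\<phi> \<in> test_functions D"
  shows "integrable lebesgue (\<lambda>x. f x * \<phi> x)"
proof -
  obtain C where C: "C \<ge> 0" "\<forall>x. \<bar>\<phi> x\<bar> \<le> C" by (rule test_functions_bounded[OF assms(2)])
  show ?thesis
    by (rule integrable_mult_bounded[OF assms(1) _ C(2)[rule_format]])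
      (intro continuous_borel_measurable_lebesgue test_functions_continuous[OF assms(2)])
qed

lemma test_functions_integrable:
  assumes "\<phi> \<in> test_functions D"
  shows "integrable lebesgue \<phi>"
proof -
  obtain K where K: "compact K" "K \<subseteq> D" "\<forall>x. x \<notin> K \<longrightarrow> \<phi> x = 0"
    by (rule test_functionsE[OF assms])
  have "K \<in> lmeasurable" using K(1) lmeasurable_compact by blast
  then have "integrable lebesgue (indicat_real K)" by (simp add: lmeasurable_iff_integrable)
  from integrable_mult_test_function[OF this assms]
  moreover have "indicat_real K x * \<phi> x = \<phi> x" for x
    using K(3) by (cases "x \<in> K") auto
  ultimately show ?thesis by simp
qed

lemma directional_derivative_translate:
  fixes \<phi> :: "real^'n \<Rightarrow> real"
  assumes "\<phi> \<in> test_functions D"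
  shows "((\<lambda>t. \<phi> (x - t *\<^sub>R h)) has_real_derivative
          - (\<Sum>j\<in>UNIV. h $ j * partial_deriv j \<phi> (x - t *\<^sub>R h))) (at t within S)"
proof -
  note D = C_k_has_derivative[OF test_functions_C_k[OF assms]]
  have "((\<lambda>t. x - t *\<^sub>R h) has_derivative (\<lambda>s. - (s *\<^sub>R h))) (at t within S)"
    by (auto intro!: derivative_eq_intros)
  from has_derivative_compose[OF this D]
  show ?thesis
    by (rule has_derivative_imp_has_field_derivative)
      (simp add: sum_distrib_left sum_negf mult.assoc mult.left_commute)
qed

text \<open>The derivative falls on the smooth factor, hence integrability of \<open>f\<close>
  suffices for differentiating under the integral.\<close>

lemma translation_integral_derivative:
  fixes \<phi> f :: "real^'n \<Rightarrow> real"
  assumes f: "integrable lebesgue f" and \<phi>: "\<phi> \<in> test_functions D"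
  shows "((\<lambda>t. \<integral>x. f x * \<phi> (x - t *\<^sub>R h) \<partial>lebesgue) has_real_derivative
          - (\<integral>x. f x * (\<Sum>j\<in>UNIV. h $ j * partial_deriv j \<phi> (x - t *\<^sub>R h)) \<partial>lebesgue)) (at t)"
proof -
  define d where "d y = (\<Sum>j\<in>UNIV. h $ j * partial_deriv j \<phi> y)" for y
  \<comment> \<open>Being a test function itself, the directional derivative is bounded. Its bound
    is a Lipschitz constant of \<phi> along \<open>h\<close>, and \<open>C * \<bar>f x\<bar>\<close>
    dominates the difference quotients.\<close>
  have "d \<in> test_functions D"
    unfolding d_def[abs_def]
  proof (induction rule: finite_induct[OF finite[of UNIV]])
    case 1 then show ?case by (simp add: test_functions_zero)
  next
    case (2 j J)
    then show ?case
      using test_functions_add[OF test_functions_scale[OF test_functions_partial_deriv[OF \<phi>, of j], of "h $ j"]]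
      by simp
  qed
  then obtain C where C: "C \<ge> 0" "\<forall>y. \<bar>d y\<bar> \<le> C"
    by (rule test_functions_bounded)
  have D: "((\<lambda>t. \<phi> (x - t *\<^sub>R h)) has_real_derivative - d (x - t *\<^sub>R h)) (at t within S)" for x t S
    unfolding d_def by (rule directional_derivative_translate[OF \<phi>])
  have lip: "\<bar>\<phi> (x - s *\<^sub>R h) - \<phi> (x - t *\<^sub>R h)\<bar> \<le> C * \<bar>s - t\<bar>" for x s t
    using field_differentiable_bound[OF convex_UNIV D, of x C s t] C by simp
  have meas: "(\<lambda>x. \<phi> (x - s *\<^sub>R h)) \<in> borel_measurable lebesgue" for s
    using test_functions_continuous[OF \<phi>]
    by (intro continuous_borel_measurable_lebesgue)
      (auto intro!: continuous_on_compose2[of UNIV \<phi> UNIV "\<lambda>x. x - s *\<^sub>R h"] continuous_intros)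
  obtain C' where C': "C' \<ge> 0" "\<forall>y. \<bar>\<phi> y\<bar> \<le> C'" by (rule test_functions_bounded[OF \<phi>])
  have int: "integrable lebesgue (\<lambda>x. f x * \<phi> (x - s *\<^sub>R h))" for s
    by (rule integrable_mult_bounded[OF f meas]) (rule C'(2)[rule_format])
  have [measurable]: "f \<in> borel_measurable lebesgue" using f by auto
  let ?F = "\<lambda>t. \<integral>x. f x * \<phi> (x - t *\<^sub>R h) \<partial>lebesgue"
  have "((\<lambda>s. (?F s - ?F t) / (s - t)) \<longlongrightarrow> (\<integral>x. f x * (- d (x - t *\<^sub>R h)) \<partial>lebesgue)) (at t)"
    unfolding tendsto_at_iff_sequentially
  proof (intro allI impI)
    fix X assume X: "\<forall>i. X i \<in> UNIV - {t}" "X \<longlonglongrightarrow> t"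
    then have ne: "X i \<noteq> t" for i by auto
    define q where "q i x = (\<phi> (x - X i *\<^sub>R h) - \<phi> (x - t *\<^sub>R h)) / (X i - t)" for i x
    have eq: "(?F (X i) - ?F t) / (X i - t) = (\<integral>x. f x * q i x \<partial>lebesgue)" for i
    proof -
      have "(?F (X i) - ?F t) / (X i - t) =
          (\<integral>x. (f x * \<phi> (x - X i *\<^sub>R h) - f x * \<phi> (x - t *\<^sub>R h)) / (X i - t) \<partial>lebesgue)"
        by (simp add: Bochner_Integration.integral_diff[OF int int])
      then show ?thesis by (simp add: q_def right_diff_distrib)
    qed
    have lim: "(\<lambda>i. q i x) \<longlonglongrightarrow> - d (x - t *\<^sub>R h)" for x
    proof -
      have "((\<lambda>s. (\<phi> (x - s *\<^sub>R h) - \<phi> (x - t *\<^sub>R h)) / (s - t)) \<longlongrightarrow> - d (x - t *\<^sub>R h)) (at t)"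
        using D[of x t UNIV] by (simp add: has_field_derivative_iff)
      then show ?thesis
        using X unfolding tendsto_at_iff_sequentially q_def o_def by blast
    qed
    have qm: "q i \<in> borel_measurable lebesgue" for i
      unfolding q_def[abs_def] by (intro borel_measurable_divide borel_measurable_diff meas) auto
    have "(\<lambda>i. \<integral>x. f x * q i x \<partial>lebesgue) \<longlonglongrightarrow> (\<integral>x. f x * (- d (x - t *\<^sub>R h)) \<partial>lebesgue)"
    proof (rule integral_dominated_convergence[where w = "\<lambda>x. C * \<bar>f x\<bar>"])
      show "(\<lambda>x. f x * (- d (x - t *\<^sub>R h))) \<in> borel_measurable lebesgue"
      proof (rule borel_measurable_LIMSEQ_real[where u = "\<lambda>i x. f x * q i x"])
        show "(\<lambda>i. f x * q i x) \<longlonglongrightarrow> f x * (- d (x - t *\<^sub>R h))" for x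
          by (intro tendsto_mult lim tendsto_const)
      qed (intro borel_measurable_times qm, simp)
      show "(\<lambda>x. f x * q i x) \<in> borel_measurable lebesgue" for i using qm by measurable
      show "integrable lebesgue (\<lambda>x. C * \<bar>f x\<bar>)" using f by simp
      show "AE x in lebesgue. (\<lambda>i. f x * q i x) \<longlonglongrightarrow> f x * (- d (x - t *\<^sub>R h))"
        by (intro AE_I2 tendsto_mult lim tendsto_const)
      show "AE x in lebesgue. norm (f x * q i x) \<le> C * \<bar>f x\<bar>" for i
      proof (intro AE_I2)
        fix x
        have "\<bar>q i x\<bar> \<le> C"
          using lip[of x "X i" t] ne[of i] by (simp add: q_def abs_divide divide_le_eq)
        then show "norm (f x * q i x) \<le> C * \<bar>f x\<bar>"
          by (simp add: abs_mult mult.commute[of "\<bar>f x\<bar>"] mult_right_mono)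
      qed
    qed
    then show "((\<lambda>s. (?F s - ?F t) / (s - t)) \<circ> X) \<longlonglongrightarrow> (\<integral>x. f x * (- d (x - t *\<^sub>R h)) \<partial>lebesgue)"
      by (simp add: o_def eq)
  qed
  then show ?thesis
    by (simp add: has_field_derivative_iff d_def)
qed

lemma translation_integral_derivative_axis:
  fixes \<phi> f :: "real^'n \<Rightarrow> real"
  assumes "integrable lebesgue f" and "\<phi> \<in> test_functions D"
  shows "((\<lambda>t. \<integral>x. f x * \<phi> (x - t *\<^sub>R axis j 1) \<partial>lebesgue) has_real_derivative
          - (\<integral>x. f x * partial_deriv j \<phi> x \<partial>lebesgue)) (at 0)"
proof -
  have "(\<Sum>i\<in>UNIV. axis j 1 $ i * partial_deriv i \<phi> x) = partial_deriv j \<phi> x" for x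
    by (subst sum.remove[of _ j]) (auto simp: axis_def intro!: sum.neutral)
  then show ?thesis
    using translation_integral_derivative[OF assms, of "axis j 1" 0] by simp
qed

lemma integral_translate_swap:
  assumes "u \<in> test_functions D" "v \<in> test_functions D"
  shows "(\<integral>x. u x * v (x - a) \<partial>lebesgue) = (\<integral>x. v x * u (x + a) \<partial>lebesgue)"
proof -
  have [measurable]: "u \<in> borel_measurable borel" "v \<in> borel_measurable borel"
    using assms test_functions_measurable by auto
  have "(\<lambda>x. u x * v (x - a)) \<in> borel_measurable borel" by measurable
  from integral_lebesgue_translate[OF this, of a] show ?thesis
    by (simp add: mult.commute)
qed

text \<open>Both sides come from differentiating the integral of u(x) v(x - t e_j) at t = 0, once as
  it stands and once after a substitution that moves the shift onto \<open>u\<close>.\<close>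

lemma integration_by_parts_test_functions:
  fixes u v :: "real^'n \<Rightarrow> real"
  assumes u: "u \<in> test_functions D" and v: "v \<in> test_functions D"
  shows "(\<integral>x. u x * partial_deriv j v x \<partial>lebesgue) = - (\<integral>x. partial_deriv j u x * v x \<partial>lebesgue)"
proof -
  note 1 = translation_integral_derivative_axis[OF test_functions_integrable[OF u] v, of j]
  have "((\<lambda>t. \<integral>x. v x * u (x - (-t) *\<^sub>R axis j 1) \<partial>lebesgue) has_real_derivative
      (- (\<integral>x. v x * partial_deriv j u x \<partial>lebesgue)) * (- 1)) (at 0)"
    by (rule DERIV_chain2[where g = uminus and
          f = "\<lambda>t. \<integral>x. v x * u (x - t *\<^sub>R axis j 1) \<partial>lebesgue"])
      (use translation_integral_derivative_axis[OF test_functions_integrable[OF v] u, of j] in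
        \<open>auto intro!: derivative_eq_intros\<close>)
  then have "((\<lambda>t. \<integral>x. u x * v (x - t *\<^sub>R axis j 1) \<partial>lebesgue) has_real_derivative
      (\<integral>x. v x * partial_deriv j u x \<partial>lebesgue)) (at 0)"
    by (simp add: integral_translate_swap[OF u v])
  from DERIV_unique[OF 1 this] show ?thesis by (simp add: mult.commute)
qed

text \<open>The integral of \<open>partial_deriv j u\<close> against the shifted \<open>v\<close> is
  differentiated in the shift, before and after one integration by parts. Only first derivatives
  occur, so symmetry of second derivatives is not invoked. Korn's inequality rests on this
  exchange.\<close>

lemma integral_partial_deriv_swap:
  fixes u v :: "real^'n \<Rightarrow> real"
  assumes u: "u \<in> test_functions D" and v: "v \<in> test_functions D"
  shows "(\<integral>x. partial_deriv j u x * partial_deriv i v x \<partial>lebesgue) =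
         (\<integral>x. partial_deriv i u x * partial_deriv j v x \<partial>lebesgue)"
proof -
  have duj: "partial_deriv j u \<in> test_functions D" and dvj: "partial_deriv j v \<in> test_functions D"
    using u v test_functions_partial_deriv by auto
  have diff: "v differentiable at y" for y
    by (rule C_k_differentiable[OF test_functions_C_k[OF v]])
  note 1 = translation_integral_derivative_axis[OF test_functions_integrable[OF duj] v, of i]
  have eq: "(\<integral>x. partial_deriv j u x * v (x - t *\<^sub>R axis i 1) \<partial>lebesgue) =
      - (\<integral>x. partial_deriv j v x * u (x - (-t) *\<^sub>R axis i 1) \<partial>lebesgue)" for t
  proof -
    have "(\<lambda>x. v (x + (- (t *\<^sub>R axis i 1)))) \<in> test_functions UNIV"
      by (rule test_functions_translate[OF v]) auto
    from integration_by_parts_test_functions[OF _ this, of u j]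
    have "(\<integral>x. partial_deriv j u x * v (x - t *\<^sub>R axis i 1) \<partial>lebesgue) =
        - (\<integral>x. u x * partial_deriv j v (x - t *\<^sub>R axis i 1) \<partial>lebesgue)"
      using u test_functions_mono[of D UNIV]
        partial_deriv_translate[of v _ "- (t *\<^sub>R axis i 1)" j, OF diff] by auto
    then show ?thesis by (simp add: integral_translate_swap[OF u dvj])
  qed
  have "((\<lambda>t. - (\<integral>x. partial_deriv j v x * u (x - (-t) *\<^sub>R axis i 1) \<partial>lebesgue)) has_real_derivative
      - ((- (\<integral>x. partial_deriv j v x * partial_deriv i u x \<partial>lebesgue)) * (- 1))) (at 0)"
    by (rule DERIV_minus, rule DERIV_chain2[where g = uminus and
          f = "\<lambda>t. \<integral>x. partial_deriv j v x * u (x - t *\<^sub>R axis i 1) \<partial>lebesgue"])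
      (use translation_integral_derivative_axis[OF test_functions_integrable[OF dvj] u, of i] in
        \<open>auto intro!: derivative_eq_intros\<close>)
  then have "((\<lambda>t. \<integral>x. partial_deriv j u x * v (x - t *\<^sub>R axis i 1) \<partial>lebesgue) has_real_derivative
      - (\<integral>x. partial_deriv j v x * partial_deriv i u x \<partial>lebesgue)) (at 0)"
    unfolding eq by simp
  from DERIV_unique[OF 1 this] show ?thesis by (simp add: mult.commute)
qed

lemma integral_partial_deriv_test_function:
  assumes \<phi>: "\<phi> \<in> test_functions D"
  shows "(\<integral>x. partial_deriv j \<phi> x \<partial>lebesgue) = 0"
proof -
  obtain K where K: "compact K" "K \<subseteq> D" "\<forall>x. x \<notin> K \<longrightarrow> \<phi> x = 0"
    by (rule test_functionsE[OF \<phi>])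
  obtain R where R: "K \<subseteq> ball 0 R" "R > 0"
    using bounded_subset_ballD[OF compact_imp_bounded[OF K(1)]] by blast
  \<comment> \<open>An integrable stand-in for the constant 1: its radius exceeds that of the
    support by 1, so it covers all shifts by less than 1.\<close>
  let ?f = "indicat_real (cball 0 (R + 1))"
  have f: "integrable lebesgue ?f"
    using lmeasurable_cball lmeasurable_iff_integrable by blast
  have const: "(\<integral>x. ?f x * \<phi> (x - t *\<^sub>R axis j 1) \<partial>lebesgue) = (\<integral>x. \<phi> x \<partial>lebesgue)"
    if "t \<in> ball 0 1" for t :: real
  proof -
    have *: "?f x * \<phi> (x - t *\<^sub>R axis j 1) = \<phi> (x + - (t *\<^sub>R axis j 1))" for x
    proof (cases "x \<in> cball 0 (R + 1)")
      case False
      have "norm x \<le> norm (x - t *\<^sub>R axis j 1) + norm (t *\<^sub>R (axis j 1 :: real^'a))"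
        using norm_triangle_ineq[of "x - t *\<^sub>R axis j 1" "t *\<^sub>R axis j 1"] by simp
      then have "norm (x - t *\<^sub>R axis j 1) \<ge> R" using False that by (simp add: norm_axis_1)
      then have "x - t *\<^sub>R axis j 1 \<notin> K" using R(1) by auto
      then show ?thesis using K(3) by simp
    qed simp
    show ?thesis
      unfolding * by (rule integral_lebesgue_translate[OF test_functions_measurable[OF \<phi>]])
  qed
  have "((\<lambda>t. \<integral>x. ?f x * \<phi> (x - t *\<^sub>R axis j 1) \<partial>lebesgue) has_real_derivative 0) (at 0)"
    by (rule has_field_derivative_transform_within_open[of "\<lambda>t. \<integral>x. \<phi> x \<partial>lebesgue" 0 0 "ball 0 1"])
      (use const in auto)
  from DERIV_unique[OF translation_integral_derivative_axis[OF f \<phi>, of j] this]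
  have "(\<integral>x. ?f x * partial_deriv j \<phi> x \<partial>lebesgue) = 0" by simp
  moreover have "?f x * partial_deriv j \<phi> x = partial_deriv j \<phi> x" for x
    using partial_deriv_zero_outside[OF compact_imp_closed[OF K(1)] K(3)] R
    by (cases "x \<in> K") (auto simp: subset_iff)
  ultimately show ?thesis by simp
qed

section \<open>Density of test functions in the square integrable functions\<close>

lemma integrable_inner_of_square_integrable:
  fixes f g :: "'a \<Rightarrow> 'b::euclidean_space"
  assumes [measurable]: "f \<in> borel_measurable M" "g \<in> borel_measurable M"
    and "integrable M (\<lambda>x. (norm (f x))\<^sup>2)" "integrable M (\<lambda>x. (norm (g x))\<^sup>2)"
  shows "integrable M (\<lambda>x. f x \<bullet> g x)"
proof (rule Bochner_Integration.integrable_bound)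
  show "integrable M (\<lambda>x. (norm (f x))\<^sup>2 + (norm (g x))\<^sup>2)" using assms by simp
  have "\<bar>f x \<bullet> g x\<bar> \<le> (norm (f x))\<^sup>2 + (norm (g x))\<^sup>2" for x
  proof -
    have "\<bar>f x \<bullet> g x\<bar> \<le> norm (f x) * norm (g x)" by (rule Cauchy_Schwarz_ineq2)
    moreover have "2 * (norm (f x) * norm (g x)) \<le> (norm (f x))\<^sup>2 + (norm (g x))\<^sup>2"
      using sum_squares_bound[of "norm (f x)" "norm (g x)"] by simp
    moreover have "0 \<le> norm (f x) * norm (g x)" by simp
    ultimately show ?thesis by linarith
  qed
  then show "AE x in M. norm (f x \<bullet> g x) \<le> norm ((norm (f x))\<^sup>2 + (norm (g x))\<^sup>2)"
    by auto
qed measurable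

lemma quadratic_nonneg_discriminant:
  fixes a b c :: real
  assumes nn: "\<And>t. 0 \<le> a - 2 * t * b + t\<^sup>2 * c"
  shows "b\<^sup>2 \<le> a * c"
proof (cases "c = 0")
  case True
  have "b = 0"
  proof (rule ccontr)
    assume "b \<noteq> 0"
    \<comment> \<open>This argument makes a - 2 t b equal to -1.\<close>
    then show False using nn[of "(a + 1) / (2 * b)"] True by simp
  qed
  then show ?thesis using True by simp
next
  case False
  have "c \<ge> 0"
  proof (rule ccontr)
    assume "\<not> c \<ge> 0"
    then have c: "c < 0" by simp
    \<comment> \<open>At this \<open>t\<close> the quadratic term is -(|a| + 1). Adding the
      inequalities at \<open>t\<close> and \<open>- t\<close> removes the linear term and leaves 2 a
      - 2 (|a| + 1) \<ge> 0, which is impossible.\<close>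
    define t where "t = sqrt ((\<bar>a\<bar> + 1) / (- c))"
    have "t\<^sup>2 * c = - (\<bar>a\<bar> + 1)" using c by (simp add: t_def field_simps)
    then show False using nn[of t] nn[of "- t"] by simp
  qed
  then have "c > 0" using False by simp
  then show ?thesis using nn[of "b / c"] by (simp add: field_simps power2_eq_square)
qed

lemma Cauchy_Schwarz_integral:
  fixes f g :: "'a \<Rightarrow> 'b::euclidean_space"
  assumes "f \<in> borel_measurable M" "g \<in> borel_measurable M"
    and "integrable M (\<lambda>x. (norm (f x))\<^sup>2)" "integrable M (\<lambda>x. (norm (g x))\<^sup>2)"
  shows "\<bar>\<integral>x. f x \<bullet> g x \<partial>M\<bar> \<le> sqrt (\<integral>x. (norm (f x))\<^sup>2 \<partial>M) * sqrt (\<integral>x. (norm (g x))\<^sup>2 \<partial>M)"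
proof -
  note fg = integrable_inner_of_square_integrable[OF assms]
  have "(\<integral>x. f x \<bullet> g x \<partial>M)\<^sup>2 \<le> (\<integral>x. (norm (f x))\<^sup>2 \<partial>M) * (\<integral>x. (norm (g x))\<^sup>2 \<partial>M)"
  proof (rule quadratic_nonneg_discriminant)
    fix t :: real
    have "0 \<le> (\<integral>x. (norm (f x - t *\<^sub>R g x))\<^sup>2 \<partial>M)" by simp
    also have "\<dots> = (\<integral>x. (norm (f x))\<^sup>2 - (2 * t) * (f x \<bullet> g x) + t\<^sup>2 * (norm (g x))\<^sup>2 \<partial>M)"
      by (intro Bochner_Integration.integral_cong refl)
        (simp add: power2_norm_eq_inner inner_diff inner_commute algebra_simps power2_eq_square[of t])
    also have "\<dots> = (\<integral>x. (norm (f x))\<^sup>2 \<partial>M) - 2 * t * (\<integral>x. f x \<bullet> g x \<partial>M)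
        + t\<^sup>2 * (\<integral>x. (norm (g x))\<^sup>2 \<partial>M)"
      using assms(3,4) fg by simp
    finally show "0 \<le> \<dots>" .
  qed
  then have "sqrt ((\<integral>x. f x \<bullet> g x \<partial>M)\<^sup>2) \<le>
      sqrt ((\<integral>x. (norm (f x))\<^sup>2 \<partial>M) * (\<integral>x. (norm (g x))\<^sup>2 \<partial>M))"
    by (rule real_sqrt_le_mono)
  then show ?thesis by (simp add: real_sqrt_mult)
qed

text \<open>The L2 closure of the test functions; squared distances keep square roots out of the
  approximation arguments.\<close>

definition test_approximable :: "(real^'n) set \<Rightarrow> (real^'n \<Rightarrow> real) \<Rightarrow> bool" where
  "test_approximable D w \<longleftrightarrow> w \<in> borel_measurable lebesgue \<and> integrable lebesgue (\<lambda>x. (w x)\<^sup>2) \<and>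
     (\<forall>e>0. \<exists>\<eta>\<in>test_functions D. (\<integral>x. (w x - \<eta> x)\<^sup>2 \<partial>lebesgue) < e)"

lemma test_functions_square_integrable:
  assumes "\<phi> \<in> test_functions D"
  shows "integrable lebesgue (\<lambda>x. (\<phi> x)\<^sup>2)"
  using integrable_mult_test_function[OF test_functions_integrable[OF assms] assms]
  by (simp add: power2_eq_square)

lemma square_integrable_add:
  fixes v w :: "'a \<Rightarrow> real"
  assumes [measurable]: "v \<in> borel_measurable M" "w \<in> borel_measurable M"
    and "integrable M (\<lambda>x. (v x)\<^sup>2)" "integrable M (\<lambda>x. (w x)\<^sup>2)"
  shows "integrable M (\<lambda>x. (v x + w x)\<^sup>2)"
    "(\<integral>x. (v x + w x)\<^sup>2 \<partial>M) \<le> 2 * (\<integral>x. (v x)\<^sup>2 \<partial>M) + 2 * (\<integral>x. (w x)\<^sup>2 \<partial>M)"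
proof -
  have le: "(a + b)\<^sup>2 \<le> 2 * a\<^sup>2 + 2 * b\<^sup>2" for a b :: real
    using sum_squares_bound[of a b] by (simp add: power2_sum)
  have i: "integrable M (\<lambda>x. 2 * (v x)\<^sup>2 + 2 * (w x)\<^sup>2)" using assms by simp
  show int: "integrable M (\<lambda>x. (v x + w x)\<^sup>2)"
    by (rule Bochner_Integration.integrable_bound[OF i]) (use le in auto)
  have "(\<integral>x. (v x + w x)\<^sup>2 \<partial>M) \<le> (\<integral>x. 2 * (v x)\<^sup>2 + 2 * (w x)\<^sup>2 \<partial>M)"
    by (rule integral_mono[OF int i]) (rule le)
  then show "(\<integral>x. (v x + w x)\<^sup>2 \<partial>M) \<le> 2 * (\<integral>x. (v x)\<^sup>2 \<partial>M) + 2 * (\<integral>x. (w x)\<^sup>2 \<partial>M)"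
    using assms by simp
qed

lemma square_integrable_diff:
  fixes v w :: "'a \<Rightarrow> real"
  assumes "v \<in> borel_measurable M" "w \<in> borel_measurable M"
    and "integrable M (\<lambda>x. (v x)\<^sup>2)" "integrable M (\<lambda>x. (w x)\<^sup>2)"
  shows "integrable M (\<lambda>x. (v x - w x)\<^sup>2)"
  using square_integrable_add(1)[of v M "\<lambda>x. - w x"] assms by simp

lemma test_approximableD:
  assumes "test_approximable D w" "e > 0"
  obtains \<eta> where "\<eta> \<in> test_functions D" "(\<integral>x. (w x - \<eta> x)\<^sup>2 \<partial>lebesgue) < e"
    "\<eta> \<in> borel_measurable lebesgue" "integrable lebesgue (\<lambda>x. (\<eta> x)\<^sup>2)"
    "integrable lebesgue (\<lambda>x. (w x - \<eta> x)\<^sup>2)"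
proof -
  obtain \<eta> where \<eta>: "\<eta> \<in> test_functions D" "(\<integral>x. (w x - \<eta> x)\<^sup>2 \<partial>lebesgue) < e"
    using assms unfolding test_approximable_def by blast
  have m: "\<eta> \<in> borel_measurable lebesgue"
    by (intro continuous_borel_measurable_lebesgue test_functions_continuous[OF \<eta>(1)])
  show ?thesis
    using that[OF \<eta> m test_functions_square_integrable[OF \<eta>(1)]] assms(1) m
      test_functions_square_integrable[OF \<eta>(1)]
    unfolding test_approximable_def by (blast intro: square_integrable_diff)
qed

lemma test_approximable_add:
  assumes v: "test_approximable D v" and w: "test_approximable D w"
  shows "test_approximable D (\<lambda>x. v x + w x)"
  unfolding test_approximable_def
proof (intro conjI allI impI)
  have m: "v \<in> borel_measurable lebesgue" "w \<in> borel_measurable lebesgue"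
    "integrable lebesgue (\<lambda>x. (v x)\<^sup>2)" "integrable lebesgue (\<lambda>x. (w x)\<^sup>2)"
    using v w by (auto simp: test_approximable_def)
  show "(\<lambda>x. v x + w x) \<in> borel_measurable lebesgue" using m by simp
  show "integrable lebesgue (\<lambda>x. (v x + w x)\<^sup>2)" by (rule square_integrable_add[OF m])
  fix e :: real assume "e > 0"
  \<comment> \<open>The square of a sum is at most twice the sum of the squares, so two errors below
    e/4 add up to less than e.\<close>
  then have e: "e / 4 > 0" by simp
  obtain \<eta> where \<eta>: "\<eta> \<in> test_functions D" "(\<integral>x. (v x - \<eta> x)\<^sup>2 \<partial>lebesgue) < e / 4"
    "\<eta> \<in> borel_measurable lebesgue" "integrable lebesgue (\<lambda>x. (\<eta> x)\<^sup>2)"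
    "integrable lebesgue (\<lambda>x. (v x - \<eta> x)\<^sup>2)" by (rule test_approximableD[OF v e])
  obtain \<theta> where \<theta>: "\<theta> \<in> test_functions D" "(\<integral>x. (w x - \<theta> x)\<^sup>2 \<partial>lebesgue) < e / 4"
    "\<theta> \<in> borel_measurable lebesgue" "integrable lebesgue (\<lambda>x. (\<theta> x)\<^sup>2)"
    "integrable lebesgue (\<lambda>x. (w x - \<theta> x)\<^sup>2)" by (rule test_approximableD[OF w e])
  have "(\<integral>x. ((v x - \<eta> x) + (w x - \<theta> x))\<^sup>2 \<partial>lebesgue) < e"
    using square_integrable_add(2)[OF _ _ \<eta>(5) \<theta>(5)] m \<eta> \<theta> by simp
  then have "(\<integral>x. (v x + w x - (\<eta> x + \<theta> x))\<^sup>2 \<partial>lebesgue) < e"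
    by (simp add: algebra_simps)
  then show "\<exists>\<eta>\<in>test_functions D. (\<integral>x. (v x + w x - \<eta> x)\<^sup>2 \<partial>lebesgue) < e"
    by (rule bexI[OF _ test_functions_add[OF \<eta>(1) \<theta>(1)]])
qed

lemma test_approximable_scale:
  assumes v: "test_approximable D v"
  shows "test_approximable D (\<lambda>x. c * v x)"
  unfolding test_approximable_def
proof (intro conjI allI impI)
  have m: "v \<in> borel_measurable lebesgue" "integrable lebesgue (\<lambda>x. (v x)\<^sup>2)"
    using v by (auto simp: test_approximable_def)
  then show "(\<lambda>x. c * v x) \<in> borel_measurable lebesgue"
    "integrable lebesgue (\<lambda>x. (c * v x)\<^sup>2)" by (simp_all add: power_mult_distrib)
  fix e :: real assume "e > 0"
  then have e: "e / (c\<^sup>2 + 1) > 0" by (simp add: add_nonneg_pos)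
  obtain \<eta> where \<eta>: "\<eta> \<in> test_functions D" "(\<integral>x. (v x - \<eta> x)\<^sup>2 \<partial>lebesgue) < e / (c\<^sup>2 + 1)"
    "\<eta> \<in> borel_measurable lebesgue" "integrable lebesgue (\<lambda>x. (\<eta> x)\<^sup>2)"
    "integrable lebesgue (\<lambda>x. (v x - \<eta> x)\<^sup>2)" by (rule test_approximableD[OF v e])
  have "(c * v x - c * \<eta> x)\<^sup>2 = c\<^sup>2 * (v x - \<eta> x)\<^sup>2" for x
    by (simp add: algebra_simps power2_eq_square)
  then have "(\<integral>x. (c * v x - c * \<eta> x)\<^sup>2 \<partial>lebesgue) = c\<^sup>2 * (\<integral>x. (v x - \<eta> x)\<^sup>2 \<partial>lebesgue)"
    by simp
  also have "\<dots> \<le> (c\<^sup>2 + 1) * (\<integral>x. (v x - \<eta> x)\<^sup>2 \<partial>lebesgue)"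
    by (simp add: mult_right_mono)
  also have "\<dots> < e"
    using \<eta>(2) by (simp add: pos_less_divide_eq add_nonneg_pos mult.commute)
  finally show "\<exists>\<eta>\<in>test_functions D. (\<integral>x. (c * v x - \<eta> x)\<^sup>2 \<partial>lebesgue) < e"
    by (rule bexI[OF _ test_functions_scale[OF \<eta>(1)]])
qed

lemma test_approximable_sum:
  "finite I \<Longrightarrow> (\<And>i. i \<in> I \<Longrightarrow> test_approximable D (f i)) \<Longrightarrow> test_approximable D (\<lambda>x. \<Sum>i\<in>I. f i x)"
proof (induction I rule: finite_induct)
  case empty
  then show ?case
    using test_functions_zero by (auto simp: test_approximable_def intro!: bexI[of _ "\<lambda>x. 0"])
next
  case (insert i I)
  then show ?case by (simp add: test_approximable_add)
qed

text \<open>The powers \<open>(1 - b)\<^sup>m\<close> of a bump function \<open>0 \<le> b \<le> 1\<close> converge to the indicator of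
  \<open>{b = 0}\<close>, so no partition of unity is needed to approximate the indicator of a union of boxes.\<close>

lemma test_approximable_box_union:
  fixes I :: "((real^'n) \<times> (real^'n)) set"
  assumes fin: "finite I" and sub: "\<And>a b. (a, b) \<in> I \<Longrightarrow> cbox a b \<subseteq> D"
  shows "test_approximable D (indicator (\<Union>(a, b)\<in>I. box a b))"
proof -
  let ?W = "\<Union>(a, b)\<in>I. box a b" and ?K = "\<Union>(a, b)\<in>I. cbox a b"
  define \<eta> where "\<eta> m x = 1 - (\<Prod>(a, b)\<in>I. (1 - box_bump a b x) ^ m)" for m x
  have \<eta>: "\<eta> m \<in> test_functions D" for m
    unfolding \<eta>_def[abs_def] by (rule test_functions_box_union[OF fin sub])
  have W: "?W \<in> sets lebesgue"
    using fin by (intro sets.finite_UN) auto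
  have K: "?K \<in> lmeasurable" using fin by (intro lmeasurable_compact compact_UN) auto
  have [measurable]: "\<eta> m \<in> borel_measurable lebesgue" for m
    by (intro continuous_borel_measurable_lebesgue test_functions_continuous[OF \<eta>])
  have Wm[measurable]: "indicat_real ?W \<in> borel_measurable lebesgue" using W by simp
  have b01: "0 \<le> (case p of (a, b) \<Rightarrow> (1 - box_bump a b x) ^ m) \<and>
      (case p of (a, b) \<Rightarrow> (1 - box_bump a b x) ^ m) \<le> 1" for p m and x :: "real^'n"
    using box_bump_range by (cases p) (auto intro!: power_le_one zero_le_power)
  then have range: "0 \<le> \<eta> m x \<and> \<eta> m x \<le> 1" for m x
    unfolding \<eta>_def by (auto intro!: prod_nonneg prod_le_1)
  have bump0: "box_bump a b x = 0" if "x \<notin> box a b" for a b x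
    using that box_bump_pos_iff[of a b x] box_bump_range(1)[of a b x] by auto
  have zero: "\<eta> m x = 0" if "x \<notin> ?W" for m x
  proof -
    have "(\<Prod>(a, b)\<in>I. (1 - box_bump a b x) ^ m) = 1"
      using that bump0 by (intro prod.neutral) force
    then show ?thesis by (simp add: \<eta>_def)
  qed
  have lim: "(\<lambda>m. (indicat_real ?W x - \<eta> m x)\<^sup>2) \<longlonglongrightarrow> 0" for x
  proof (cases "x \<in> ?W")
    case True
    then obtain p where p: "p \<in> I" "x \<in> (case p of (a, b) \<Rightarrow> box a b)" by auto
    \<comment> \<open>A single box containing \<open>x\<close> is enough: its factor tends to 0 and
      the others stay at most 1.\<close>
    have "(\<lambda>m. \<Prod>(a, b)\<in>I. (1 - box_bump a b x) ^ m) \<longlonglongrightarrow> 0"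
    proof (rule Lim_null_comparison)
      let ?q = "1 - (case p of (a, b) \<Rightarrow> box_bump a b x)"
      have "0 \<le> ?q" "?q < 1"
        using p(2) box_bump_pos_iff box_bump_range(2) by (auto split: prod.splits)
      then show "(\<lambda>m. ?q ^ m) \<longlonglongrightarrow> 0" by (intro LIMSEQ_power_zero) simp
      have "norm (\<Prod>(a, b)\<in>I. (1 - box_bump a b x) ^ m) \<le> ?q ^ m" for m
      proof -
        have "norm (\<Prod>(a, b)\<in>I. (1 - box_bump a b x) ^ m) =
            (\<Prod>(a, b)\<in>I. (1 - box_bump a b x) ^ m)"
          using b01 by (simp add: prod_nonneg)
        also have "\<dots> = (case p of (a, b) \<Rightarrow> (1 - box_bump a b x) ^ m) *
            (\<Prod>(a, b)\<in>I - {p}. (1 - box_bump a b x) ^ m)"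
          by (rule prod.remove[OF fin p(1)])
        also have "\<dots> \<le> (case p of (a, b) \<Rightarrow> (1 - box_bump a b x) ^ m) * 1"
          using b01 by (intro mult_left_mono prod_le_1) auto
        finally show ?thesis by (simp add: case_prod_unfold)
      qed
      then show "\<forall>\<^sub>F m in sequentially. norm (\<Prod>(a, b)\<in>I. (1 - box_bump a b x) ^ m) \<le> ?q ^ m"
        by simp
    qed
    then have "(\<lambda>m. (\<Prod>(a, b)\<in>I. (1 - box_bump a b x) ^ m)\<^sup>2) \<longlonglongrightarrow> 0\<^sup>2"
      by (rule tendsto_power)
    then show ?thesis using True by (simp add: \<eta>_def)
  next
    case False
    then show ?thesis using zero by simp
  qed
  have conv: "(\<lambda>m. \<integral>x. (indicat_real ?W x - \<eta> m x)\<^sup>2 \<partial>lebesgue) \<longlonglongrightarrow>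
      (\<integral>x. 0 \<partial>(lebesgue :: (real^'n) measure))"
  proof (rule integral_dominated_convergence[where w = "indicat_real ?K"])
    show "integrable lebesgue (indicat_real ?K)" using K lmeasurable_iff_integrable by blast
    show "(\<lambda>x. (indicat_real ?W x - \<eta> m x)\<^sup>2) \<in> borel_measurable lebesgue" for m by measurable
    show "AE x in lebesgue. norm ((indicat_real ?W x - \<eta> m x)\<^sup>2) \<le> indicat_real ?K x" for m
    proof (intro AE_I2)
      fix x
      show "norm ((indicat_real ?W x - \<eta> m x)\<^sup>2) \<le> indicat_real ?K x"
      proof (cases "x \<in> ?W")
        case True
        then have "x \<in> ?K" using box_subset_cbox by blast
        moreover have "\<bar>1 - \<eta> m x\<bar> \<le> 1" using range[of m x] by auto
        ultimately show ?thesis using True by (simp add: abs_square_le_1)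
      qed (simp add: zero)
    qed
  qed (use lim in auto)
  show ?thesis
    unfolding test_approximable_def
  proof (intro conjI allI impI)
    have "?W \<subseteq> ?K" using box_subset_cbox by blast
    then have "integrable lebesgue (indicat_real ?W)"
      using W K fmeasurableI2 lmeasurable_iff_integrable by blast
    then show "integrable lebesgue (\<lambda>x. (indicat_real ?W x)\<^sup>2)"
      by (simp add: power2_eq_square flip: indicator_inter_arith)
    fix e :: real assume "e > 0"
    then obtain m where "(\<integral>x. (indicat_real ?W x - \<eta> m x)\<^sup>2 \<partial>lebesgue) < e"
      using order_tendstoD(2)[OF conv, of e] by (auto simp: eventually_sequentially)
    then show "\<exists>\<eta>\<in>test_functions D. (\<integral>x. (indicat_real ?W x - \<eta> x)\<^sup>2 \<partial>lebesgue) < e"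
      using \<eta> by blast
  qed (rule Wm)
qed

lemma test_approximable_limit:
  assumes w: "w \<in> borel_measurable lebesgue" "integrable lebesgue (\<lambda>x. (w x)\<^sup>2)"
    and "\<And>e. e > 0 \<Longrightarrow> \<exists>v. test_approximable D v \<and> (\<integral>x. (w x - v x)\<^sup>2 \<partial>lebesgue) < e"
  shows "test_approximable D w"
  unfolding test_approximable_def
proof (intro conjI w allI impI)
  fix e :: real assume "e > 0"
  then have e: "e / 4 > 0" by simp
  then obtain v where v: "test_approximable D v" "(\<integral>x. (w x - v x)\<^sup>2 \<partial>lebesgue) < e / 4"
    using assms(3) by blast
  have vm: "v \<in> borel_measurable lebesgue" "integrable lebesgue (\<lambda>x. (v x)\<^sup>2)"
    using v(1) by (auto simp: test_approximable_def)
  obtain \<eta> where \<eta>: "\<eta> \<in> test_functions D" "(\<integral>x. (v x - \<eta> x)\<^sup>2 \<partial>lebesgue) < e / 4"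
    "\<eta> \<in> borel_measurable lebesgue" "integrable lebesgue (\<lambda>x. (\<eta> x)\<^sup>2)"
    "integrable lebesgue (\<lambda>x. (v x - \<eta> x)\<^sup>2)" by (rule test_approximableD[OF v(1) e])
  have "(\<integral>x. ((w x - v x) + (v x - \<eta> x))\<^sup>2 \<partial>lebesgue) < e"
    using square_integrable_add(2)[OF _ _ square_integrable_diff[OF w(1) vm(1) w(2) vm(2)] \<eta>(5)]
      w vm v \<eta> by simp
  then show "\<exists>\<eta>\<in>test_functions D. (\<integral>x. (w x - \<eta> x)\<^sup>2 \<partial>lebesgue) < e"
    using \<eta>(1) by auto
qed

text \<open>Regularity of Lebesgue measure gives a compact T inside E and an open V around T, each
  differing little from its partner. Finitely many boxes whose closures lie in V and D cover T, and
  their union W satisfies T \<subseteq> W \<subseteq> V, so E and W differ only inside E - T and V -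
  T.\<close>

lemma test_approximable_indicator:
  fixes D :: "(real^'n) set"
  assumes D: "open D" and E: "E \<in> sets lebesgue" "E \<subseteq> D" "bounded E"
  shows "test_approximable D (indicator E)"
proof (rule test_approximable_limit)
  have Em: "E \<in> lmeasurable" using E bounded_set_imp_lmeasurable by blast
  show "indicat_real E \<in> borel_measurable lebesgue" using E by simp
  show "integrable lebesgue (\<lambda>x. (indicat_real E x)\<^sup>2)"
    using Em by (simp add: power2_eq_square lmeasurable_iff_integrable flip: indicator_inter_arith)
  fix e :: real assume "e > 0"
  then have e: "e / 2 > 0" by simp
  obtain T where T: "closed T" "T \<subseteq> E" "E - T \<in> lmeasurable" "emeasure lebesgue (E - T) < ennreal (e / 2)"
    using sets_lebesgue_inner_closed[OF E(1) e] .
  have cT: "compact T" using T(1,2) E(3) bounded_subset compact_eq_bounded_closed by blast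
  obtain V where V: "open V" "T \<subseteq> V" "V - T \<in> lmeasurable" "emeasure lebesgue (V - T) < ennreal (e / 2)"
    using sets_lebesgue_outer_open[of T "e / 2"] e cT lmeasurable_compact by blast
  define C where "C = {(a, b). cbox a b \<subseteq> V \<inter> D}"
  have "T \<subseteq> (\<Union>p\<in>C. case p of (a, b) \<Rightarrow> box a b)"
  proof
    fix x assume "x \<in> T"
    then have "x \<in> V \<inter> D" using V T E by auto
    then obtain a b where "cbox a b \<subseteq> V \<inter> D" "x \<in> box a b" "\<forall>i\<in>Basis. a \<bullet> i < b \<bullet> i"
      by (rule open_contains_cbox[OF open_Int[OF V(1) D]])
    then show "x \<in> (\<Union>p\<in>C. case p of (a, b) \<Rightarrow> box a b)" by (auto simp: C_def)
  qed
  then obtain I where I: "I \<subseteq> C" "finite I" "T \<subseteq> (\<Union>p\<in>I. case p of (a, b) \<Rightarrow> box a b)"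
    by (rule compactE_image[OF cT, rotated]) auto
  let ?W = "\<Union>(a, b)\<in>I. box a b"
  have W: "test_approximable D (indicator ?W)"
    by (rule test_approximable_box_union) (use I in \<open>auto simp: C_def\<close>)
  have WV: "?W \<subseteq> V" using I(1) box_subset_cbox by (fastforce simp: C_def)
  have "(\<integral>x. (indicat_real E x - indicat_real ?W x)\<^sup>2 \<partial>lebesgue) \<le>
      (\<integral>x. indicat_real (E - T) x + indicat_real (V - T) x \<partial>lebesgue)"
  proof (rule integral_mono')
    show "integrable lebesgue (\<lambda>x. indicat_real (E - T) x + indicat_real (V - T) x)"
      using T(3) V(3) by (simp add: lmeasurable_iff_integrable)
    show "(indicat_real E x - indicat_real ?W x)\<^sup>2 \<le> indicat_real (E - T) x + indicat_real (V - T) x" for x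
      using WV I(3) T(2) by (auto simp: indicator_def)
  qed (auto simp: indicator_def)
  also have "\<dots> = measure lebesgue (E - T) + measure lebesgue (V - T)"
    using T(3) V(3) by (simp add: lmeasurable_iff_integrable)
  also have "\<dots> < e"
  proof -
    have "measure lebesgue (E - T) < e / 2" "measure lebesgue (V - T) < e / 2"
      using T(3,4) V(3,4) e by (simp_all add: emeasure_eq_measure2 ennreal_less_iff)
    then show ?thesis by simp
  qed
  finally show "\<exists>v. test_approximable D v \<and> (\<integral>x. (indicat_real E x - v x)\<^sup>2 \<partial>lebesgue) < e"
    using W by blast
qed

text \<open>Both sides are continuous in the L2 norm, so the bound passes from test functions to
  their closure.\<close>

lemma test_function_duality_approximable:
  assumes g: "g \<in> borel_measurable lebesgue" "integrable lebesgue (\<lambda>x. (g x)\<^sup>2)"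
    and M: "M \<ge> 0" "\<And>\<eta>. \<eta> \<in> test_functions D \<Longrightarrow>
        \<bar>\<integral>x. g x * \<eta> x \<partial>lebesgue\<bar> \<le> M * sqrt (\<integral>x. (\<eta> x)\<^sup>2 \<partial>lebesgue)"
    and w: "test_approximable D w"
  shows "\<bar>\<integral>x. g x * w x \<partial>lebesgue\<bar> \<le> M * sqrt (\<integral>x. (w x)\<^sup>2 \<partial>lebesgue)"
proof (rule field_le_epsilon)
  fix e :: real assume e: "e > 0"
  define G where "G = sqrt (\<integral>x. (g x)\<^sup>2 \<partial>lebesgue)"
  have G: "G \<ge> 0" by (simp add: G_def)
  \<comment> \<open>An approximation error of norm at most \<open>d\<close> costs
    \<open>G * d\<close> in the integral and \<open>M * d\<close> in the norm on the right; the
    summand 1 keeps the denominator positive.\<close>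
  define d where "d = e / (G + M + 1)"
  have d: "d > 0" using e G M by (simp add: d_def)
  have wm: "w \<in> borel_measurable lebesgue" "integrable lebesgue (\<lambda>x. (w x)\<^sup>2)"
    using w by (auto simp: test_approximable_def)
  obtain \<eta> where \<eta>: "\<eta> \<in> test_functions D" "(\<integral>x. (w x - \<eta> x)\<^sup>2 \<partial>lebesgue) < d\<^sup>2"
    "\<eta> \<in> borel_measurable lebesgue" "integrable lebesgue (\<lambda>x. (\<eta> x)\<^sup>2)"
    "integrable lebesgue (\<lambda>x. (w x - \<eta> x)\<^sup>2)"
    by (rule test_approximableD[OF w, of "d\<^sup>2"]) (use d in auto)
  define r where "r x = w x - \<eta> x" for x
  have r: "r \<in> borel_measurable lebesgue" "integrable lebesgue (\<lambda>x. (r x)\<^sup>2)"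
    "sqrt (\<integral>x. (r x)\<^sup>2 \<partial>lebesgue) \<le> d"
    using wm \<eta> d by (auto simp: r_def[abs_def] intro!: real_le_lsqrt)
  have CS: "\<bar>\<integral>x. u x * v x \<partial>lebesgue\<bar> \<le> sqrt (\<integral>x. (u x)\<^sup>2 \<partial>lebesgue) * sqrt (\<integral>x. (v x)\<^sup>2 \<partial>lebesgue)"
      "integrable lebesgue (\<lambda>x. u x * v x)"
    if "u \<in> borel_measurable lebesgue" "v \<in> borel_measurable lebesgue"
      "integrable lebesgue (\<lambda>x. (u x)\<^sup>2)" "integrable lebesgue (\<lambda>x. (v x)\<^sup>2)" for u v :: "real^'a \<Rightarrow> real"
    using Cauchy_Schwarz_integral[of u lebesgue v] integrable_inner_of_square_integrable[of u lebesgue v] that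
    by simp_all
  have binom: "a - 2 * c + b \<le> (sqrt a + sqrt b)\<^sup>2"
    if "a \<ge> 0" "b \<ge> 0" "\<bar>c\<bar> \<le> sqrt a * sqrt b" for a b c :: real
    using that by (simp add: power2_sum)
  have "(\<integral>x. g x * w x \<partial>lebesgue) = (\<integral>x. g x * \<eta> x + g x * r x \<partial>lebesgue)"
    by (simp add: r_def algebra_simps)
  also have "\<dots> = (\<integral>x. g x * \<eta> x \<partial>lebesgue) + (\<integral>x. g x * r x \<partial>lebesgue)"
    by (rule Bochner_Integration.integral_add) (use CS(2) g \<eta> r in blast)+
  finally have 1: "\<bar>\<integral>x. g x * w x \<partial>lebesgue\<bar> \<le> M * sqrt (\<integral>x. (\<eta> x)\<^sup>2 \<partial>lebesgue) + G * d"
    using M(2)[OF \<eta>(1)] CS(1)[OF g(1) r(1) g(2) r(2)] mult_left_mono[OF r(3) G]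
    unfolding G_def by linarith
  have "(\<integral>x. (\<eta> x)\<^sup>2 \<partial>lebesgue) = (\<integral>x. (w x)\<^sup>2 + (- 2) * (w x * r x) + (r x)\<^sup>2 \<partial>lebesgue)"
    by (simp add: r_def power2_eq_square algebra_simps)
  also have "\<dots> = (\<integral>x. (w x)\<^sup>2 \<partial>lebesgue) - 2 * (\<integral>x. w x * r x \<partial>lebesgue) + (\<integral>x. (r x)\<^sup>2 \<partial>lebesgue)"
    using CS(2)[OF wm(1) r(1) wm(2) r(2)] wm r by simp
  also have "\<dots> \<le> (sqrt (\<integral>x. (w x)\<^sup>2 \<partial>lebesgue) + sqrt (\<integral>x. (r x)\<^sup>2 \<partial>lebesgue))\<^sup>2"
    by (rule binom[OF _ _ CS(1)[OF wm(1) r(1) wm(2) r(2)]]) simp_all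
  finally have "sqrt (\<integral>x. (\<eta> x)\<^sup>2 \<partial>lebesgue) \<le> sqrt (\<integral>x. (w x)\<^sup>2 \<partial>lebesgue) + d"
  proof (intro real_le_lsqrt)
    show "0 \<le> sqrt (\<integral>x. (w x)\<^sup>2 \<partial>lebesgue) + d" using d by (simp add: add_nonneg_nonneg)
    assume "(\<integral>x. (\<eta> x)\<^sup>2 \<partial>lebesgue) \<le>
      (sqrt (\<integral>x. (w x)\<^sup>2 \<partial>lebesgue) + sqrt (\<integral>x. (r x)\<^sup>2 \<partial>lebesgue))\<^sup>2"
    also have "\<dots> \<le> (sqrt (\<integral>x. (w x)\<^sup>2 \<partial>lebesgue) + d)\<^sup>2"
      using r(3) by (intro power_mono add_left_mono) (simp_all add: add_nonneg_nonneg)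
    finally show "(\<integral>x. (\<eta> x)\<^sup>2 \<partial>lebesgue) \<le> \<dots>" .
  qed
  from mult_left_mono[OF this M(1)] 1
  have "\<bar>\<integral>x. g x * w x \<partial>lebesgue\<bar> \<le> M * sqrt (\<integral>x. (w x)\<^sup>2 \<partial>lebesgue) + (M + G) * d"
    by (simp add: algebra_simps)
  also have "(M + G) * d \<le> e"
    using G M e by (simp add: d_def field_simps)
  finally show "\<bar>\<integral>x. g x * w x \<partial>lebesgue\<bar> \<le> M * sqrt (\<integral>x. (w x)\<^sup>2 \<partial>lebesgue) + e"
    by simp
qed

text \<open>Converts information that is available only through test functions into an L2 bound.
  Simple functions converging to \<open>g\<close> are approximable, so the functional bound extends
  to \<open>g\<close> itself and reads ||g||^2 \<le> M ||g||. Used with M = 0 for uniqueness of weak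
  gradients and with M proportional to the shift for translates.\<close>

lemma test_function_duality:
  fixes D :: "(real^'n) set"
  assumes D: "open D" "bounded D"
    and g: "g \<in> borel_measurable lebesgue" "integrable lebesgue (\<lambda>x. (g x)\<^sup>2)" "\<And>x. x \<notin> D \<Longrightarrow> g x = 0"
    and M: "M \<ge> 0" "\<And>\<eta>. \<eta> \<in> test_functions D \<Longrightarrow>
        \<bar>\<integral>x. g x * \<eta> x \<partial>lebesgue\<bar> \<le> M * sqrt (\<integral>x. (\<eta> x)\<^sup>2 \<partial>lebesgue)"
  shows "(\<integral>x. (g x)\<^sup>2 \<partial>lebesgue) \<le> M\<^sup>2"
proof -
  obtain s where s: "\<And>i. simple_function lebesgue (s i)" "\<And>x. (\<lambda>i. s i x) \<longlonglongrightarrow> g x"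
    "\<And>i x. \<bar>s i x\<bar> \<le> 2 * \<bar>g x\<bar>"
    using borel_measurable_implies_sequence_metric[OF g(1), of 0] by auto
  have sm: "s i \<in> borel_measurable lebesgue" for i
    using s(1) borel_measurable_simple_function by blast
  have app: "test_approximable D (s i)" for i
  proof -
    have "test_approximable D (\<lambda>x. \<Sum>y\<in>range (s i). y * indicator (s i -` {y}) x)"
    proof (rule test_approximable_sum)
      show "finite (range (s i))" using simple_functionD(1)[OF s(1)[of i]] by simp
      fix y assume "y \<in> range (s i)"
      show "test_approximable D (\<lambda>x. y * indicator (s i -` {y}) x)"
      proof (cases "y = 0")
        case True
        then show ?thesis using test_approximable_sum[of "{}" D] by simp
      next
        case False
        \<comment> \<open>The domination of \<open>s i\<close> by 2 |g| makes it vanish wherever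
          \<open>g\<close> does, so its nonzero level sets stay inside D.\<close>
        have sub: "s i -` {y} \<subseteq> D"
        proof
          fix x assume "x \<in> s i -` {y}"
          then show "x \<in> D" using s(3)[of i x] g(3)[of x] False by force
        qed
        have "s i -` {y} \<in> sets lebesgue" using simple_functionD(2)[OF s(1)[of i], of "{y}"] by simp
        then show ?thesis
          using sub D bounded_subset by (intro test_approximable_scale test_approximable_indicator) auto
      qed
    qed
    moreover have "(\<Sum>y\<in>range (s i). y * indicator (s i -` {y}) x) = s i x" for x
      by (subst sum.remove[of _ "s i x"])
        (use simple_functionD(1)[OF s(1)[of i]] in \<open>auto intro!: sum.neutral simp: indicator_def\<close>)
    ultimately show ?thesis by simp
  qed
  have ineq: "\<bar>\<integral>x. g x * s i x \<partial>lebesgue\<bar> \<le> M * sqrt (\<integral>x. (s i x)\<^sup>2 \<partial>lebesgue)" for i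
    by (rule test_function_duality_approximable[OF g(1,2) M app])
  have l1: "(\<lambda>i. \<integral>x. g x * s i x \<partial>lebesgue) \<longlonglongrightarrow> (\<integral>x. g x * g x \<partial>lebesgue)"
  proof (rule integral_dominated_convergence[where w = "\<lambda>x. 2 * (g x)\<^sup>2"])
    show "AE x in lebesgue. norm (g x * s i x) \<le> 2 * (g x)\<^sup>2" for i
    proof (intro AE_I2)
      fix x
      have "\<bar>g x\<bar> * \<bar>s i x\<bar> \<le> \<bar>g x\<bar> * (2 * \<bar>g x\<bar>)" using s(3) by (intro mult_left_mono) auto
      then show "norm (g x * s i x) \<le> 2 * (g x)\<^sup>2"
        by (simp add: abs_mult power2_eq_square)
    qed
    show "AE x in lebesgue. (\<lambda>i. g x * s i x) \<longlonglongrightarrow> g x * g x"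
      by (intro AE_I2 tendsto_mult tendsto_const s(2))
  qed (use g sm in auto)
  have l2: "(\<lambda>i. \<integral>x. (s i x)\<^sup>2 \<partial>lebesgue) \<longlonglongrightarrow> (\<integral>x. (g x)\<^sup>2 \<partial>lebesgue)"
  proof (rule integral_dominated_convergence[where w = "\<lambda>x. 4 * (g x)\<^sup>2"])
    show "AE x in lebesgue. norm ((s i x)\<^sup>2) \<le> 4 * (g x)\<^sup>2" for i
    proof (intro AE_I2)
      fix x
      have "\<bar>s i x\<bar>\<^sup>2 \<le> (2 * \<bar>g x\<bar>)\<^sup>2" using s(3) by (intro power_mono) auto
      then show "norm ((s i x)\<^sup>2) \<le> 4 * (g x)\<^sup>2" by (simp add: power_mult_distrib)
    qed
    show "AE x in lebesgue. (\<lambda>i. (s i x)\<^sup>2) \<longlonglongrightarrow> (g x)\<^sup>2"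
      by (intro AE_I2 tendsto_power s(2))
  qed (use g sm in auto)
  let ?N = "\<integral>x. (g x)\<^sup>2 \<partial>lebesgue"
  have "\<bar>\<integral>x. g x * g x \<partial>lebesgue\<bar> \<le> M * sqrt ?N"
  proof (rule LIMSEQ_le)
    show "(\<lambda>i. \<bar>\<integral>x. g x * s i x \<partial>lebesgue\<bar>) \<longlonglongrightarrow> \<bar>\<integral>x. g x * g x \<partial>lebesgue\<bar>"
      by (intro tendsto_rabs l1)
    show "(\<lambda>i. M * sqrt (\<integral>x. (s i x)\<^sup>2 \<partial>lebesgue)) \<longlonglongrightarrow> M * sqrt ?N"
      by (intro tendsto_mult tendsto_const tendsto_real_sqrt l2)
  qed (use ineq in blast)
  then have *: "sqrt ?N * sqrt ?N \<le> M * sqrt ?N" by (simp add: power2_eq_square)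
  have "sqrt ?N \<le> M"
  proof (cases "?N = 0")
    case False
    moreover have "?N \<ge> 0" by simp
    ultimately have "?N > 0" by linarith
    then have "sqrt ?N > 0" by (rule real_sqrt_gt_zero)
    then show ?thesis using mult_right_le_imp_le[OF *] by blast
  qed (use M in simp)
  then show ?thesis by (rule sqrt_le_D)
qed

section \<open>Weak gradients\<close>

lemma L2_spaceD:
  assumes "f \<in> L2_space D"
  shows "f \<in> borel_measurable (lebesgue_on D)" "integrable (lebesgue_on D) (\<lambda>x. (norm (f x))\<^sup>2)"
  using assms by (auto simp: L2_space_def)

lemma L2_inner_integrable:
  "f \<in> L2_space D \<Longrightarrow> g \<in> L2_space D \<Longrightarrow> integrable (lebesgue_on D) (\<lambda>x. f x \<bullet> g x)"
  by (intro integrable_inner_of_square_integrable L2_spaceD)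

lemma L2_space_zero: "(\<lambda>x. 0) \<in> L2_space D"
  by (simp add: L2_space_def)

lemma L2_space_scaleR: "f \<in> L2_space D \<Longrightarrow> (\<lambda>x. c *\<^sub>R f x) \<in> L2_space D"
  by (auto simp: L2_space_def power_mult_distrib intro!: borel_measurable_scaleR)

lemma L2_space_add:
  assumes "f \<in> L2_space D" "g \<in> L2_space D"
  shows "(\<lambda>x. f x + g x) \<in> L2_space D"
  unfolding L2_space_def
proof (intro CollectI conjI)
  show "(\<lambda>x. f x + g x) \<in> borel_measurable (lebesgue_on D)"
    using assms by (intro borel_measurable_add L2_spaceD)
  have "(norm (f x + g x))\<^sup>2 = (norm (f x))\<^sup>2 + 2 * (f x \<bullet> g x) + (norm (g x))\<^sup>2" for x
    by (simp add: power2_norm_eq_inner inner_add inner_commute)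
  then show "integrable (lebesgue_on D) (\<lambda>x. (norm (f x + g x))\<^sup>2)"
    using L2_inner_integrable[OF assms] L2_spaceD(2)[OF assms(1)] L2_spaceD(2)[OF assms(2)] by simp
qed

lemma L2_space_minus: "f \<in> L2_space D \<Longrightarrow> (\<lambda>x. - f x) \<in> L2_space D"
  using L2_space_scaleR[of f D "-1"] by simp

lemma L2_space_diff: "f \<in> L2_space D \<Longrightarrow> g \<in> L2_space D \<Longrightarrow> (\<lambda>x. f x - g x) \<in> L2_space D"
  using L2_space_add[of f D "\<lambda>x. - g x"] L2_space_minus[of g D] by simp

lemma L2_space_sum:
  "finite I \<Longrightarrow> (\<And>i. i \<in> I \<Longrightarrow> f i \<in> L2_space D) \<Longrightarrow> (\<lambda>x. \<Sum>i\<in>I. f i x) \<in> L2_space D"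
  by (induction I rule: finite_induct) (auto intro: L2_space_zero L2_space_add)

lemma L2_space_linear:
  fixes l :: "'b::euclidean_space \<Rightarrow> 'c::euclidean_space"
  assumes "linear l" "f \<in> L2_space D"
  shows "(\<lambda>x. l (f x)) \<in> L2_space D"
proof -
  obtain K where K: "\<And>x. norm (l x) \<le> K * norm x"
    using linear_bounded[OF assms(1)] by blast
  have m: "(\<lambda>x. l (f x)) \<in> borel_measurable (lebesgue_on D)"
    using assms L2_spaceD(1)
    by (intro measurable_compose[of f _ borel l] borel_measurable_continuous_onI
        linear_continuous_on) (auto simp: linear_conv_bounded_linear)
  have "integrable (lebesgue_on D) (\<lambda>x. (norm (l (f x)))\<^sup>2)"
  proof (rule Bochner_Integration.integrable_bound)
    show "integrable (lebesgue_on D) (\<lambda>x. K\<^sup>2 * (norm (f x))\<^sup>2)"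
      using L2_spaceD(2)[OF assms(2)] by simp
    show "(\<lambda>x. (norm (l (f x)))\<^sup>2) \<in> borel_measurable (lebesgue_on D)"
      using m by measurable
    have "(norm (l (f x)))\<^sup>2 \<le> K\<^sup>2 * (norm (f x))\<^sup>2" for x
      using power_mono[OF K norm_ge_zero, of "f x" 2] by (simp add: power_mult_distrib)
    then show "AE x in lebesgue_on D. norm ((norm (l (f x)))\<^sup>2) \<le> norm (K\<^sup>2 * (norm (f x))\<^sup>2)"
      by simp
  qed
  with m show ?thesis by (simp add: L2_space_def)
qed

lemma L2_space_vec_nth:
  fixes f :: "real^'n \<Rightarrow> 'b::euclidean_space^'m"
  shows "f \<in> L2_space D \<Longrightarrow> (\<lambda>x. f x $ i) \<in> L2_space D"
  by (rule L2_space_linear[where l = "\<lambda>y. y $ i"]) (auto intro: linearI)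

lemma L2_space_const:
  assumes "bounded D" "D \<in> sets lebesgue"
  shows "(\<lambda>x. c) \<in> L2_space D"
proof -
  have "D \<in> lmeasurable" using assms bounded_set_imp_lmeasurable by blast
  then have "finite_measure (lebesgue_on D)"
    by (simp add: finite_measure_lebesgue_on)
  then show ?thesis by (simp add: L2_space_def finite_measure.integrable_const)
qed

lemma L2_space_integrable:
  assumes "bounded D" "D \<in> sets lebesgue" "f \<in> L2_space D"
  shows "integrable (lebesgue_on D) f"
proof -
  have "integrable (lebesgue_on D) (\<lambda>x. f x \<bullet> b)" for b
    using L2_inner_integrable[OF assms(3) L2_space_const[OF assms(1,2)], of b] .
  then have "integrable (lebesgue_on D) (\<lambda>x. \<Sum>b\<in>Basis. (f x \<bullet> b) *\<^sub>R b)"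
    by (intro Bochner_Integration.integrable_sum integrable_scaleR_left)
  then show ?thesis by (simp add: euclidean_representation)
qed

lemma L2_inner_commute: "L2_inner D f g = L2_inner D g f"
  by (simp add: L2_inner_def inner_commute)

lemma L2_inner_add_right:
  "f \<in> L2_space D \<Longrightarrow> g \<in> L2_space D \<Longrightarrow> h \<in> L2_space D \<Longrightarrow>
   L2_inner D f (\<lambda>x. g x + h x) = L2_inner D f g + L2_inner D f h"
  by (simp add: L2_inner_def inner_add_right L2_inner_integrable)

lemma L2_inner_add_left:
  "f \<in> L2_space D \<Longrightarrow> g \<in> L2_space D \<Longrightarrow> h \<in> L2_space D \<Longrightarrow>
   L2_inner D (\<lambda>x. g x + h x) f = L2_inner D g f + L2_inner D h f"
  by (simp add: L2_inner_def inner_add_left L2_inner_integrable)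

lemma L2_inner_scaleR_right: "L2_inner D f (\<lambda>x. c *\<^sub>R g x) = c * L2_inner D f g"
  by (simp add: L2_inner_def)

lemma L2_inner_scaleR_left: "L2_inner D (\<lambda>x. c *\<^sub>R g x) f = c * L2_inner D g f"
  by (simp add: L2_inner_def)

lemma L2_inner_minus_right: "L2_inner D f (\<lambda>x. - g x) = - L2_inner D f g"
  by (simp add: L2_inner_def)

lemma L2_inner_diff_right:
  "f \<in> L2_space D \<Longrightarrow> g \<in> L2_space D \<Longrightarrow> h \<in> L2_space D \<Longrightarrow>
   L2_inner D f (\<lambda>x. g x - h x) = L2_inner D f g - L2_inner D f h"
  by (simp add: L2_inner_def inner_diff_right L2_inner_integrable)

lemma L2_inner_diff_left:
  "f \<in> L2_space D \<Longrightarrow> g \<in> L2_space D \<Longrightarrow> h \<in> L2_space D \<Longrightarrow>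
   L2_inner D (\<lambda>x. g x - h x) f = L2_inner D g f - L2_inner D h f"
  by (simp add: L2_inner_def inner_diff_left L2_inner_integrable)

lemma L2_inner_AE_zero_left: "AE x in lebesgue_on D. f x = 0 \<Longrightarrow> L2_inner D f g = 0"
  unfolding L2_inner_def by (rule integral_eq_zero_AE) auto

lemma L2_inner_AE_zero_right: "AE x in lebesgue_on D. g x = 0 \<Longrightarrow> L2_inner D f g = 0"
  unfolding L2_inner_def by (rule integral_eq_zero_AE) auto

lemma L2_inner_cong_AE:
  assumes "f \<in> L2_space D" "f' \<in> L2_space D" "g \<in> L2_space D" "g' \<in> L2_space D"
    and "AE x in lebesgue_on D. f x = f' x" "AE x in lebesgue_on D. g x = g' x"
  shows "L2_inner D f g = L2_inner D f' g'"
  unfolding L2_inner_def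
  by (rule integral_cong_AE) (use assms L2_inner_integrable in auto)

lemma L2_inner_self: "L2_inner D f f = (\<integral>x. (norm (f x))\<^sup>2 \<partial>lebesgue_on D)"
  by (simp add: L2_inner_def power2_norm_eq_inner)

lemma L2_inner_self_nonneg: "L2_inner D f f \<ge> 0"
  by (simp add: L2_inner_self)

lemma L2_norm_nonneg: "L2_norm D f \<ge> 0"
  by (simp add: L2_norm_def L2_inner_self_nonneg)

lemma L2_norm_power2: "(L2_norm D f)\<^sup>2 = L2_inner D f f"
  by (simp add: L2_norm_def L2_inner_self_nonneg)

lemma L2_inner_Cauchy_Schwarz:
  assumes "f \<in> L2_space D" "g \<in> L2_space D"
  shows "\<bar>L2_inner D f g\<bar> \<le> L2_norm D f * L2_norm D g"
  using Cauchy_Schwarz_integral[OF L2_spaceD(1)[OF assms(1)] L2_spaceD(1)[OF assms(2)]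
      L2_spaceD(2)[OF assms(1)] L2_spaceD(2)[OF assms(2)]]
  by (simp add: L2_norm_def L2_inner_self L2_inner_def)

lemma L2_norm_triangle:
  assumes "f \<in> L2_space D" "g \<in> L2_space D"
  shows "L2_norm D (\<lambda>x. f x + g x) \<le> L2_norm D f + L2_norm D g"
proof -
  have "(L2_norm D (\<lambda>x. f x + g x))\<^sup>2 =
      (L2_norm D f)\<^sup>2 + 2 * L2_inner D f g + (L2_norm D g)\<^sup>2"
    using assms
    by (simp add: L2_norm_power2 L2_inner_add_right L2_inner_add_left L2_space_add
        L2_inner_commute[of D g f])
  also have "\<dots> \<le> (L2_norm D f + L2_norm D g)\<^sup>2"
    using L2_inner_Cauchy_Schwarz[OF assms] by (simp add: power2_sum)
  finally show ?thesis
    by (rule power2_le_imp_le) (simp add: L2_norm_nonneg)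
qed

lemma L2_norm_minus: "L2_norm D (\<lambda>x. - f x) = L2_norm D f"
  by (simp add: L2_norm_def L2_inner_def)

lemma L2_norm_diff_triangle:
  assumes "f \<in> L2_space D" "g \<in> L2_space D"
  shows "L2_norm D f \<le> L2_norm D g + L2_norm D (\<lambda>x. f x - g x)"
  using L2_norm_triangle[OF assms(2) L2_space_diff[OF assms]] by simp

lemma L2_norm_cong_AE:
  assumes "f \<in> L2_space D" "f' \<in> L2_space D" "AE x in lebesgue_on D. f x = f' x"
  shows "L2_norm D f = L2_norm D f'"
  unfolding L2_norm_def using L2_inner_cong_AE[OF assms(1,2,1,2,3,3)] by simp

lemma L2_inner_lebesgue:
  assumes "D \<in> sets lebesgue"
  shows "L2_inner D f g = (\<integral>x. indicator D x * (f x \<bullet> g x) \<partial>lebesgue)"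
  unfolding L2_inner_def using assms by (subst integral_restrict_space) auto

lemma test_functions_zero_outside: "\<phi> \<in> test_functions D \<Longrightarrow> x \<notin> D \<Longrightarrow> \<phi> x = 0"
  using closure_subset[of "{x. \<phi> x \<noteq> 0}"] unfolding test_functions_def by blast

lemma integral_lebesgue_on_mult_test_function:
  assumes "D \<in> sets lebesgue" "\<phi> \<in> test_functions D"
  shows "(\<integral>x. f x * \<phi> x \<partial>lebesgue_on D) = (\<integral>x. (indicator D x * f x) * \<phi> x \<partial>lebesgue)"
  using assms by (subst integral_restrict_space) (auto simp: mult.assoc)

lemma test_functions_L2_space:
  assumes "D \<in> sets lebesgue" "\<phi> \<in> test_functions E"
  shows "\<phi> \<in> L2_space D"
proof -
  have "\<phi> \<in> borel_measurable lebesgue"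
    by (intro continuous_borel_measurable_lebesgue test_functions_continuous[OF assms(2)])
  moreover have "integrable (lebesgue_on D) (\<lambda>x. (\<phi> x)\<^sup>2)"
    using integrable_mult_indicator[OF assms(1) test_functions_square_integrable[OF assms(2)]] assms(1)
    by (simp add: integrable_restrict_space)
  ultimately show ?thesis
    by (simp add: L2_space_def measurable_restrict_space1)
qed

lemma L2_mult_test_function_integrable:
  assumes "D \<in> sets lebesgue" "f \<in> L2_space D" "\<phi> \<in> test_functions E"
  shows "integrable (lebesgue_on D) (\<lambda>x. f x * \<phi> x)"
  using L2_inner_integrable[OF assms(2) test_functions_L2_space[OF assms(1,3)]] by simp

lemma L2_space_extend:
  fixes f :: "real^'n \<Rightarrow> real"
  assumes "D \<in> sets lebesgue" "f \<in> L2_space D"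
  shows "(\<lambda>x. indicator D x * f x) \<in> borel_measurable lebesgue"
    "integrable lebesgue (\<lambda>x. (indicator D x * f x)\<^sup>2)"
proof -
  show "(\<lambda>x. indicator D x * f x) \<in> borel_measurable lebesgue"
    using L2_spaceD(1)[OF assms(2)] assms(1)
    by (subst (asm) borel_measurable_restrict_space_iff) auto
  have "indicat_real D x * (f x)\<^sup>2 = (indicator D x * f x)\<^sup>2" for x
    by (simp add: indicator_def)
  then show "integrable lebesgue (\<lambda>x. (indicator D x * f x)\<^sup>2)"
    using L2_spaceD(2)[OF assms(2)] assms(1)
    by (subst (asm) integrable_restrict_space) auto
qed

text \<open>The fundamental lemma of the calculus of variations, as the case of bound 0 in
  \<open>test_function_duality\<close>.\<close>

lemma L2_zero_if_orthogonal_to_test_functions: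
  fixes g :: "real^'n \<Rightarrow> real"
  assumes D: "open D" "bounded D" and g: "g \<in> L2_space D"
    and orth: "\<And>\<phi>. \<phi> \<in> test_functions D \<Longrightarrow> (\<integral>x. g x * \<phi> x \<partial>lebesgue_on D) = 0"
  shows "AE x in lebesgue_on D. g x = 0"
proof -
  have Dm: "D \<in> sets lebesgue" using D by simp
  let ?g = "\<lambda>x. indicator D x * g x"
  have "(\<integral>x. (?g x)\<^sup>2 \<partial>lebesgue) \<le> 0\<^sup>2"
    by (rule test_function_duality[OF D L2_space_extend[OF Dm g]])
      (use orth integral_lebesgue_on_mult_test_function[OF Dm, of _ g] in auto)
  moreover have "(\<integral>x. (?g x)\<^sup>2 \<partial>lebesgue) \<ge> 0" by simp
  ultimately have "(\<integral>x. (?g x)\<^sup>2 \<partial>lebesgue) = 0" by simp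
  then have "AE x in lebesgue. (?g x)\<^sup>2 = 0"
    using integral_nonneg_eq_0_iff_AE[OF L2_space_extend(2)[OF Dm g]] by simp
  then have "AE x in lebesgue. x \<in> D \<longrightarrow> g x = 0" by eventually_elim auto
  then show ?thesis using Dm by (simp add: AE_restrict_space_iff)
qed

lemma has_weak_gradient_unique:
  fixes D :: "(real^'n) set"
  assumes D: "open D" "bounded D"
    and G: "G \<in> L2_space D" "has_weak_gradient D f G"
    and H: "H \<in> L2_space D" "has_weak_gradient D f H"
  shows "AE x in lebesgue_on D. G x = H x"
proof -
  have Dm: "D \<in> sets lebesgue" using D by simp
  have "AE x in lebesgue_on D. G x $ i $ j - H x $ i $ j = 0" for i j
  proof (rule L2_zero_if_orthogonal_to_test_functions[OF D])
    have GH: "(\<lambda>x. G x $ i $ j) \<in> L2_space D" "(\<lambda>x. H x $ i $ j) \<in> L2_space D"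
      using G H by (auto intro: L2_space_vec_nth)
    then show "(\<lambda>x. G x $ i $ j - H x $ i $ j) \<in> L2_space D" by (rule L2_space_diff)
    fix \<phi> assume \<phi>: "\<phi> \<in> test_functions D"
    have "- (\<integral>x. G x $ i $ j * \<phi> x \<partial>lebesgue_on D) = - (\<integral>x. H x $ i $ j * \<phi> x \<partial>lebesgue_on D)"
      using G(2)[unfolded has_weak_gradient_def, rule_format, OF \<phi>, of i j]
        H(2)[unfolded has_weak_gradient_def, rule_format, OF \<phi>, of i j] by simp
    then show "(\<integral>x. (G x $ i $ j - H x $ i $ j) * \<phi> x \<partial>lebesgue_on D) = 0"
      using L2_mult_test_function_integrable[OF Dm GH(1) \<phi>] L2_mult_test_function_integrable[OF Dm GH(2) \<phi>]
      by (simp add: left_diff_distrib)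
  qed
  then have "AE x in lebesgue_on D. \<forall>i j. G x $ i $ j - H x $ i $ j = 0"
    by (simp add: AE_all_countable)
  then show ?thesis by eventually_elim (simp add: vec_eq_iff)
qed

section \<open>The first-order Sobolev space\<close>

lemma H1_spaceD:
  assumes "f \<in> H1_space D"
  shows "f \<in> L2_space D" "weak_grad D f \<in> L2_space D" "has_weak_gradient D f (weak_grad D f)"
proof -
  show "f \<in> L2_space D" using assms by (simp add: H1_space_def)
  have "\<exists>G. G \<in> L2_space D \<and> has_weak_gradient D f G" using assms by (auto simp: H1_space_def)
  from someI_ex[OF this] show "weak_grad D f \<in> L2_space D" "has_weak_gradient D f (weak_grad D f)"
    by (auto simp: weak_grad_def)
qed

lemma H1_spaceI:
  "f \<in> L2_space D \<Longrightarrow> G \<in> L2_space D \<Longrightarrow> has_weak_gradient D f G \<Longrightarrow> f \<in> H1_space D"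
  by (auto simp: H1_space_def)

text \<open>Uniqueness makes the choice in \<open>weak_grad\<close> computable: any square
  integrable candidate that satisfies the defining identities agrees with it almost everywhere. All
  rules for sums, multiples and constants go through this.\<close>

lemma weak_grad_AE_eq:
  assumes "open D" "bounded D" "f \<in> L2_space D" "G \<in> L2_space D" "has_weak_gradient D f G"
  shows "AE x in lebesgue_on D. weak_grad D f x = G x"
  using has_weak_gradient_unique[OF assms(1,2)] H1_spaceD[OF H1_spaceI[OF assms(3-5)]] assms by blast

lemma has_weak_gradient_add:
  assumes D: "D \<in> sets lebesgue"
    and "f \<in> L2_space D" "G \<in> L2_space D" "has_weak_gradient D f G"
    and "f' \<in> L2_space D" "G' \<in> L2_space D" "has_weak_gradient D f' G'"
  shows "has_weak_gradient D (\<lambda>x. f x + f' x) (\<lambda>x. G x + G' x)"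
  unfolding has_weak_gradient_def
proof (intro ballI allI)
  fix \<phi> i j assume \<phi>: "\<phi> \<in> test_functions D"
  note I = L2_mult_test_function_integrable[OF D _ test_functions_partial_deriv[OF \<phi>]]
    L2_mult_test_function_integrable[OF D _ \<phi>]
  show "(\<integral>x. (f x + f' x) $ i * partial_deriv j \<phi> x \<partial>lebesgue_on D) =
      - (\<integral>x. (G x + G' x) $ i $ j * \<phi> x \<partial>lebesgue_on D)"
    using assms(4,7) \<phi> I(1)[OF L2_space_vec_nth[OF assms(2)]] I(1)[OF L2_space_vec_nth[OF assms(5)]]
      I(2)[OF L2_space_vec_nth[OF L2_space_vec_nth[OF assms(3)]]]
      I(2)[OF L2_space_vec_nth[OF L2_space_vec_nth[OF assms(6)]]]
    by (simp add: distrib_right has_weak_gradient_def)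
qed

lemma has_weak_gradient_scaleR:
  assumes "has_weak_gradient D f G"
  shows "has_weak_gradient D (\<lambda>x. c *\<^sub>R f x) (\<lambda>x. c *\<^sub>R G x)"
  using assms by (simp add: has_weak_gradient_def mult.assoc)

lemma has_weak_gradient_const:
  fixes D :: "(real^'n) set"
  assumes "D \<in> sets lebesgue"
  shows "has_weak_gradient D (\<lambda>x. c) (\<lambda>x. 0)"
  unfolding has_weak_gradient_def
proof (intro ballI allI)
  fix \<phi> and i j :: 'n assume \<phi>: "\<phi> \<in> test_functions D"
  have "(\<integral>x. c $ i * partial_deriv j \<phi> x \<partial>lebesgue_on D) =
      (\<integral>x. (indicator D x * c $ i) * partial_deriv j \<phi> x \<partial>lebesgue)"
    by (rule integral_lebesgue_on_mult_test_function[OF assms test_functions_partial_deriv[OF \<phi>]])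
  also have "\<dots> = (\<integral>x. c $ i * partial_deriv j \<phi> x \<partial>lebesgue)"
    using test_functions_zero_outside[OF test_functions_partial_deriv[OF \<phi>]]
    by (intro Bochner_Integration.integral_cong) (auto simp: indicator_def)
  also have "\<dots> = 0" by (simp add: integral_partial_deriv_test_function[OF \<phi>])
  finally show "(\<integral>x. c $ i * partial_deriv j \<phi> x \<partial>lebesgue_on D) =
      - (\<integral>x. 0 $ i $ j * \<phi> x \<partial>lebesgue_on D)" by simp
qed

lemma weak_grad_const_AE:
  assumes "open D" "bounded D"
  shows "AE x in lebesgue_on D. weak_grad D (\<lambda>x. c) x = 0"
  using assms by (intro weak_grad_AE_eq has_weak_gradient_const L2_space_const L2_space_zero) auto

lemma H1_space_const:
  assumes "open D" "bounded D"
  shows "(\<lambda>x. c) \<in> H1_space D"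
  using assms by (intro H1_spaceI[OF L2_space_const L2_space_zero has_weak_gradient_const]) auto

lemma weak_grad_add_AE:
  assumes "open D" "bounded D" "f \<in> H1_space D" "g \<in> H1_space D"
  shows "AE x in lebesgue_on D. weak_grad D (\<lambda>x. f x + g x) x = weak_grad D f x + weak_grad D g x"
proof -
  note f = H1_spaceD[OF assms(3)] and g = H1_spaceD[OF assms(4)]
  show ?thesis
    by (rule weak_grad_AE_eq[OF assms(1,2) L2_space_add[OF f(1) g(1)] L2_space_add[OF f(2) g(2)]
          has_weak_gradient_add[OF _ f g]]) (use assms(1) in simp)
qed

lemma H1_space_add:
  assumes "open D" "f \<in> H1_space D" "g \<in> H1_space D"
  shows "(\<lambda>x. f x + g x) \<in> H1_space D"
proof -
  note f = H1_spaceD[OF assms(2)] and g = H1_spaceD[OF assms(3)]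
  show ?thesis
    by (rule H1_spaceI[OF L2_space_add[OF f(1) g(1)] L2_space_add[OF f(2) g(2)]
          has_weak_gradient_add[OF _ f g]]) (use assms(1) in simp)
qed

lemma weak_grad_scaleR_AE:
  assumes "open D" "bounded D" "f \<in> H1_space D"
  shows "AE x in lebesgue_on D. weak_grad D (\<lambda>x. c *\<^sub>R f x) x = c *\<^sub>R weak_grad D f x"
proof -
  note f = H1_spaceD[OF assms(3)]
  show ?thesis
    by (rule weak_grad_AE_eq[OF assms(1,2) L2_space_scaleR[OF f(1)] L2_space_scaleR[OF f(2)]
          has_weak_gradient_scaleR[OF f(3)]])
qed

lemma H1_space_scaleR:
  assumes "f \<in> H1_space D"
  shows "(\<lambda>x. c *\<^sub>R f x) \<in> H1_space D"
proof -
  note f = H1_spaceD[OF assms]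
  show ?thesis
    by (rule H1_spaceI[OF L2_space_scaleR[OF f(1)] L2_space_scaleR[OF f(2)]
          has_weak_gradient_scaleR[OF f(3)]])
qed

lemma weak_grad_minus_AE:
  assumes "open D" "bounded D" "f \<in> H1_space D"
  shows "AE x in lebesgue_on D. weak_grad D (\<lambda>x. - f x) x = - weak_grad D f x"
  using weak_grad_scaleR_AE[OF assms, of "-1"] by simp

lemma H1_space_minus: "f \<in> H1_space D \<Longrightarrow> (\<lambda>x. - f x) \<in> H1_space D"
  using H1_space_scaleR[of f D "-1"] by simp

lemma weak_grad_diff_AE:
  assumes "open D" "bounded D" "f \<in> H1_space D" "g \<in> H1_space D"
  shows "AE x in lebesgue_on D. weak_grad D (\<lambda>x. f x - g x) x = weak_grad D f x - weak_grad D g x"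
  using weak_grad_add_AE[OF assms(1-3) H1_space_minus[OF assms(4)]] weak_grad_minus_AE[OF assms(1,2,4)]
  by (simp, eventually_elim) simp

lemma H1_space_diff:
  assumes "open D" "f \<in> H1_space D" "g \<in> H1_space D"
  shows "(\<lambda>x. f x - g x) \<in> H1_space D"
  using H1_space_add[OF assms(1,2) H1_space_minus[OF assms(3)]] by simp

lemma H1_inner_self: "H1_inner D f f = (L2_norm D (weak_grad D f))\<^sup>2 + (L2_norm D f)\<^sup>2"
  by (simp add: H1_inner_def L2_norm_power2)

lemma H1_norm_power2: "(H1_norm D f)\<^sup>2 = (H1_seminorm D f)\<^sup>2 + (L2_norm D f)\<^sup>2"
  by (simp add: H1_norm_def H1_inner_self H1_seminorm_def)

lemma H1_norm_nonneg: "H1_norm D f \<ge> 0"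
  by (simp add: H1_norm_def H1_inner_self)

lemma H1_seminorm_nonneg: "H1_seminorm D f \<ge> 0"
  by (simp add: H1_seminorm_def L2_norm_nonneg)

lemma L2_norm_le_H1_norm: "L2_norm D f \<le> H1_norm D f"
  by (rule power2_le_imp_le) (simp_all add: H1_norm_power2 H1_norm_nonneg)

lemma H1_seminorm_le_H1_norm: "H1_seminorm D f \<le> H1_norm D f"
  by (rule power2_le_imp_le) (simp_all add: H1_norm_power2 H1_norm_nonneg)

lemma H1_norm_minus:
  assumes "open D" "bounded D" "f \<in> H1_space D"
  shows "H1_norm D (\<lambda>x. - f x) = H1_norm D f"
proof -
  have "L2_norm D (weak_grad D (\<lambda>x. - f x)) = L2_norm D (\<lambda>x. - weak_grad D f x)"
    by (rule L2_norm_cong_AE[OF _ _ weak_grad_minus_AE[OF assms]])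
      (rule H1_spaceD(2)[OF H1_space_minus[OF assms(3)]] L2_space_minus[OF H1_spaceD(2)[OF assms(3)]])+
  then show ?thesis by (simp add: H1_norm_def H1_inner_self L2_norm_minus)
qed

lemma H1_norm_const:
  assumes "open D" "bounded D"
  shows "H1_norm D (\<lambda>x. c) = L2_norm D (\<lambda>x. c)"
proof -
  have "L2_inner D (weak_grad D (\<lambda>x. c)) (weak_grad D (\<lambda>x. c)) = 0"
    by (rule L2_inner_AE_zero_left[OF weak_grad_const_AE[OF assms]])
  then show ?thesis by (simp add: H1_norm_def H1_inner_def L2_norm_def)
qed

section \<open>Korn inequality\<close>

lemma L2_space_componentwise:
  fixes f :: "real^'n \<Rightarrow> 'b::euclidean_space^'m"
  assumes "\<And>i. (\<lambda>x. f x $ i) \<in> L2_space D"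
  shows "f \<in> L2_space D"
proof -
  have "linear (axis i :: 'b \<Rightarrow> 'b^'m)" for i
    by (rule linearI) (simp_all add: axis_def vec_eq_iff)
  then have "(\<lambda>x. \<Sum>i\<in>UNIV. axis i (f x $ i)) \<in> L2_space D"
    using assms by (intro L2_space_sum L2_space_linear[where l = "axis _"]) auto
  moreover have "(\<Sum>i\<in>UNIV. axis i (f x $ i)) = f x" for x
    by (simp add: vec_eq_iff axis_def if_distrib sum.delta cong: if_cong)
  ultimately show ?thesis by simp
qed

definition jacobian_field :: "(real^'n \<Rightarrow> real^'n) \<Rightarrow> real^'n \<Rightarrow> real^'n^'n" where
  "jacobian_field \<phi> x = (\<chi> i j. partial_deriv j (\<lambda>y. \<phi> y $ i) x)"

lemma test_fields_weak_gradient: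
  assumes D: "open D" and \<phi>: "\<phi> \<in> test_fields D"
  shows "\<phi> \<in> L2_space D" "jacobian_field \<phi> \<in> L2_space D" "has_weak_gradient D \<phi> (jacobian_field \<phi>)"
proof -
  have Dm: "D \<in> sets lebesgue" using D by simp
  have t: "(\<lambda>x. \<phi> x $ i) \<in> test_functions D" for i using \<phi> by (simp add: test_fields_def)
  show "\<phi> \<in> L2_space D"
    by (intro L2_space_componentwise test_functions_L2_space[OF Dm t])
  show "jacobian_field \<phi> \<in> L2_space D"
    unfolding jacobian_field_def[abs_def]
    by (intro L2_space_componentwise)
      (simp, rule test_functions_L2_space[OF Dm test_functions_partial_deriv[OF t]])
  show "has_weak_gradient D \<phi> (jacobian_field \<phi>)"
    unfolding has_weak_gradient_def
  proof (intro ballI allI)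
    fix \<psi> i j assume \<psi>: "\<psi> \<in> test_functions D"
    have ind: "(indicator D x * a) * \<theta> x = a * \<theta> x" if "\<theta> \<in> test_functions D" for \<theta> x and a :: real
      using test_functions_zero_outside[OF that, of x] by (auto simp: indicator_def)
    show "(\<integral>x. \<phi> x $ i * partial_deriv j \<psi> x \<partial>lebesgue_on D) =
        - (\<integral>x. jacobian_field \<phi> x $ i $ j * \<psi> x \<partial>lebesgue_on D)"
      using integration_by_parts_test_functions[OF t \<psi>, of i j]
      by (simp add: integral_lebesgue_on_mult_test_function[OF Dm test_functions_partial_deriv[OF \<psi>]]
          integral_lebesgue_on_mult_test_function[OF Dm \<psi>] ind[OF \<psi>]
          ind[OF test_functions_partial_deriv[OF \<psi>]] jacobian_field_def)
  qed
qed

definition sym_part :: "real^'n^'n \<Rightarrow> real^'n^'n" where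
  "sym_part M = (1/2) *\<^sub>R (M + transpose M)"

lemma transpose_inner_transpose: "transpose M \<bullet> transpose N = M \<bullet> (N :: real^'n^'m)"
  by (simp add: inner_vec_def transpose_def) (rule sum.swap)

lemma transpose_add: "transpose (M + N) = transpose M + transpose (N :: real^'n^'m)"
  by (simp add: transpose_def vec_eq_iff)

lemma transpose_scaleR: "transpose (c *\<^sub>R M) = c *\<^sub>R transpose (M :: real^'n^'m)"
  by (simp add: transpose_def vec_eq_iff)

lemma linear_transpose: "linear (transpose :: real^'n^'m \<Rightarrow> real^'m^'n)"
  by (rule linearI) (simp_all add: transpose_add transpose_scaleR)

lemma linear_sym_part: "linear sym_part"
  by (rule linearI) (simp_all add: sym_part_def transpose_add transpose_scaleR algebra_simps)

lemma inner_sym_part: "sym_part M \<bullet> sym_part M = (1/2) * (M \<bullet> M) + (1/2) * (M \<bullet> transpose M)"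
proof -
  have "sym_part M \<bullet> sym_part M =
      (1/4) * (M \<bullet> M + M \<bullet> transpose M + transpose M \<bullet> M + transpose M \<bullet> transpose M)"
    by (simp add: sym_part_def inner_add_left inner_add_right field_simps)
  then show ?thesis
    by (simp add: transpose_inner_transpose inner_commute[of "transpose M" M])
qed

lemma norm_sym_part_le: "norm (sym_part M) \<le> norm M"
proof -
  have "norm (transpose M) = norm M"
    by (simp add: norm_eq_sqrt_inner transpose_inner_transpose)
  then show ?thesis
    using norm_triangle_ineq[of M "transpose M"] by (simp add: sym_part_def)
qed

lemma L2_norm_mono:
  assumes "f \<in> L2_space D" "g \<in> L2_space D" "\<And>x. norm (f x) \<le> norm (g x)"
  shows "L2_norm D f \<le> L2_norm D g"
  unfolding L2_norm_def L2_inner_self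
  by (intro real_sqrt_le_mono integral_mono L2_spaceD assms power_mono) auto

text \<open>Since 2 |sym M|^2 = |M|^2 + M : M^T, it suffices that the cross term has a nonnegative
  integral. Exchanging the two derivatives turns the products d_ij d_ji into d_ii d_jj, and these
  sum to the square of the divergence. This also explains the factor sqrt 2.\<close>

lemma korn_test_fields:
  assumes D: "open D" and \<phi>: "\<phi> \<in> test_fields D"
  shows "L2_norm D (jacobian_field \<phi>) \<le> sqrt 2 * L2_norm D (\<lambda>x. sym_part (jacobian_field \<phi> x))"
proof -
  let ?J = "jacobian_field \<phi>"
  have Dm: "D \<in> sets lebesgue" using D by simp
  have t: "(\<lambda>x. \<phi> x $ i) \<in> test_functions D" for i using \<phi> by (simp add: test_fields_def)
  note J = test_fields_weak_gradient(2)[OF D \<phi>]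
  note JT = L2_space_linear[OF linear_transpose J]
  define d where "d i j = partial_deriv j (\<lambda>y. \<phi> y $ i)" for i j
  have dt: "d i j \<in> test_functions D" for i j
    unfolding d_def by (rule test_functions_partial_deriv[OF t])
  have dd: "integrable lebesgue (\<lambda>x. d i j x * d k l x)" for i j k l
    by (rule integrable_mult_test_function[OF test_functions_integrable[OF dt] dt])
  have "L2_inner D ?J (\<lambda>x. transpose (?J x)) =
      (\<integral>x. (\<Sum>i\<in>UNIV. \<Sum>j\<in>UNIV. d i j x * d j i x) \<partial>lebesgue)"
    unfolding L2_inner_lebesgue[OF Dm]
  proof (intro Bochner_Integration.integral_cong refl)
    fix x
    have "d i j x = 0" if "x \<notin> D" for i j using test_functions_zero_outside[OF dt that] .
    then show "indicator D x * (?J x \<bullet> transpose (?J x)) = (\<Sum>i\<in>UNIV. \<Sum>j\<in>UNIV. d i j x * d j i x)"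
      by (cases "x \<in> D") (simp_all add: inner_vec_def transpose_def jacobian_field_def d_def)
  qed
  also have "\<dots> = (\<Sum>i\<in>UNIV. \<Sum>j\<in>UNIV. (\<integral>x. d i j x * d j i x \<partial>lebesgue))"
    using dd by simp
  also have "\<dots> = (\<Sum>i\<in>UNIV. \<Sum>j\<in>UNIV. (\<integral>x. d i i x * d j j x \<partial>lebesgue))"
    unfolding d_def by (subst integral_partial_deriv_swap[OF t t]) simp
  also have "\<dots> = (\<integral>x. (\<Sum>i\<in>UNIV. \<Sum>j\<in>UNIV. d i i x * d j j x) \<partial>lebesgue)"
    using dd by simp
  also have "\<dots> = (\<integral>x. (\<Sum>i\<in>UNIV. d i i x)\<^sup>2 \<partial>lebesgue)"
    by (simp add: power2_eq_square sum_product)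
  also have "\<dots> \<ge> 0" by simp
  finally have pos: "L2_inner D ?J (\<lambda>x. transpose (?J x)) \<ge> 0" .
  have "L2_inner D (\<lambda>x. sym_part (?J x)) (\<lambda>x. sym_part (?J x)) =
      (1/2) * L2_inner D ?J ?J + (1/2) * L2_inner D ?J (\<lambda>x. transpose (?J x))"
    using L2_inner_integrable[OF J J] L2_inner_integrable[OF J JT]
    by (simp add: L2_inner_def inner_sym_part)
  with pos have "(L2_norm D ?J)\<^sup>2 \<le> 2 * (L2_norm D (\<lambda>x. sym_part (?J x)))\<^sup>2"
    by (simp add: L2_norm_power2)
  also have "\<dots> = (sqrt 2 * L2_norm D (\<lambda>x. sym_part (?J x)))\<^sup>2"
    by (simp add: power_mult_distrib)
  finally show ?thesis
    by (rule power2_le_imp_le) (simp add: L2_norm_nonneg)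
qed

lemma sym_grad_eq: "sym_grad D u = (\<lambda>x. sym_part (weak_grad D u x))"
  by (simp add: sym_grad_def[abs_def] sym_part_def)

text \<open>The inequality for test fields survives the limit because both gradient norms are
  continuous along the H1 convergence that defines \<open>H10_space\<close>.\<close>

lemma korn_H10:
  fixes D :: "(real^'n) set"
  assumes D: "open D" "bounded D" and u: "u \<in> H10_space D"
  shows "(H1_seminorm D u)\<^sup>2 \<le> 2 * L2_inner D (sym_grad D u) (sym_grad D u)"
proof -
  obtain \<phi> where \<phi>: "\<And>n. \<phi> n \<in> test_fields D" "(\<lambda>n. H1_norm D (\<lambda>x. u x - \<phi> n x)) \<longlonglongrightarrow> 0"
    using u unfolding H10_space_def by blast
  have uH: "u \<in> H1_space D" using u by (simp add: H10_space_def)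
  let ?G = "weak_grad D u" and ?J = "\<lambda>n. jacobian_field (\<phi> n)"
  let ?e = "\<lambda>n. H1_norm D (\<lambda>x. u x - \<phi> n x)"
  note G = H1_spaceD(2)[OF uH]
  note tf = test_fields_weak_gradient[OF D(1) \<phi>(1)]
  have \<phi>H: "\<phi> n \<in> H1_space D" for n by (rule H1_spaceI[OF tf])
  \<comment> \<open>The H1 norm of the difference involves its own chosen weak gradient, which has
    to be identified with the difference of the two gradients.\<close>
  have e: "L2_norm D (\<lambda>x. ?G x - ?J n x) \<le> ?e n" for n
  proof -
    have "AE x in lebesgue_on D. weak_grad D (\<lambda>x. u x - \<phi> n x) x = ?G x - ?J n x"
      using weak_grad_diff_AE[OF D uH \<phi>H[of n]] weak_grad_AE_eq[OF D tf, of n]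
      by eventually_elim simp
    then have "L2_norm D (weak_grad D (\<lambda>x. u x - \<phi> n x)) = L2_norm D (\<lambda>x. ?G x - ?J n x)"
      by (intro L2_norm_cong_AE[OF H1_spaceD(2)[OF H1_space_diff[OF D(1) uH \<phi>H]] L2_space_diff[OF G tf(2)]])
    then show ?thesis
      using H1_seminorm_le_H1_norm[of D "\<lambda>x. u x - \<phi> n x"] by (simp add: H1_seminorm_def)
  qed
  have SG: "(\<lambda>x. sym_part (?G x)) \<in> L2_space D" by (rule L2_space_linear[OF linear_sym_part G])
  \<comment> \<open>The error enters twice: once through the full gradient, and once through the
    symmetrized one, where Korn's constant multiplies it.\<close>
  have bound: "L2_norm D ?G \<le> sqrt 2 * L2_norm D (\<lambda>x. sym_part (?G x)) + (sqrt 2 + 1) * ?e n" for n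
  proof -
    note J = tf(2)[of n]
    have SJ: "(\<lambda>x. sym_part (?J n x)) \<in> L2_space D" by (rule L2_space_linear[OF linear_sym_part J])
    have W: "(\<lambda>x. ?G x - ?J n x) \<in> L2_space D" by (rule L2_space_diff[OF G J])
    have "L2_norm D (\<lambda>x. sym_part (?J n x)) \<le>
        L2_norm D (\<lambda>x. sym_part (?G x)) + L2_norm D (\<lambda>x. sym_part (?J n x) - sym_part (?G x))"
      by (rule L2_norm_diff_triangle[OF SJ SG])
    also have "(\<lambda>x. sym_part (?J n x) - sym_part (?G x)) = (\<lambda>x. - sym_part (?G x - ?J n x))"
      by (simp add: linear_diff[OF linear_sym_part])
    also have "L2_norm D \<dots> = L2_norm D (\<lambda>x. sym_part (?G x - ?J n x))" by (rule L2_norm_minus)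
    also have "\<dots> \<le> L2_norm D (\<lambda>x. ?G x - ?J n x)"
      by (rule L2_norm_mono[OF L2_space_linear[OF linear_sym_part W] W norm_sym_part_le])
    finally have 1: "L2_norm D (\<lambda>x. sym_part (?J n x)) \<le> L2_norm D (\<lambda>x. sym_part (?G x)) + ?e n"
      using e[of n] by simp
    have "L2_norm D ?G \<le> L2_norm D (?J n) + L2_norm D (\<lambda>x. ?G x - ?J n x)"
      by (rule L2_norm_diff_triangle[OF G J])
    also have "\<dots> \<le> sqrt 2 * L2_norm D (\<lambda>x. sym_part (?J n x)) + ?e n"
      by (intro add_mono e korn_test_fields[OF D(1) \<phi>(1)])
    also have "\<dots> \<le> sqrt 2 * (L2_norm D (\<lambda>x. sym_part (?G x)) + ?e n) + ?e n"
      using 1 by simp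
    finally show ?thesis by (simp add: algebra_simps)
  qed
  have "(\<lambda>n. sqrt 2 * L2_norm D (\<lambda>x. sym_part (?G x)) + (sqrt 2 + 1) * ?e n) \<longlonglongrightarrow>
      sqrt 2 * L2_norm D (\<lambda>x. sym_part (?G x)) + (sqrt 2 + 1) * 0"
    by (intro tendsto_intros \<phi>(2))
  then have "L2_norm D ?G \<le> sqrt 2 * L2_norm D (\<lambda>x. sym_part (?G x)) + (sqrt 2 + 1) * 0"
    by (rule LIMSEQ_le_const) (use bound in blast)
  then have "(L2_norm D ?G)\<^sup>2 \<le> (sqrt 2 * L2_norm D (\<lambda>x. sym_part (?G x)))\<^sup>2"
    by (intro power_mono) (simp_all add: L2_norm_nonneg)
  then show ?thesis
    by (simp add: H1_seminorm_def sym_grad_eq L2_norm_power2[symmetric] power_mult_distrib)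
qed

section \<open>Poincare inequality\<close>

text \<open>A scalar component with its gradient as a row. The Borel condition picks a
  representative for which translation and iterated integrals over \<open>lborel\<close> are
  available.\<close>

definition weak_pair :: "(real^'n) set \<Rightarrow> (real^'n \<Rightarrow> real) \<Rightarrow> (real^'n \<Rightarrow> real^'n) \<Rightarrow> bool" where
  "weak_pair D f g \<longleftrightarrow> f \<in> borel_measurable borel \<and> f \<in> L2_space D \<and> g \<in> L2_space D \<and>
     (\<forall>\<phi>\<in>test_functions D. \<forall>j. (\<integral>x. f x * partial_deriv j \<phi> x \<partial>lebesgue_on D) =
        - (\<integral>x. g x $ j * \<phi> x \<partial>lebesgue_on D))"

lemma integrable_lebesgue_translate:
  fixes f :: "'a::euclidean_space \<Rightarrow> real"
  assumes [measurable]: "f \<in> borel_measurable borel" and "integrable lebesgue f"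
  shows "integrable lebesgue (\<lambda>x. f (x + a))"
proof -
  have "integrable (distr lborel borel ((+) a)) f"
    using assms by (simp add: lborel_distr_plus integrable_completion)
  then have "integrable lborel (\<lambda>x. f (a + x))"
    by (subst (asm) integrable_distr_eq) auto
  then show ?thesis by (simp add: integrable_completion add.commute)
qed

lemma square_integrable_imp_integrable_on:
  assumes D: "D \<in> lmeasurable" and f: "f \<in> borel_measurable lebesgue" "integrable lebesgue (\<lambda>x. (f x)\<^sup>2)"
    "\<And>x. x \<notin> D \<Longrightarrow> f x = (0::real)"
  shows "integrable lebesgue f"
proof (rule Bochner_Integration.integrable_bound)
  show "integrable lebesgue (\<lambda>x. indicat_real D x + (f x)\<^sup>2)"
    using D f by (simp add: lmeasurable_iff_integrable)
  have "\<bar>f x\<bar> \<le> indicat_real D x + (f x)\<^sup>2" for x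
  proof (cases "x \<in> D")
    case True
    have "0 \<le> (\<bar>f x\<bar> - 1/2)\<^sup>2" by simp
    then show ?thesis using True by (simp add: power2_eq_square algebra_simps)
  qed (simp add: f)
  then show "AE x in lebesgue. norm (f x) \<le> norm (indicat_real D x + (f x)\<^sup>2)"
    by (auto intro: order_trans)
qed (rule f)

text \<open>Differentiating \<open>t \<mapsto> \<integral> f(x) \<eta>(x - th) dx\<close> moves the weak derivative of \<open>f\<close> onto \<open>f(x + h) - f(x)\<close>
  without mollifying \<open>f\<close>.\<close>

lemma weak_pair_translation_estimate:
  fixes f :: "real^'n \<Rightarrow> real" and h :: "real^'n"
  assumes D: "open D" "bounded D" and fg: "weak_pair D f g"
    and A: "open A" "convex A" "A \<subseteq> D"
  defines "Ah \<equiv> A \<inter> {x. x + h \<in> A}"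
  shows "integrable lebesgue (\<lambda>x. (indicator Ah x * (f (x + h) - f x))\<^sup>2)"
    "(\<integral>x. (indicator Ah x * (f (x + h) - f x))\<^sup>2 \<partial>lebesgue) \<le> (norm h)\<^sup>2 * L2_inner D g g"
proof -
  have Dm: "D \<in> sets lebesgue" "D \<in> lmeasurable" using D lmeasurable_open by auto
  define F where "F x = indicator D x * f x" for x
  have f: "f \<in> borel_measurable borel" "f \<in> L2_space D" "g \<in> L2_space D"
    using fg by (auto simp: weak_pair_def)
  have Fb[measurable]: "F \<in> borel_measurable borel" unfolding F_def[abs_def] using f(1) D(1) by simp
  have F2: "integrable lebesgue (\<lambda>x. (F x)\<^sup>2)"
    unfolding F_def by (rule L2_space_extend(2)[OF Dm(1) f(2)])
  have "F \<in> borel_measurable lebesgue" using Fb by (intro measurable_completion) simp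
  then have F1: "integrable lebesgue F"
    by (rule square_integrable_imp_integrable_on[OF Dm(2) _ F2]) (simp add: F_def)
  have "Ah = A \<inter> (\<lambda>x. x + h) -` A" by (auto simp: Ah_def)
  then have Aho: "open Ah"
    using A(1) by (auto intro!: open_Int continuous_open_vimage continuous_intros)
  have AhD: "Ah \<subseteq> A" "Ah \<subseteq> D" using A(3) by (auto simp: Ah_def)
  have Ahb: "bounded Ah" using AhD(2) D(2) bounded_subset by blast
  define u where "u x = indicator Ah x * (f (x + h) - f x)" for x
  \<comment> \<open>On \<open>Ah\<close> both x and x + h lie in D, so \<open>f\<close> may be
    replaced by its extension by 0, which is integrable over the whole space.\<close>
  have uF: "u x = indicator Ah x * (F (x + h) - F x)" for x
    using A(3) by (auto simp: u_def F_def Ah_def indicator_def)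
  have "Ah \<in> sets borel" using Aho by simp
  moreover have "(\<lambda>x. F (x + h)) \<in> borel_measurable borel" by measurable
  ultimately have ub: "u \<in> borel_measurable borel"
    unfolding uF[abs_def] by (intro borel_measurable_times borel_measurable_diff Fb) simp_all
  have um: "u \<in> borel_measurable lebesgue" using ub by (intro measurable_completion) simp
  have FF: "integrable lebesgue (\<lambda>x. (F (x + h) + (- F x))\<^sup>2)"
  proof (rule square_integrable_add)
    show "integrable lebesgue (\<lambda>x. (F (x + h))\<^sup>2)"
      using integrable_lebesgue_translate[of "\<lambda>x. (F x)\<^sup>2" h] F2 by simp
  qed (use F2 in \<open>auto intro!: measurable_completion\<close>)
  have u2: "integrable lebesgue (\<lambda>x. (u x)\<^sup>2)"
  proof (rule Bochner_Integration.integrable_bound[OF FF])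
    show "AE x in lebesgue. norm ((u x)\<^sup>2) \<le> norm ((F (x + h) + (- F x))\<^sup>2)"
      by (auto simp: uF indicator_def)
  qed (use um in simp)
  then show "integrable lebesgue (\<lambda>x. (indicator Ah x * (f (x + h) - f x))\<^sup>2)" by (simp add: u_def)
  define M where "M = norm h * L2_norm D g"
  have M: "M \<ge> 0" by (simp add: M_def L2_norm_nonneg)
  have "(\<integral>x. (u x)\<^sup>2 \<partial>lebesgue) \<le> M\<^sup>2"
  proof (rule test_function_duality[OF Aho Ahb um u2 _ M])
    show "u x = 0" if "x \<notin> Ah" for x using that by (simp add: u_def)
    fix \<eta> assume \<eta>: "\<eta> \<in> test_functions Ah"
    define N where "N = sqrt (\<integral>x. (\<eta> x)\<^sup>2 \<partial>lebesgue)"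
    have \<eta>b[measurable]: "\<eta> \<in> borel_measurable borel" by (rule test_functions_measurable[OF \<eta>])
    define \<Phi> where "\<Phi> t = (\<integral>x. F x * \<eta> (x - t *\<^sub>R h) \<partial>lebesgue)" for t
    define \<Phi>' where "\<Phi>' t = - (\<integral>x. F x * (\<Sum>j\<in>UNIV. h $ j * partial_deriv j \<eta> (x - t *\<^sub>R h)) \<partial>lebesgue)" for t
    have der: "(\<Phi> has_real_derivative \<Phi>' t) (at t within S)" for t S
      unfolding \<Phi>_def[abs_def] \<Phi>'_def
      by (rule has_field_derivative_at_within[OF translation_integral_derivative[OF F1 \<eta>]])
    have bound: "norm (\<Phi>' t) \<le> M * N" if t: "t \<in> {0..1}" for t
    proof -
      define \<theta> where "\<theta> x = \<eta> (x + - (t *\<^sub>R h))" for x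
      have "\<theta> \<in> test_functions A"
        unfolding \<theta>_def[abs_def]
      proof (rule test_functions_translate[OF \<eta>])
        fix x assume "x \<in> Ah"
        \<comment> \<open>Convexity enters here: x and x + h lie in A, hence the support of \<eta>
          stays in A while it is shifted by t h.\<close>
        then have "(1 - t) *\<^sub>R x + t *\<^sub>R (x + h) \<in> A"
          using t by (intro convexD_alt[OF A(2)]) (auto simp: Ah_def)
        then show "x - - (t *\<^sub>R h) \<in> A" by (simp add: algebra_simps)
      qed
      then have \<theta>: "\<theta> \<in> test_functions D" using test_functions_mono[OF A(3)] by blast
      have pd: "partial_deriv j \<theta> x = partial_deriv j \<eta> (x - t *\<^sub>R h)" for j x
      proof -
        have "\<eta> differentiable at y" for y
          by (rule C_k_differentiable[OF test_functions_C_k[OF \<eta>]])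
        then show ?thesis
          unfolding \<theta>_def[abs_def] using partial_deriv_translate[of \<eta> x "- (t *\<^sub>R h)" j] by simp
      qed
      have gj: "(\<lambda>x. g x $ j) \<in> L2_space D" for j by (rule L2_space_vec_nth[OF f(3)])
      have int: "integrable lebesgue (\<lambda>x. F x * partial_deriv j \<theta> x)" for j
        by (rule integrable_mult_test_function[OF F1 test_functions_partial_deriv[OF \<theta>]])
      have wg: "(\<integral>x. F x * partial_deriv j \<theta> x \<partial>lebesgue) = - (\<integral>x. g x $ j * \<theta> x \<partial>lebesgue_on D)" for j
        using fg \<theta> integral_lebesgue_on_mult_test_function[OF Dm(1) test_functions_partial_deriv[OF \<theta>], of f j]
        by (simp add: weak_pair_def F_def)
      have gh: "(\<lambda>x. g x \<bullet> h) \<in> L2_space D"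
        by (rule L2_space_linear[where l = "\<lambda>y. y \<bullet> h", OF _ f(3)])
          (auto intro!: linearI simp: inner_add_left)
      have "\<Phi>' t = - (\<integral>x. (\<Sum>j\<in>UNIV. h $ j * (F x * partial_deriv j \<theta> x)) \<partial>lebesgue)"
        unfolding \<Phi>'_def pd by (simp add: sum_distrib_left mult.left_commute)
      also have "\<dots> = (\<Sum>j\<in>UNIV. h $ j * (\<integral>x. g x $ j * \<theta> x \<partial>lebesgue_on D))"
        using int by (simp add: wg sum_negf)
      also have "\<dots> = (\<integral>x. (\<Sum>j\<in>UNIV. h $ j * (g x $ j * \<theta> x)) \<partial>lebesgue_on D)"
        using L2_mult_test_function_integrable[OF Dm(1) gj \<theta>] by simp
      also have "\<dots> = L2_inner D (\<lambda>x. g x \<bullet> h) \<theta>"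
        by (simp add: L2_inner_def inner_vec_def sum_distrib_left sum_distrib_right mult_ac)
      finally have 1: "\<bar>\<Phi>' t\<bar> \<le> L2_norm D (\<lambda>x. g x \<bullet> h) * L2_norm D \<theta>"
        using L2_inner_Cauchy_Schwarz[OF gh test_functions_L2_space[OF Dm(1) \<theta>]] by simp
      have hg: "(\<lambda>x. norm h *\<^sub>R g x) \<in> L2_space D" by (rule L2_space_scaleR[OF f(3)])
      have "L2_norm D (\<lambda>x. g x \<bullet> h) \<le> L2_norm D (\<lambda>x. norm h *\<^sub>R g x)"
        by (rule L2_norm_mono[OF gh hg]) (simp add: Cauchy_Schwarz_ineq2 mult.commute[of "norm h"])
      also have "\<dots> = M"
        by (simp add: L2_norm_def L2_inner_scaleR_left L2_inner_scaleR_right real_sqrt_mult M_def)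
      finally have 2: "L2_norm D (\<lambda>x. g x \<bullet> h) \<le> M" .
      have 3: "L2_norm D \<theta> = N"
      proof -
        have "L2_inner D \<theta> \<theta> = (\<integral>x. (\<theta> x)\<^sup>2 \<partial>lebesgue)"
          unfolding L2_inner_lebesgue[OF Dm(1)]
          by (intro Bochner_Integration.integral_cong refl)
            (use test_functions_zero_outside[OF \<theta>] in \<open>auto simp: indicator_def power2_eq_square\<close>)
        also have "\<dots> = (\<integral>x. (\<eta> x)\<^sup>2 \<partial>lebesgue)"
          unfolding \<theta>_def by (rule integral_lebesgue_translate) simp
        finally show ?thesis by (simp add: L2_norm_def N_def)
      qed
      show ?thesis
        using 1 mult_right_mono[OF 2, of N] by (simp add: 3 N_def)
    qed
    \<comment> \<open>The mean value inequality on [0, 1]. Substituting x + h for x in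
      \<open>\<Phi> 1\<close> shows that this increment is the integral of f(x + h) - f(x) against
      \<eta>.\<close>
    have "norm (\<Phi> 1 - \<Phi> 0) \<le> M * N * norm (1 - 0 :: real)"
      by (rule field_differentiable_bound[where S = "{0..1}", OF _ der bound]) auto
    then have "\<bar>\<Phi> 1 - \<Phi> 0\<bar> \<le> M * N" by simp
    moreover have "(\<integral>x. u x * \<eta> x \<partial>lebesgue) = \<Phi> 1 - \<Phi> 0"
    proof -
      have "(\<integral>x. u x * \<eta> x \<partial>lebesgue) = (\<integral>x. F (x + h) * \<eta> x - F x * \<eta> x \<partial>lebesgue)"
        by (intro Bochner_Integration.integral_cong refl)
          (use test_functions_zero_outside[OF \<eta>] in \<open>auto simp: uF indicator_def left_diff_distrib\<close>)
      also have "\<dots> = (\<integral>x. F (x + h) * \<eta> x \<partial>lebesgue) - (\<integral>x. F x * \<eta> x \<partial>lebesgue)"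
        by (intro Bochner_Integration.integral_diff integrable_mult_test_function[OF _ \<eta>] F1
            integrable_lebesgue_translate Fb)
      also have "(\<integral>x. F (x + h) * \<eta> x \<partial>lebesgue) = \<Phi> 1"
        using integral_lebesgue_translate[of "\<lambda>x. F x * \<eta> (x - h)" h] by (simp add: \<Phi>_def)
      finally show ?thesis by (simp add: \<Phi>_def)
    qed
    ultimately show "\<bar>\<integral>x. u x * \<eta> x \<partial>lebesgue\<bar> \<le> M * sqrt (\<integral>x. (\<eta> x)\<^sup>2 \<partial>lebesgue)"
      by (simp add: N_def)
  qed
  then show "(\<integral>x. (indicator Ah x * (f (x + h) - f x))\<^sup>2 \<partial>lebesgue) \<le> (norm h)\<^sup>2 * L2_inner D g g"
    by (simp add: u_def M_def power_mult_distrib L2_norm_power2)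
qed

text \<open>A mean-free measure of variation. Two sets are allowed so that it can be carried from
  set to set, and values in \<open>ennreal\<close> make it meaningful and monotone without
  integrability conditions.\<close>

definition oscillation :: "(real^'n) set \<Rightarrow> (real^'n) set \<Rightarrow> (real^'n \<Rightarrow> real) \<Rightarrow> ennreal" where
  "oscillation A C f =
     (\<integral>\<^sup>+x. (\<integral>\<^sup>+y. ennreal ((f x - f y)\<^sup>2) * indicator C y \<partial>lborel) * indicator A x \<partial>lborel)"

text \<open>The gradient on the right always runs over all of \<open>D\<close>, so that estimates
  for different pieces can be added and chained.\<close>

definition osc_bounded :: "(real^'n) set \<Rightarrow> (real^'n) set \<Rightarrow> (real^'n) set \<Rightarrow> bool" where
  "osc_bounded D A C \<longleftrightarrow>
     (\<exists>K\<ge>0. \<forall>f g. weak_pair D f g \<longrightarrow> oscillation A C f \<le> ennreal (K * L2_inner D g g))"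

lemma oscillation_mono: "A \<subseteq> A' \<Longrightarrow> C \<subseteq> C' \<Longrightarrow> oscillation A C f \<le> oscillation A' C' f"
  unfolding oscillation_def
  by (intro nn_integral_mono mult_mono mult_left_mono) (auto simp: indicator_def)

lemma osc_bounded_mono: "osc_bounded D A' C' \<Longrightarrow> A \<subseteq> A' \<Longrightarrow> C \<subseteq> C' \<Longrightarrow> osc_bounded D A C"
  unfolding osc_bounded_def by (meson oscillation_mono order_trans)

lemma oscillation_sym:
  assumes [measurable]: "f \<in> borel_measurable borel" "A \<in> sets borel" "C \<in> sets borel"
  shows "oscillation A C f = oscillation C A f"
proof -
  have "oscillation A C f =
      (\<integral>\<^sup>+x. (\<integral>\<^sup>+y. ennreal ((f x - f y)\<^sup>2) * indicator C y * indicator A x \<partial>lborel) \<partial>lborel)"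
    by (simp add: oscillation_def nn_integral_multc)
  also have "\<dots> =
      (\<integral>\<^sup>+y. (\<integral>\<^sup>+x. ennreal ((f x - f y)\<^sup>2) * indicator C y * indicator A x \<partial>lborel) \<partial>lborel)"
    by (rule lborel_pair.Fubini') measurable
  also have "\<dots> =
      (\<integral>\<^sup>+y. (\<integral>\<^sup>+x. ennreal ((f y - f x)\<^sup>2) * indicator A x * indicator C y \<partial>lborel) \<partial>lborel)"
    by (simp add: power2_commute[of "f _" "f _"] mult_ac)
  also have "\<dots> = oscillation C A f"
    by (simp add: oscillation_def nn_integral_multc)
  finally show ?thesis .
qed

lemma osc_bounded_sym:
  "osc_bounded D A C \<Longrightarrow> A \<in> sets borel \<Longrightarrow> C \<in> sets borel \<Longrightarrow> osc_bounded D C A"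
  unfolding osc_bounded_def by (metis oscillation_sym weak_pair_def)

text \<open>Substituting y = x + h and exchanging the integrals reduces the oscillation to the
  translation estimate for each \<open>h\<close>. Only |h| < 2 r contributes, because the set lies
  in a ball of radius r; this gives the constant (2 r)^2 times the volume of the ball of radius 2
  r.\<close>

lemma osc_bounded_convex:
  fixes D :: "(real^'n) set"
  assumes D: "open D" "bounded D" and A: "open A" "convex A" "A \<subseteq> D"
  shows "osc_bounded D A A"
proof -
  obtain r where r: "D \<subseteq> ball 0 r" "r > 0"
    using bounded_subset_ballD[OF D(2)] by blast
  let ?R = "2 * r"
  define K where "K = ?R\<^sup>2 * measure lborel (ball (0 :: real^'n) ?R)"
  have Am[measurable]: "A \<in> sets borel" using A(1) by simp
  have "oscillation A A f \<le> ennreal (K * L2_inner D g g)" if fg: "weak_pair D f g" for f g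
  proof -
    have f[measurable]: "f \<in> borel_measurable borel" using fg by (simp add: weak_pair_def)
    define N where "N = L2_inner D g g"
    have N: "N \<ge> 0" by (simp add: N_def L2_inner_self_nonneg)
    define w :: "real^'n \<Rightarrow> real^'n \<Rightarrow> ennreal" where
      "w x h = ennreal ((f x - f (x + h))\<^sup>2) * indicator A (x + h) * indicator A x" for x h
    have [measurable]: "(\<lambda>(x, h). w x h) \<in> borel_measurable (lborel \<Otimes>\<^sub>M lborel)"
      unfolding w_def by measurable
    have "(\<integral>\<^sup>+y. ennreal ((f x - f y)\<^sup>2) * indicator A y \<partial>lborel) * indicator A x =
        (\<integral>\<^sup>+h. w x h \<partial>lborel)" for x
    proof -
      have "(\<integral>\<^sup>+y. ennreal ((f x - f y)\<^sup>2) * indicator A y \<partial>lborel) =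
          (\<integral>\<^sup>+y. ennreal ((f x - f y)\<^sup>2) * indicator A y \<partial>distr lborel borel ((+) x))"
        by (simp add: lborel_distr_plus)
      also have "\<dots> = (\<integral>\<^sup>+h. ennreal ((f x - f (x + h))\<^sup>2) * indicator A (x + h) \<partial>lborel)"
        by (rule nn_integral_distr) auto
      finally show ?thesis by (simp add: w_def nn_integral_multc)
    qed
    then have "oscillation A A f = (\<integral>\<^sup>+x. (\<integral>\<^sup>+h. w x h \<partial>lborel) \<partial>lborel)"
      by (simp add: oscillation_def)
    also have "\<dots> = (\<integral>\<^sup>+h. (\<integral>\<^sup>+x. w x h \<partial>lborel) \<partial>lborel)"
      by (rule lborel_pair.Fubini') measurable
    also have "\<dots> \<le> (\<integral>\<^sup>+h. ennreal (?R\<^sup>2 * N) * indicator (ball (0 :: real^'n) ?R) h \<partial>lborel)"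
    proof (rule nn_integral_mono)
      fix h :: "real^'n"
      show "(\<integral>\<^sup>+x. w x h \<partial>lborel) \<le> ennreal (?R\<^sup>2 * N) * indicator (ball 0 ?R) h"
      proof (cases "h \<in> ball 0 ?R")
        case False
        have "w x h = 0" for x
        proof -
          have "\<not> (x \<in> A \<and> x + h \<in> A)"
          proof
            assume "x \<in> A \<and> x + h \<in> A"
            then have "norm x < r" "norm (x + h) < r" using A(3) r(1) by auto
            then have "norm h < ?R" using norm_triangle_ineq4[of "x + h" x] by simp
            then show False using False by simp
          qed
          then show ?thesis by (auto simp: w_def indicator_def)
        qed
        then show ?thesis by simp
      next
        case True
        let ?Ah = "A \<inter> {x. x + h \<in> A}"
        note T = weak_pair_translation_estimate[OF D fg A, of h]
        have [measurable]: "?Ah \<in> sets borel" by measurable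
        have "(\<integral>\<^sup>+x. w x h \<partial>lborel) = (\<integral>\<^sup>+x. ennreal ((indicator ?Ah x * (f (x + h) - f x))\<^sup>2) \<partial>lborel)"
          by (intro nn_integral_cong) (auto simp: w_def indicator_def power2_commute)
        also have "\<dots> = ennreal (\<integral>x. (indicator ?Ah x * (f (x + h) - f x))\<^sup>2 \<partial>lborel)"
          using T(1) by (intro nn_integral_eq_integral) (simp_all add: integrable_completion)
        also have "\<dots> \<le> ennreal ((norm h)\<^sup>2 * N)"
          using T(2) by (intro ennreal_leI) (simp add: integral_completion N_def)
        also have "\<dots> \<le> ennreal (?R\<^sup>2 * N)"
          using True N by (intro ennreal_leI mult_right_mono power_mono) auto
        finally show ?thesis using True by simp
      qed
    qed
    also have "\<dots> = ennreal (?R\<^sup>2 * N) * emeasure lborel (ball (0 :: real^'n) ?R)"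
      by (rule nn_integral_cmult_indicator) simp
    also have "\<dots> = ennreal (K * N)"
      using emeasure_lborel_ball_finite[of "0 :: real^'n" ?R] N
      by (subst emeasure_eq_ennreal_measure) (auto simp: K_def ennreal_mult[symmetric] mult_ac)
    finally show ?thesis by (simp add: N_def)
  qed
  then show ?thesis unfolding osc_bounded_def by (intro exI[of _ K]) (auto simp: K_def)
qed

text \<open>Comparison through a third point: (f x - f y)^2 \<le> 2 (f x - f z)^2 + 2 (f y - f z)^2,
  integrated over z in \<open>E\<close>. Positive measure of \<open>E\<close> is what allows the
  division afterwards.\<close>

lemma osc_bounded_trans:
  assumes AE: "osc_bounded D A E" and CE: "osc_bounded D C E"
    and [measurable]: "A \<in> sets borel" "C \<in> sets borel" "E \<in> sets borel"
    and bdd: "bounded A" "bounded C" "bounded E" and pos: "emeasure lborel E \<noteq> 0"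
  shows "osc_bounded D A C"
proof -
  define a c e where "a = measure lborel A" and "c = measure lborel C" and "e = measure lborel E"
  have fin: "emeasure lborel A = ennreal a" "emeasure lborel C = ennreal c" "emeasure lborel E = ennreal e"
    using emeasure_bounded_finite[OF bdd(1)] emeasure_bounded_finite[OF bdd(2)] emeasure_bounded_finite[OF bdd(3)]
    by (auto simp: a_def c_def e_def intro!: emeasure_eq_ennreal_measure)
  have e: "e > 0" using pos fin(3) by (metis e_def ennreal_0 less_eq_real_def measure_nonneg)
  have ac: "a \<ge> 0" "c \<ge> 0" by (simp_all add: a_def c_def)
  obtain K where K: "K \<ge> 0" "\<And>f g. weak_pair D f g \<Longrightarrow> oscillation A E f \<le> ennreal (K * L2_inner D g g)"
    using AE unfolding osc_bounded_def by blast
  obtain L where L: "L \<ge> 0" "\<And>f g. weak_pair D f g \<Longrightarrow> oscillation C E f \<le> ennreal (L * L2_inner D g g)"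
    using CE unfolding osc_bounded_def by blast
  \<comment> \<open>Integration over A and C multiplies the term in x by the measure of C and the
    term in y by that of A; the denominator comes from averaging over E.\<close>
  define J where "J = (2 * c * K + 2 * a * L) / e"
  have J: "J \<ge> 0" using e ac K L by (simp add: J_def)
  have "oscillation A C f \<le> ennreal (J * L2_inner D g g)" if fg: "weak_pair D f g" for f g
  proof -
    have f[measurable]: "f \<in> borel_measurable borel" using fg by (simp add: weak_pair_def)
    define p where "p x = (\<integral>\<^sup>+z. ennreal ((f x - f z)\<^sup>2) * indicator E z \<partial>lborel)" for x
    have [measurable]: "p \<in> borel_measurable borel" unfolding p_def[abs_def] by measurable
    have pw: "ennreal e * ennreal ((f x - f y)\<^sup>2) \<le> 2 * p x + 2 * p y" for x y
    proof -
      have "ennreal e * ennreal ((f x - f y)\<^sup>2) = (\<integral>\<^sup>+z. ennreal ((f x - f y)\<^sup>2) * indicator E z \<partial>lborel)"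
        by (subst nn_integral_cmult_indicator) (simp_all add: fin mult.commute)
      also have "\<dots> \<le> (\<integral>\<^sup>+z. 2 * (ennreal ((f x - f z)\<^sup>2) * indicator E z)
          + 2 * (ennreal ((f y - f z)\<^sup>2) * indicator E z) \<partial>lborel)"
      proof (rule nn_integral_mono)
        fix z
        have "(f x - f y)\<^sup>2 \<le> 2 * (f x - f z)\<^sup>2 + 2 * (f y - f z)\<^sup>2"
          using zero_le_power2[of "(f x - f z) + (f y - f z)"] by (simp add: power2_eq_square algebra_simps)
        then have "ennreal ((f x - f y)\<^sup>2) \<le> ennreal (2 * (f x - f z)\<^sup>2 + 2 * (f y - f z)\<^sup>2)"
          by (rule ennreal_leI)
        also have "\<dots> = 2 * ennreal ((f x - f z)\<^sup>2) + 2 * ennreal ((f y - f z)\<^sup>2)"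
          by (simp add: ennreal_plus ennreal_mult)
        finally show "ennreal ((f x - f y)\<^sup>2) * indicator E z \<le>
            2 * (ennreal ((f x - f z)\<^sup>2) * indicator E z) + 2 * (ennreal ((f y - f z)\<^sup>2) * indicator E z)"
          by (cases "z \<in> E") auto
      qed
      also have "\<dots> = 2 * p x + 2 * p y"
        by (simp add: p_def nn_integral_add nn_integral_cmult)
      finally show ?thesis .
    qed
    have "ennreal e * oscillation A C f =
        (\<integral>\<^sup>+x. (\<integral>\<^sup>+y. (ennreal e * ennreal ((f x - f y)\<^sup>2)) * indicator C y \<partial>lborel) * indicator A x \<partial>lborel)"
      by (simp add: oscillation_def nn_integral_cmult mult.assoc)
    also have "\<dots> \<le>
        (\<integral>\<^sup>+x. (\<integral>\<^sup>+y. (2 * p x + 2 * p y) * indicator C y \<partial>lborel) * indicator A x \<partial>lborel)"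
      by (intro nn_integral_mono mult_right_mono pw) auto
    also have "\<dots> =
        (\<integral>\<^sup>+x. (2 * p x * ennreal c + 2 * (\<integral>\<^sup>+y. p y * indicator C y \<partial>lborel)) * indicator A x \<partial>lborel)"
      by (simp add: distrib_right nn_integral_add nn_integral_cmult fin mult.assoc)
    also have "\<dots> = 2 * ennreal c * (\<integral>\<^sup>+x. p x * indicator A x \<partial>lborel)
        + 2 * (\<integral>\<^sup>+y. p y * indicator C y \<partial>lborel) * ennreal a"
    proof -
      have "(2 * p x * ennreal c + 2 * (\<integral>\<^sup>+y. p y * indicator C y \<partial>lborel)) * indicator A x =
          (2 * ennreal c) * (p x * indicator A x) + (2 * (\<integral>\<^sup>+y. p y * indicator C y \<partial>lborel)) * indicator A x" for x
        by (simp add: algebra_simps)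
      then show ?thesis
        by (simp add: nn_integral_add nn_integral_cmult fin)
    qed
    also have "\<dots> = 2 * ennreal c * oscillation A E f + 2 * oscillation C E f * ennreal a"
      by (simp add: oscillation_def p_def)
    also have "\<dots> \<le> 2 * ennreal c * ennreal (K * L2_inner D g g) + 2 * ennreal (L * L2_inner D g g) * ennreal a"
      by (intro add_mono mult_left_mono mult_right_mono K L fg) auto
    also have "\<dots> = ennreal e * ennreal (J * L2_inner D g g)"
    proof -
      have "2 * ennreal c * ennreal (K * L2_inner D g g) = ennreal (2 * c * (K * L2_inner D g g))"
        "2 * ennreal (L * L2_inner D g g) * ennreal a = ennreal (2 * (L * L2_inner D g g) * a)"
        using ac K L by (simp_all add: ennreal_mult L2_inner_self_nonneg)
      moreover have "2 * c * (K * L2_inner D g g) + 2 * (L * L2_inner D g g) * a = e * (J * L2_inner D g g)"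
        using e by (simp add: J_def field_simps)
      ultimately show ?thesis
        using ac K L e J
        by (simp add: ennreal_plus[symmetric] ennreal_mult[symmetric] L2_inner_self_nonneg del: ennreal_plus)
    qed
    finally have "ennreal e * oscillation A C f \<le> ennreal e * ennreal (J * L2_inner D g g)" .
    then show ?thesis
      using e by (simp add: ennreal_mult_le_mult_iff)
  qed
  then show ?thesis unfolding osc_bounded_def using J by blast
qed

text \<open>At a boundary point the domain is a strict epigraph, so points just below belong to an
  open set that the domain misses. Hence no boundary point is interior to the closure. This places
  the interiors of the covering polytopes inside the domain.\<close>

lemma interior_closure_lipschitz_domain:
  fixes D :: "(real^'n) set"
  assumes D: "open D" "lipschitz_boundary D"
  shows "interior (closure D) \<subseteq> D"
proof (rule ccontr)
  assume "\<not> interior (closure D) \<subseteq> D"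
  then obtain x where x: "x \<in> interior (closure D)" "x \<notin> D" by blast
  then have "x \<in> frontier D"
    using interior_subset[of "closure D"] interior_open[OF D(1)] by (auto simp: frontier_def)
  then obtain e r L g where e: "norm e = 1" "0 < r" "L-lipschitz_on UNIV g"
    and loc: "\<forall>y \<in> ball x r. y \<in> D \<longleftrightarrow> g (y - (y \<bullet> e) *\<^sub>R e) < y \<bullet> e"
    using D(2) unfolding lipschitz_boundary_def by metis
  have cg: "continuous_on UNIV g" using e(3) by (rule lipschitz_on_continuous_on)
  \<comment> \<open>The strict hypograph is open and disjoint from D, hence also from the closure of
    D.\<close>
  define W where "W = ball x r \<inter> {y. y \<bullet> e < g (y - (y \<bullet> e) *\<^sub>R e)}"
  have "continuous_on UNIV (\<lambda>y. g (y - (y \<bullet> e) *\<^sub>R e))"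
    by (rule continuous_on_compose2[OF cg]) (auto intro!: continuous_intros)
  then have "open W"
    unfolding W_def by (intro open_Int open_Collect_less) (auto intro!: continuous_intros)
  moreover have "W \<inter> D = {}" using loc by (auto simp: W_def)
  ultimately have WD: "W \<inter> closure D = {}" by (simp add: open_Int_closure_eq_empty)
  obtain d where d: "d > 0" "ball x d \<subseteq> closure D"
    using x(1) by (auto simp: mem_interior)
  define t where "t = min d r / 2"
  have t: "t > 0" "t < d" "t < r" using d(1) e(2) by (auto simp: t_def)
  define y where "y = x - t *\<^sub>R e"
  have "dist x y = t" using t e(1) by (simp add: y_def dist_norm)
  then have y: "y \<in> ball x r" "y \<in> closure D" using t d(2) by auto
  have ee: "e \<bullet> e = 1" using e(1) by (simp add: power2_norm_eq_inner[symmetric])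
  have ye: "y \<bullet> e = x \<bullet> e - t" by (simp add: y_def inner_diff_left ee)
  \<comment> \<open>Moving along \<open>e\<close> keeps the orthogonal coordinates, so
    \<open>g\<close> takes the same value while the height drops by \<open>t\<close>.\<close>
  have "y - (y \<bullet> e) *\<^sub>R e = x - (x \<bullet> e) *\<^sub>R e"
    unfolding ye by (simp add: y_def algebra_simps)
  moreover have "x \<bullet> e \<le> g (x - (x \<bullet> e) *\<^sub>R e)"
    using loc x(2) e(2) by (auto simp: not_less)
  ultimately have "y \<in> W" using y(1) t(1) ye by (simp add: W_def)
  then show False using WD y(2) by blast
qed

lemma emeasure_lborel_open_nonzero:
  fixes S :: "'a::euclidean_space set"
  assumes "open S" "S \<noteq> {}"
  shows "emeasure lborel S \<noteq> 0"
proof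
  assume "emeasure lborel S = 0"
  then have "S \<in> null_sets lborel" using assms(1) by auto
  then have "negligible S"
    unfolding negligible_iff_null_sets by (rule null_sets_completionI)
  then show False using open_not_negligible[OF assms] by blast
qed

lemma measure_open_pos:
  fixes D :: "'a::euclidean_space set"
  assumes "open D" "bounded D" "D \<noteq> {}"
  shows "measure lebesgue D > 0"
proof -
  have "emeasure lebesgue D = ennreal (measure lebesgue D)"
    using assms lmeasurable_open by (intro emeasure_eq_measure2) auto
  then have "measure lebesgue D \<noteq> 0"
    using emeasure_lborel_open_nonzero[OF assms(1,3)] assms(1) by auto
  then show ?thesis by (simp add: less_le)
qed

lemma oscillation_Un:
  assumes [measurable]: "f \<in> borel_measurable borel" "A \<in> sets borel" "C \<in> sets borel" "C' \<in> sets borel"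
  shows "oscillation A (C \<union> C') f \<le> oscillation A C f + oscillation A C' f"
proof -
  have "oscillation A (C \<union> C') f \<le>
      (\<integral>\<^sup>+x. (\<integral>\<^sup>+y. ennreal ((f x - f y)\<^sup>2) * indicator C y + ennreal ((f x - f y)\<^sup>2) * indicator C' y \<partial>lborel)
        * indicator A x \<partial>lborel)"
    unfolding oscillation_def
    by (intro nn_integral_mono mult_right_mono) (auto simp: indicator_def)
  also have "\<dots> = oscillation A C f + oscillation A C' f"
    by (simp add: oscillation_def nn_integral_add distrib_right)
  finally show ?thesis .
qed

lemma osc_bounded_Union:
  assumes "finite F" "A \<in> sets borel" "\<And>C. C \<in> F \<Longrightarrow> C \<in> sets borel \<and> osc_bounded D A C"
  shows "osc_bounded D A (\<Union>F)"
  using assms(1,3)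
proof (induction F rule: finite_induct)
  case empty
  then show ?case
    by (auto simp: osc_bounded_def oscillation_def intro!: exI[of _ 0])
next
  case (insert C F)
  have m: "C \<in> sets borel" "\<Union>F \<in> sets borel" using insert by auto
  obtain K where K: "K \<ge> 0" "\<And>f g. weak_pair D f g \<Longrightarrow> oscillation A C f \<le> ennreal (K * L2_inner D g g)"
    using insert.prems[of C] unfolding osc_bounded_def by blast
  obtain L where L: "L \<ge> 0" "\<And>f g. weak_pair D f g \<Longrightarrow> oscillation A (\<Union>F) f \<le> ennreal (L * L2_inner D g g)"
    using insert unfolding osc_bounded_def by blast
  have "oscillation A (\<Union>(insert C F)) f \<le> ennreal ((K + L) * L2_inner D g g)" if fg: "weak_pair D f g" for f g
  proof -
    have "oscillation A (C \<union> \<Union>F) f \<le> oscillation A C f + oscillation A (\<Union>F) f"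
      using fg assms(2) m by (intro oscillation_Un) (auto simp: weak_pair_def)
    also have "\<dots> \<le> ennreal (K * L2_inner D g g) + ennreal (L * L2_inner D g g)"
      by (intro add_mono K L fg)
    also have "\<dots> = ennreal ((K + L) * L2_inner D g g)"
      using K(1) L(1) by (simp add: distrib_right L2_inner_self_nonneg)
    finally show ?thesis by simp
  qed
  then show ?case unfolding osc_bounded_def using K(1) L(1) by (intro exI[of _ "K + L"]) auto
qed

text \<open>All sets are compared with one fixed ball \<open>?B\<close>. Connectedness carries the
  bound to a small ball at every point, and each polytope interior is reached through such a ball.
  Symmetry and a last passage through \<open>?B\<close> put the domain into both arguments.\<close>

lemma osc_bounded_domain:
  fixes D :: "(real^'n) set"
  assumes "lipschitz_polytopal_domain D"
  shows "osc_bounded D D D"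
proof -
  have D: "open D" "connected D" "D \<noteq> {}" "bounded D" "lipschitz_boundary D"
    using assms by (auto simp: lipschitz_polytopal_domain_def)
  obtain P where P: "finite P" "\<And>p. p \<in> P \<Longrightarrow> polytope p" "closure D = \<Union>P"
    using assms by (auto simp: lipschitz_polytopal_domain_def)
  obtain z0 where z0: "z0 \<in> D" using D by blast
  obtain r0 where r0: "r0 > 0" "ball z0 r0 \<subseteq> D" using D(1) z0 by (auto simp: open_contains_ball)
  let ?B = "ball z0 r0"
  have bdd: "bounded S" if "S \<subseteq> D" for S using that D(4) bounded_subset by blast
  \<comment> \<open>If an open convex \<open>A\<close> contains the centre of a ball already
    reached, the overlap is a nonempty open set, through which the bound passes to the subsets of
    \<open>A\<close>.\<close>
  have step: "osc_bounded D ?B C"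
    if x: "osc_bounded D ?B (ball x s)" "s > 0" "x \<in> A" and A: "open A" "convex A" "A \<subseteq> D"
      and C: "C \<subseteq> A" "C \<in> sets borel" for x s A C
  proof -
    let ?W = "ball x s \<inter> A"
    have "osc_bounded D ?B ?W" by (rule osc_bounded_mono[OF x(1)]) auto
    moreover have "osc_bounded D C ?W"
      by (rule osc_bounded_mono[OF osc_bounded_convex[OF D(1,4) A]]) (use C in auto)
    moreover have "emeasure lborel ?W \<noteq> 0"
    proof (rule emeasure_lborel_open_nonzero)
      have "x \<in> ?W" using x by simp
      then show "?W \<noteq> {}" by blast
    qed (use A in auto)
    moreover have "?W \<in> sets borel" "?B \<in> sets borel" using A by auto
    moreover have "bounded ?W" "bounded C" using A C by (auto intro!: bdd)
    ultimately show ?thesis using C(2) by (intro osc_bounded_trans[of D ?B ?W C]) auto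
  qed
  have ball: "\<exists>s>0. osc_bounded D ?B (ball x s)" if "x \<in> D" for x
  proof (rule connected_induction_simple[OF D(2) z0 that, where P = "\<lambda>x. \<exists>s>0. osc_bounded D ?B (ball x s)"])
    show "\<exists>s>0. osc_bounded D ?B (ball z0 s)"
      using osc_bounded_convex[OF D(1,4), of ?B] r0 by auto
    fix a assume "a \<in> D"
    then obtain r where r: "r > 0" "ball a r \<subseteq> D" using D(1) by (auto simp: open_contains_ball)
    \<comment> \<open>The ball around \<open>a\<close> is convex and lies in D, so it serves as the
      set \<open>A\<close> of \<open>step\<close> for any two of its points.\<close>
    have "\<exists>t>0. osc_bounded D ?B (ball y t)"
      if x: "x \<in> ball a r" and y: "y \<in> ball a r" and s: "s > 0" "osc_bounded D ?B (ball x s)" for x y s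
    proof -
      obtain t where t: "t > 0" "ball y t \<subseteq> ball a r"
        using y open_contains_ball[of "ball a r"] open_ball by blast
      show ?thesis using step[OF s(2,1) x _ _ r(2) t(2)] t(1) by auto
    qed
    then show "\<exists>T. openin (top_of_set D) T \<and> a \<in> T \<and>
        (\<forall>x\<in>T. \<forall>y\<in>T. (\<exists>s>0. osc_bounded D ?B (ball x s)) \<longrightarrow> (\<exists>s>0. osc_bounded D ?B (ball y s)))"
      using r by (intro exI[of _ "ball a r"]) (auto simp: openin_open_eq[OF D(1)])
  qed
  have piece: "osc_bounded D ?B (interior p)" if p: "p \<in> P" for p
  proof (cases "interior p = {}")
    case True
    then show ?thesis using osc_bounded_Union[of "{}" ?B D] by simp
  next
    case False
    \<comment> \<open>A polytope is only known to lie in the closure; the one-sided boundary turns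
      this into an inclusion of its interior in D.\<close>
    have "interior p \<subseteq> interior (closure D)" using p P(3) by (intro interior_mono) auto
    then have pD: "interior p \<subseteq> D" using interior_closure_lipschitz_domain[OF D(1,5)] by blast
    obtain x where x: "x \<in> interior p" using False by blast
    then obtain s where "s > 0" "osc_bounded D ?B (ball x s)" using ball pD by blast
    then show ?thesis
      using step[OF _ _ x _ _ pD, of s "interior p"] P(2)[OF p] polytope_imp_convex convex_interior by auto
  qed
  let ?U = "\<Union>(interior ` P)"
  have U: "osc_bounded D ?B ?U"
    by (rule osc_bounded_Union) (use P(1) piece in auto)
  \<comment> \<open>Frontiers of convex sets are null sets, so the interiors of the finitely many
    polytopes exhaust D as far as integrals are concerned.\<close>
  have "negligible (\<Union>(frontier ` P))"
    using P(1,2) polytope_imp_convex negligible_convex_frontier by (intro negligible_Union) auto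
  moreover have "\<Union>(frontier ` P) \<in> sets lborel" using P(1) by (auto intro!: sets.finite_Union)
  ultimately have "\<Union>(frontier ` P) \<in> null_sets lborel"
    by (simp add: negligible_iff_null_sets null_sets_completion_iff)
  then have fr: "AE y in lborel. y \<notin> \<Union>(frontier ` P)" by (rule AE_not_in)
  have inU: "y \<in> ?U" if "y \<in> D" "y \<notin> \<Union>(frontier ` P)" for y
  proof -
    have "y \<in> closure D" using that(1) closure_subset by blast
    then obtain p where "p \<in> P" "y \<in> p" using P(3) by blast
    then show ?thesis using that(2) closure_subset[of p] by (auto simp: frontier_def)
  qed
  from fr have AE: "AE y in lborel. y \<in> D \<longrightarrow> y \<in> ?U"
    by (rule eventually_mono) (use inU in blast)
  have "oscillation ?B D f \<le> oscillation ?B ?U f" for f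
    unfolding oscillation_def
  proof (rule nn_integral_mono, rule mult_right_mono, rule nn_integral_mono_AE)
    fix x :: "real^'n"
    show "AE y in lborel. ennreal ((f x - f y)\<^sup>2) * indicator D y \<le> ennreal ((f x - f y)\<^sup>2) * indicator ?U y"
      using AE by eventually_elim (auto simp: indicator_def)
  qed auto
  then have "osc_bounded D ?B D" using U unfolding osc_bounded_def by (meson order_trans)
  then have "osc_bounded D D ?B" by (rule osc_bounded_sym) (use D in auto)
  then show ?thesis
    using emeasure_lborel_open_nonzero[of ?B] D r0(1)
    by (intro osc_bounded_trans[of D D ?B D]) auto
qed

text \<open>Expansion of the square; the result is 2 |D|^2 times the variance of \<open>f\<close>.
  It turns a bound for the oscillation into Poincare's inequality.\<close>

lemma oscillation_eq:
  fixes D :: "(real^'n) set"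
  assumes D: "open D" "bounded D" and fg: "weak_pair D f g"
  shows "oscillation D D f = ennreal (2 * (measure lebesgue D * L2_inner D f f - (\<integral>x. f x \<partial>lebesgue_on D)\<^sup>2))"
proof -
  have Dm: "D \<in> sets lebesgue" "D \<in> lmeasurable" "D \<in> sets borel" using D lmeasurable_open by auto
  define F where "F x = indicator D x * f x" for x
  define d S I where "d = measure lebesgue D" and "S = (\<integral>x. (F x)\<^sup>2 \<partial>lborel)" and "I = (\<integral>x. F x \<partial>lborel)"
  have f: "f \<in> borel_measurable borel" "f \<in> L2_space D" using fg by (auto simp: weak_pair_def)
  have Fb[measurable]: "F \<in> borel_measurable borel" unfolding F_def[abs_def] using f(1) D(1) by simp
  have Fl: "F \<in> borel_measurable lebesgue" using Fb by (intro measurable_completion) simp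
  have F2: "integrable lebesgue (\<lambda>x. (F x)\<^sup>2)"
    unfolding F_def by (rule L2_space_extend(2)[OF Dm(1) f(2)])
  have F1: "integrable lebesgue F"
    by (rule square_integrable_imp_integrable_on[OF Dm(2) Fl F2]) (simp add: F_def)
  have i1: "integrable lborel F" and i2: "integrable lborel (\<lambda>x. (F x)\<^sup>2)"
    using F1 F2 by (simp_all add: integrable_completion)
  have id: "integrable lborel (indicat_real D)" "(\<integral>x. indicat_real D x \<partial>lborel) = d"
    using Dm by (simp_all add: lmeasurable_iff_integrable integrable_completion d_def)
  have S: "S = L2_inner D f f"
  proof -
    have "indicator D x * (f x \<bullet> f x) = (F x)\<^sup>2" for x by (simp add: F_def indicator_def power2_eq_square)
    then show ?thesis by (simp add: L2_inner_lebesgue[OF Dm(1)] S_def integral_completion)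
  qed
  have I: "I = (\<integral>x. f x \<partial>lebesgue_on D)"
    using Dm(1) Fb by (subst integral_restrict_space) (auto simp: I_def F_def[abs_def] integral_completion)
  have inner: "(\<integral>\<^sup>+y. ennreal ((f x - f y)\<^sup>2) * indicator D y \<partial>lborel) = ennreal ((f x)\<^sup>2 * d - 2 * f x * I + S)"
    "0 \<le> (f x)\<^sup>2 * d - 2 * f x * I + S" for x
  proof -
    let ?h = "\<lambda>y. (f x)\<^sup>2 * indicator D y - 2 * f x * F y + (F y)\<^sup>2"
    have h: "?h y = (f x - f y)\<^sup>2 * indicator D y" for y
      by (simp add: F_def indicator_def power2_eq_square algebra_simps)
    have hi: "integrable lborel ?h" using i1 i2 id by simp
    have hv: "(\<integral>y. ?h y \<partial>lborel) = (f x)\<^sup>2 * d - 2 * f x * I + S"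
      using i1 i2 id by (simp add: S_def I_def)
    have pos: "0 \<le> ?h y" for y unfolding h by simp
    show "0 \<le> (f x)\<^sup>2 * d - 2 * f x * I + S"
      unfolding hv[symmetric] by (rule Bochner_Integration.integral_nonneg[OF pos])
    have "(\<integral>\<^sup>+y. ennreal ((f x - f y)\<^sup>2) * indicator D y \<partial>lborel) = (\<integral>\<^sup>+y. ennreal (?h y) \<partial>lborel)"
      unfolding h by (simp add: ennreal_mult ennreal_indicator)
    also have "\<dots> = ennreal (\<integral>y. ?h y \<partial>lborel)"
      by (rule nn_integral_eq_integral[OF hi]) (use pos in auto)
    finally show "(\<integral>\<^sup>+y. ennreal ((f x - f y)\<^sup>2) * indicator D y \<partial>lborel) = ennreal ((f x)\<^sup>2 * d - 2 * f x * I + S)"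
      by (simp add: hv)
  qed
  let ?k = "\<lambda>x. d * (F x)\<^sup>2 - 2 * I * F x + S * indicator D x"
  have k: "?k x = ((f x)\<^sup>2 * d - 2 * f x * I + S) * indicator D x" for x
    by (simp add: F_def indicator_def)
  have "oscillation D D f = (\<integral>\<^sup>+x. ennreal (?k x) \<partial>lborel)"
    unfolding oscillation_def inner(1) k using inner(2) by (simp add: ennreal_mult ennreal_indicator)
  also have "\<dots> = ennreal (\<integral>x. ?k x \<partial>lborel)"
  proof (rule nn_integral_eq_integral)
    show "integrable lborel ?k" using i1 i2 id by simp
    show "AE x in lborel. 0 \<le> ?k x" unfolding k using inner(2) by simp
  qed
  also have "(\<integral>x. ?k x \<partial>lborel) = d * S - 2 * I * I + S * d"
    using i1 i2 id by (simp add: S_def I_def)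
  also have "\<dots> = 2 * (d * S - I\<^sup>2)" by (simp add: power2_eq_square)
  finally show ?thesis by (simp add: d_def S I)
qed

lemma poincare_scalar:
  fixes D :: "(real^'n) set"
  assumes D: "lipschitz_polytopal_domain D"
  shows "\<exists>C\<ge>0. \<forall>f g. weak_pair D f g \<longrightarrow>
    L2_inner D f f \<le> C * (L2_inner D g g + (\<integral>x. f x \<partial>lebesgue_on D)\<^sup>2)"
proof -
  have D': "open D" "D \<noteq> {}" "bounded D"
    using D by (auto simp: lipschitz_polytopal_domain_def)
  define d where "d = measure lebesgue D"
  have d: "d > 0" unfolding d_def by (rule measure_open_pos[OF D'(1,3,2)])
  obtain K where K: "K \<ge> 0" "\<And>f g. weak_pair D f g \<Longrightarrow> oscillation D D f \<le> ennreal (K * L2_inner D g g)"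
    using osc_bounded_domain[OF D] unfolding osc_bounded_def by blast
  \<comment> \<open>Solving the oscillation bound for the norm of \<open>f\<close> leaves K / (2 d)
    in front of the gradient and 1 / d in front of the squared integral.\<close>
  define C where "C = max (K / (2 * d)) (1 / d)"
  have "L2_inner D f f \<le> C * (L2_inner D g g + (\<integral>x. f x \<partial>lebesgue_on D)\<^sup>2)" if fg: "weak_pair D f g" for f g
  proof -
    define I N where "I = (\<integral>x. f x \<partial>lebesgue_on D)" and "N = L2_inner D g g"
    have N: "N \<ge> 0" by (simp add: N_def L2_inner_self_nonneg)
    have "ennreal (2 * (d * L2_inner D f f - I\<^sup>2)) \<le> ennreal (K * N)"
      using K(2)[OF fg] by (simp add: oscillation_eq[OF D'(1,3) fg] d_def I_def N_def)
    then have "2 * (d * L2_inner D f f - I\<^sup>2) \<le> K * N"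
      using K(1) N by (simp add: ennreal_le_iff)
    then have "L2_inner D f f \<le> K / (2 * d) * N + 1 / d * I\<^sup>2"
      using d by (simp add: field_simps)
    also have "\<dots> \<le> C * N + C * I\<^sup>2"
      using N by (intro add_mono mult_right_mono) (auto simp: C_def)
    finally show ?thesis by (simp add: I_def N_def distrib_left)
  qed
  moreover have "C \<ge> 0" using K(1) d by (simp add: C_def le_max_iff_disj)
  ultimately show ?thesis by blast
qed

lemma L2_inner_componentwise:
  fixes f g :: "real^'n \<Rightarrow> 'b::euclidean_space^'m"
  assumes "f \<in> L2_space D" "g \<in> L2_space D"
  shows "L2_inner D f g = (\<Sum>i\<in>UNIV. L2_inner D (\<lambda>x. f x $ i) (\<lambda>x. g x $ i))"
proof -
  have "integrable (lebesgue_on D) (\<lambda>x. f x $ i \<bullet> g x $ i)" for i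
    by (intro L2_inner_integrable L2_space_vec_nth assms)
  then show ?thesis by (simp add: L2_inner_def inner_vec_def)
qed

text \<open>The integral of \<open>X\<close> stays on the right instead of being subtracted, because
  the inf-sup argument bounds it separately by means of a constant multiplier.\<close>

lemma poincare:
  fixes D :: "(real^'n) set"
  assumes D: "lipschitz_polytopal_domain D"
  shows "\<exists>C\<ge>0. \<forall>X\<in>H1_space D.
    (L2_norm D X)\<^sup>2 \<le> C * ((H1_seminorm D X)\<^sup>2 + (norm (\<integral>x. X x \<partial>lebesgue_on D))\<^sup>2)"
proof -
  have D': "open D" "bounded D" using D by (auto simp: lipschitz_polytopal_domain_def)
  have Dm: "D \<in> sets lebesgue" "D \<in> lmeasurable" using D' lmeasurable_open by auto
  obtain C where C: "C \<ge> 0" "\<And>f g. weak_pair D f g \<Longrightarrow>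
    L2_inner D f f \<le> C * (L2_inner D g g + (\<integral>x. f x \<partial>lebesgue_on D)\<^sup>2)"
    using poincare_scalar[OF D] by blast
  have "(L2_norm D X)\<^sup>2 \<le> C * ((H1_seminorm D X)\<^sup>2 + (norm (\<integral>x. X x \<partial>lebesgue_on D))\<^sup>2)"
    if X: "X \<in> H1_space D" for X
  proof -
    note XD = H1_spaceD[OF X]
    let ?G = "weak_grad D X"
    note Gi = L2_space_vec_nth[OF XD(2)]
    have comp: "L2_inner D (\<lambda>x. X x $ i) (\<lambda>x. X x $ i) \<le>
        C * (L2_inner D (\<lambda>x. ?G x $ i) (\<lambda>x. ?G x $ i) + (\<integral>x. X x $ i \<partial>lebesgue_on D)\<^sup>2)" for i
    proof -
      note Xi = L2_space_vec_nth[OF XD(1), of i]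
      \<comment> \<open>A component is only Lebesgue measurable. A Borel version has the same
        integrals against test functions, hence the same weak gradient.\<close>
      obtain f where f: "f \<in> borel_measurable lborel" "AE x in lborel. indicator D x * X x $ i = f x"
        using completion_ex_borel_measurable_real[OF L2_space_extend(1)[OF Dm(1) Xi]] by blast
      have "AE x in lebesgue. x \<in> D \<longrightarrow> X x $ i = f x"
        using AE_completion[OF f(2)] by eventually_elim auto
      then have AE: "AE x in lebesgue_on D. X x $ i = f x" using Dm by (simp add: AE_restrict_space_iff)
      have fm: "f \<in> borel_measurable (lebesgue_on D)"
        using f(1) by (intro measurable_restrict_space1 measurable_completion)
      have fL: "f \<in> L2_space D"
      proof -
        have "integrable (lebesgue_on D) (\<lambda>x. (f x)\<^sup>2) \<longleftrightarrow> integrable (lebesgue_on D) (\<lambda>x. (X x $ i)\<^sup>2)"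
          by (rule integrable_cong_AE) (use fm L2_spaceD(1)[OF Xi] AE in auto)
        then show ?thesis using fm L2_spaceD(2)[OF Xi] by (simp add: L2_space_def)
      qed
      have eq: "(\<integral>x. X x $ i * \<phi> x \<partial>lebesgue_on D) = (\<integral>x. f x * \<phi> x \<partial>lebesgue_on D)"
        if "\<phi> \<in> test_functions D" for \<phi>
        using L2_inner_cong_AE[OF Xi fL test_functions_L2_space[OF Dm(1) that]
            test_functions_L2_space[OF Dm(1) that] AE] by (simp add: L2_inner_def)
      have "weak_pair D f (\<lambda>x. ?G x $ i)"
        unfolding weak_pair_def
      proof (intro conjI ballI allI fL Gi)
        show "f \<in> borel_measurable borel" using f(1) by simp
        fix \<phi> j assume \<phi>: "\<phi> \<in> test_functions D"
        show "(\<integral>x. f x * partial_deriv j \<phi> x \<partial>lebesgue_on D) = - (\<integral>x. ?G x $ i $ j * \<phi> x \<partial>lebesgue_on D)"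
          using XD(3) \<phi> eq[OF test_functions_partial_deriv[OF \<phi>], of j]
          by (simp add: has_weak_gradient_def)
      qed
      from C(2)[OF this] show ?thesis
        using L2_inner_cong_AE[OF Xi fL Xi fL AE AE]
          integral_cong_AE[OF L2_spaceD(1)[OF Xi] fm AE] by simp
    qed
    note Xint = L2_space_integrable[OF D'(2) Dm(1) XD(1)]
    have nth: "(\<integral>x. X x $ i \<partial>lebesgue_on D) = (\<integral>x. X x \<partial>lebesgue_on D) $ i" for i
      by (rule integral_bounded_linear[OF bounded_linear_vec_nth Xint])
    have "(L2_norm D X)\<^sup>2 = (\<Sum>i\<in>UNIV. L2_inner D (\<lambda>x. X x $ i) (\<lambda>x. X x $ i))"
      by (simp add: L2_norm_power2 L2_inner_componentwise[OF XD(1) XD(1)])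
    also have "\<dots> \<le> (\<Sum>i\<in>UNIV. C * (L2_inner D (\<lambda>x. ?G x $ i) (\<lambda>x. ?G x $ i) + (\<integral>x. X x $ i \<partial>lebesgue_on D)\<^sup>2))"
      by (rule sum_mono[OF comp])
    also have "\<dots> = C * ((\<Sum>i\<in>UNIV. L2_inner D (\<lambda>x. ?G x $ i) (\<lambda>x. ?G x $ i)) +
        (\<Sum>i\<in>UNIV. ((\<integral>x. X x \<partial>lebesgue_on D) $ i)\<^sup>2))"
      by (simp add: nth sum_distrib_left[symmetric] sum.distrib)
    also have "\<dots> = C * ((H1_seminorm D X)\<^sup>2 + (norm (\<integral>x. X x \<partial>lebesgue_on D))\<^sup>2)"
    proof -
      have "(H1_seminorm D X)\<^sup>2 = (\<Sum>i\<in>UNIV. L2_inner D (\<lambda>x. ?G x $ i) (\<lambda>x. ?G x $ i))"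
        by (simp add: H1_seminorm_def L2_norm_power2 L2_inner_componentwise[OF XD(2) XD(2)])
      moreover have "(norm v)\<^sup>2 = (\<Sum>i\<in>UNIV. (v $ i)\<^sup>2)" for v :: "real^'n"
        unfolding power2_norm_eq_inner by (simp add: inner_vec_def power2_eq_square)
      ultimately show ?thesis by simp
    qed
    finally show ?thesis .
  qed
  with C(1) show ?thesis by blast
qed

section \<open>Composition with a map with Lipschitz inverse\<close>

lemma L2_space_bounded:
  fixes f :: "real^'n \<Rightarrow> 'b::euclidean_space"
  assumes "bounded D" "D \<in> sets lebesgue" "f \<in> borel_measurable (lebesgue_on D)"
    and "\<And>x. x \<in> D \<Longrightarrow> norm (f x) \<le> R"
  shows "f \<in> L2_space D"
proof -
  have "integrable (lebesgue_on D) (\<lambda>x. R\<^sup>2)"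
    using L2_spaceD(2)[OF L2_space_const[OF assms(1,2), of "R"]] by simp
  then have "integrable (lebesgue_on D) (\<lambda>x. (norm (f x))\<^sup>2)"
  proof (rule Bochner_Integration.integrable_bound)
    show "AE x in lebesgue_on D. norm ((norm (f x))\<^sup>2) \<le> norm (R\<^sup>2)"
      using assms(4) power_mono[OF assms(4) norm_ge_zero, of _ 2] by (intro AE_I2) simp
  qed (use assms(3) in measurable)
  then show ?thesis using assms(3) by (simp add: L2_space_def)
qed

lemma L2_space_indicator:
  fixes f :: "real^'n \<Rightarrow> 'b::euclidean_space"
  assumes "K \<in> sets lebesgue" "f \<in> L2_space D"
  shows "(\<lambda>x. indicator K x *\<^sub>R f x) \<in> L2_space D"
proof -
  have K: "indicat_real K \<in> borel_measurable (lebesgue_on D)"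
    using assms(1) by (intro measurable_restrict_space1) simp
  then have m: "(\<lambda>x. indicat_real K x *\<^sub>R f x) \<in> borel_measurable (lebesgue_on D)"
    using L2_spaceD(1)[OF assms(2)] by (rule borel_measurable_scaleR)
  have "integrable (lebesgue_on D) (\<lambda>x. (norm (indicat_real K x *\<^sub>R f x))\<^sup>2)"
  proof (rule Bochner_Integration.integrable_bound[OF L2_spaceD(2)[OF assms(2)]])
    show "AE x in lebesgue_on D. norm ((norm (indicat_real K x *\<^sub>R f x))\<^sup>2) \<le> norm ((norm (f x))\<^sup>2)"
      by (auto simp: indicator_def)
  qed (use m in measurable)
  with m show ?thesis by (simp add: L2_space_def)
qed

text \<open>The set is covered by nonoverlapping cubes of almost the same total measure. A cube of
  side s has diameter at most n s, so its image lies in a ball of radius L n s, whose volume is the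
  stated constant times s^n. In the application the image is a preimage under a measurable map,
  which supplies its measurability.\<close>

lemma lipschitz_image_emeasure_le:
  fixes g :: "real^'n \<Rightarrow> real^'n"
  assumes g: "L-lipschitz_on S g" and E: "E \<in> sets lebesgue" "bounded E"
    and gE: "g ` (E \<inter> S) \<in> sets lebesgue"
  shows "emeasure lebesgue (g ` (E \<inter> S)) \<le>
    ennreal ((L * CARD('n)) ^ CARD('n) * measure lborel (ball (0 :: real^'n) 1)) * emeasure lebesgue E"
proof -
  let ?n = "CARD('n)"
  define C where "C = (L * ?n) ^ ?n * measure lborel (ball (0 :: real^'n) 1)"
  have L: "L \<ge> 0" using g by (rule lipschitz_on_nonneg)
  then have C: "C \<ge> 0" by (simp add: C_def)
  have Em: "E \<in> lmeasurable" using E bounded_set_imp_lmeasurable by blast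
  obtain R where R: "R > 0" "\<And>x. x \<in> E \<Longrightarrow> norm x \<le> R"
    using E(2) bounded_pos by blast
  \<comment> \<open>The bounding box is a cube, so the intervals obtained from it by dyadic division
    are cubes as well.\<close>
  define a b :: "real^'n" where "a = (\<chi> i. - R)" and "b = (\<chi> i. R)"
  have Eab: "E \<subseteq> cbox a b"
  proof
    fix x assume "x \<in> E"
    then have "\<bar>x $ i\<bar> \<le> R" for i using R(2) component_le_norm_cart order_trans by blast
    then show "x \<in> cbox a b" by (simp add: mem_box_cart a_def b_def abs_le_iff minus_le_iff)
  qed
  have "emeasure lebesgue (g ` (E \<inter> S)) \<le> ennreal (C * (measure lebesgue E + e))" if e: "e > 0" for e
  proof -
    obtain \<D> where \<D>: "countable \<D>"
      "\<And>K. K \<in> \<D> \<Longrightarrow> K \<subseteq> cbox a b \<and> K \<noteq> {} \<and> (\<exists>c d. K = cbox c d)"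
      "pairwise (\<lambda>A B. interior A \<inter> interior B = {}) \<D>"
      "\<And>u v. cbox u v \<in> \<D> \<Longrightarrow> \<exists>n. \<forall>i \<in> Basis. v \<bullet> i - u \<bullet> i = (b \<bullet> i - a \<bullet> i)/2^n"
      "E \<subseteq> \<Union>\<D>" "\<Union>\<D> \<in> lmeasurable" "measure lebesgue (\<Union>\<D>) \<le> measure lebesgue E + e"
      by (rule measurable_outer_intervals_bounded[OF Em Eab e]) blast
    have cube: "\<exists>A. A \<in> sets lebesgue \<and> g ` (K \<inter> S) \<subseteq> A \<and> emeasure lebesgue A \<le> ennreal C * emeasure lebesgue (interior K)"
      if K: "K \<in> \<D>" for K
    proof (cases "K \<inter> S = {}")
      case True
      then show ?thesis by (intro exI[of _ "{}"]) simp
    next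
      case False
      then obtain x0 where x0: "x0 \<in> K" "x0 \<in> S" by blast
      obtain u v where uv: "K = cbox u v" using \<D>(2)[OF K] by blast
      obtain m where m: "\<forall>i \<in> Basis. v \<bullet> i - u \<bullet> i = (b \<bullet> i - a \<bullet> i)/2^m"
        using \<D>(4) K uv by blast
      define s where "s = 2 * R / 2 ^ m"
      have s: "s > 0" using R by (simp add: s_def)
      have side: "v $ i - u $ i = s" for i
        using m[rule_format, of "axis i 1"] by (simp add: inner_axis a_def b_def s_def)
      have dist: "dist x y \<le> ?n * s" if "x \<in> K" "y \<in> K" for x y
      proof -
        have "\<bar>(x - y) $ i\<bar> \<le> s" for i
          using that side[of i] unfolding uv mem_box_cart by (smt (verit) vector_minus_component)
        then have "(\<Sum>i\<in>UNIV. \<bar>(x - y) $ i\<bar>) \<le> (\<Sum>i\<in>(UNIV :: 'n set). s)" by (intro sum_mono)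
        then show ?thesis using norm_le_l1_cart[of "x - y"] by (simp add: dist_norm)
      qed
      let ?A = "cball (g x0) (L * (?n * s))"
      have sub: "g ` (K \<inter> S) \<subseteq> ?A"
      proof (clarsimp)
        fix y assume "y \<in> K" "y \<in> S"
        then show "dist (g x0) (g y) \<le> L * (?n * s)"
          using lipschitz_onD[OF g x0(2), of y] mult_left_mono[OF dist[OF x0(1), of y] L] by linarith
      qed
      have "measure lborel (interior K) = s ^ ?n"
      proof -
        have "measure lborel (interior K) = measure lborel (box u v)" by (simp add: uv)
        also have "\<dots> = (\<Prod>i\<in>Basis. (v - u) \<bullet> i)"
        proof -
          have "u \<bullet> i \<le> v \<bullet> i" if "i \<in> Basis" for i
            using that side s by (auto simp: Basis_vec_def inner_axis) (smt (verit))
          then show ?thesis by (simp add: measure_lborel_box_eq)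
        qed
        also have "\<dots> = (\<Prod>i\<in>(Basis :: (real^'n) set). s)"
          using side by (intro prod.cong) (auto simp: Basis_vec_def inner_axis)
        finally show ?thesis by simp
      qed
      moreover have "emeasure lebesgue (interior K) = ennreal (measure lborel (interior K))"
        using uv by (simp add: emeasure_lborel_box_eq measure_def)
      moreover have "emeasure lebesgue ?A = ennreal (measure lborel ?A)"
        using emeasure_lborel_cball_finite[of "g x0" "L * (?n * s)"]
        by (simp add: emeasure_eq_ennreal_measure top.not_eq_extremum)
      moreover have "measure lborel ?A = C * s ^ ?n"
        using content_ball_conv_unit_ball[of "L * (?n * s)" "g x0"] content_cball_conv_ball[of "g x0" "L * (?n * s)"] L s
        by (simp add: C_def power_mult_distrib)
      ultimately have "emeasure lebesgue ?A = ennreal C * emeasure lebesgue (interior K)"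
        using C s by (simp add: ennreal_mult)
      then show ?thesis using sub by (intro exI[of _ ?A]) auto
    qed
    then obtain A where A: "\<And>K. K \<in> \<D> \<Longrightarrow> A K \<in> sets lebesgue \<and> g ` (K \<inter> S) \<subseteq> A K \<and>
        emeasure lebesgue (A K) \<le> ennreal C * emeasure lebesgue (interior K)" by metis
    define k where "k n = (if n \<in> to_nat_on \<D> ` \<D> then from_nat_into \<D> n else {})" for n
    define h where "h n = (if n \<in> to_nat_on \<D> ` \<D> then A (k n) else {})" for n
    have kD: "k n \<in> \<D>" if "n \<in> to_nat_on \<D> ` \<D>" for n
      using that \<D>(1) by (auto simp: k_def)
    have kto: "k (to_nat_on \<D> K) = K" if "K \<in> \<D>" for K
      using that \<D>(1) by (simp add: k_def)
    have hm: "h n \<in> sets lebesgue" for n using A kD by (auto simp: h_def)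
    have "g ` (E \<inter> S) \<subseteq> (\<Union>n. h n)"
    proof (clarsimp)
      fix x assume x: "x \<in> E" "x \<in> S"
      then obtain K where K: "K \<in> \<D>" "x \<in> K" using \<D>(5) by blast
      then have "g x \<in> A K" using A[OF K(1)] x by blast
      then have "g x \<in> h (to_nat_on \<D> K)" using K(1) kto by (simp add: h_def)
      then show "\<exists>n. g x \<in> h n" by blast
    qed
    then have "emeasure lebesgue (g ` (E \<inter> S)) \<le> emeasure lebesgue (\<Union>n. h n)"
      using hm by (intro emeasure_mono) auto
    also have "\<dots> \<le> (\<Sum>n. emeasure lebesgue (h n))"
      using hm by (intro emeasure_subadditive_countably) auto
    also have "\<dots> \<le> (\<Sum>n. ennreal C * emeasure lebesgue (interior (k n)))"
    proof (intro suminf_le allI)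
      fix n
      show "emeasure lebesgue (h n) \<le> ennreal C * emeasure lebesgue (interior (k n))"
      proof (cases "n \<in> to_nat_on \<D> ` \<D>")
        case True
        then have "h n = A (k n)" by (simp add: h_def)
        then show ?thesis using A[OF kD[OF True]] by metis
      next
        case False
        then have "h n = {}" by (simp add: h_def)
        then show ?thesis by simp
      qed
    qed auto
    also have "\<dots> = ennreal C * (\<Sum>n. emeasure lebesgue (interior (k n)))" by simp
    also have "(\<Sum>n. emeasure lebesgue (interior (k n))) = emeasure lebesgue (\<Union>n. interior (k n))"
    proof (rule suminf_emeasure)
      show "disjoint_family (\<lambda>n. interior (k n))"
        unfolding disjoint_family_on_def
      proof (intro ballI impI)
        fix m n :: nat assume mn: "m \<noteq> n"
        show "interior (k m) \<inter> interior (k n) = {}"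
        proof (cases "m \<in> to_nat_on \<D> ` \<D> \<and> n \<in> to_nat_on \<D> ` \<D>")
          case True
          then obtain K K' where K: "K \<in> \<D>" "K' \<in> \<D>" "m = to_nat_on \<D> K" "n = to_nat_on \<D> K'" by blast
          then have "K \<noteq> K'" using mn by blast
          then show ?thesis using pairwiseD[OF \<D>(3) K(1,2)] kto K by simp
        qed (auto simp: k_def)
      qed
    qed auto
    also have "\<dots> \<le> emeasure lebesgue (\<Union>\<D>)"
    proof (rule emeasure_mono)
      show "(\<Union>n. interior (k n)) \<subseteq> \<Union>\<D>"
      proof
        fix x assume "x \<in> (\<Union>n. interior (k n))"
        then obtain n where n: "x \<in> interior (k n)" by blast
        then have "n \<in> to_nat_on \<D> ` \<D>" by (auto simp: k_def split: if_splits)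
        then show "x \<in> \<Union>\<D>" using kD n interior_subset by blast
      qed
      show "\<Union>\<D> \<in> sets lebesgue" using \<D>(6) by auto
    qed
    also have "\<dots> \<le> ennreal (measure lebesgue E + e)"
      using \<D>(6,7) by (simp only: emeasure_eq_measure2 ennreal_leI)
    finally show ?thesis
      using C e by (simp add: ennreal_mult mult_left_mono)
  qed
  note bound = this
  have "emeasure lebesgue (g ` (E \<inter> S)) \<le> ennreal (C * measure lebesgue E)"
  proof (rule ennreal_le_epsilon)
    fix e :: real assume e: "e > 0"
    have "emeasure lebesgue (g ` (E \<inter> S)) \<le> ennreal (C * (measure lebesgue E + e / (C + 1)))"
      using e C by (intro bound) simp
    also have "\<dots> \<le> ennreal (C * measure lebesgue E + e)"
    proof (rule ennreal_leI)
      have "C * (e / (C + 1)) \<le> e" using C e by (simp add: field_simps)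
      then show "C * (measure lebesgue E + e / (C + 1)) \<le> C * measure lebesgue E + e"
        by (simp add: distrib_left)
    qed
    also have "\<dots> = ennreal (C * measure lebesgue E) + ennreal e"
      using C e by simp
    finally show "emeasure lebesgue (g ` (E \<inter> S)) \<le> ennreal (C * measure lebesgue E) + ennreal e" .
  qed
  also have "\<dots> = ennreal C * emeasure lebesgue E"
    using C Em by (simp only: emeasure_eq_measure2 ennreal_mult measure_nonneg)
  finally show ?thesis by (simp add: C_def)
qed

text \<open>A preimage under \<open>X\<close> is an image under the Lipschitz inverse. Therefore the
  image measure of D under \<open>X\<close> is at most C times Lebesgue measure on E, which gives
  the norm bound. Preimages of null sets are null, which makes the composition measurable although
  \<open>u\<close> is only Lebesgue measurable.\<close>

lemma lipschitz_inverse_composition: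
  fixes D E :: "(real^'n) set" and X :: "real^'n \<Rightarrow> real^'n"
  assumes D: "D \<in> sets lebesgue" and E: "open E" "bounded E"
    and X: "X \<in> borel_measurable (lebesgue_on D)" "inj_on X D" "L-lipschitz_on (X ` D) (inv_into D X)"
      "X ` D \<subseteq> E"
    and u: "u \<in> L2_space E"
  shows "(\<lambda>s. u (X s)) \<in> L2_space D"
    "L2_norm D (\<lambda>s. u (X s)) \<le> sqrt ((L * CARD('n)) ^ CARD('n) * measure lborel (ball (0 :: real^'n) 1)) * L2_norm E u"
proof -
  define C where "C = (L * CARD('n)) ^ CARD('n) * measure lborel (ball (0 :: real^'n) 1)"
  have C: "C \<ge> 0" using lipschitz_on_nonneg[OF X(3)] by (simp add: C_def)
  have Em: "E \<in> sets lebesgue" using E by simp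
  have pre: "X -` S \<inter> D = inv_into D X ` (S \<inter> X ` D)" for S
    using X(2) by (force simp: image_iff)
  have null: "X -` N \<inter> D \<in> null_sets lebesgue" if "N \<in> null_sets lebesgue" for N
  proof -
    have "negligible (inv_into D X ` (N \<inter> X ` D))"
    proof (rule negligible_locally_Lipschitz_image)
      have "negligible N" using that by (simp add: negligible_iff_null_sets)
      then show "negligible (N \<inter> X ` D)" by (rule negligible_subset) blast
      fix x assume x: "x \<in> N \<inter> X ` D"
      have "\<forall>y\<in>N \<inter> X ` D \<inter> UNIV. norm (inv_into D X y - inv_into D X x) \<le> L * norm (y - x)"
        using lipschitz_on_normD[OF X(3)] x by auto
      then show "\<exists>T B. open T \<and> x \<in> T \<and>
          (\<forall>y\<in>N \<inter> X ` D \<inter> T. norm (inv_into D X y - inv_into D X x) \<le> B * norm (y - x))"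
        by (intro exI[of _ UNIV] exI[of _ L]) auto
    qed simp
    then show ?thesis by (simp add: pre negligible_iff_null_sets)
  qed
  \<comment> \<open>A Lebesgue set is a Borel set together with part of a Borel null set; the first
    is handled by measurability of \<open>X\<close>, the second by \<open>null\<close>.\<close>
  have meas: "X -` S \<inter> D \<in> sets lebesgue" if S: "S \<in> sets lebesgue" for S
  proof -
    obtain P N N' where PN: "S = P \<union> N" "N \<subseteq> N'" "N' \<in> null_sets lborel" "P \<in> sets lborel"
      using S by (rule sets_completionE)
    have "X -` P \<inter> space (lebesgue_on D) \<in> sets (lebesgue_on D)"
      using X(1) PN(4) by (intro measurable_sets[of _ _ borel]) auto
    then have 1: "X -` P \<inter> D \<in> sets lebesgue"
      using D by (simp add: sets_restrict_space_iff)
    have "X -` N' \<inter> D \<in> null_sets lebesgue" using PN(3) by (intro null null_sets_completionI)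
    then have "X -` N \<inter> D \<in> sets lebesgue"
      using PN(2) null_sets_completion_subset[of "X -` N \<inter> D" "X -` N' \<inter> D" lborel] by auto
    moreover have "X -` S \<inter> D = (X -` P \<inter> D) \<union> (X -` N \<inter> D)" using PN(1) by auto
    ultimately show ?thesis using 1 by simp
  qed
  have Xm: "X \<in> measurable (lebesgue_on D) (lebesgue_on E)"
  proof (rule measurableI)
    show "X x \<in> space (lebesgue_on E)" if "x \<in> space (lebesgue_on D)" for x
      using that X(4) by (auto simp: space_restrict_space)
    fix S assume "S \<in> sets (lebesgue_on E)"
    then have "S \<in> sets lebesgue" using Em by (simp add: sets_restrict_space_iff)
    then show "X -` S \<inter> space (lebesgue_on D) \<in> sets (lebesgue_on D)"
      using meas D by (simp add: sets_restrict_space_iff)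
  qed
  let ?\<nu> = "distr (lebesgue_on D) (lebesgue_on E) X" and ?\<mu> = "scale_measure (ennreal C) (lebesgue_on E)"
  have le: "?\<nu> \<le> ?\<mu>"
  proof (subst le_measure)
    show "sets ?\<nu> = sets ?\<mu>" by simp
    show "\<forall>S\<in>sets ?\<nu>. emeasure ?\<nu> S \<le> emeasure ?\<mu> S"
    proof
      fix S assume "S \<in> sets ?\<nu>"
      then have S: "S \<in> sets (lebesgue_on E)" by simp
      then have S': "S \<in> sets lebesgue" "S \<subseteq> E" using Em by (auto simp: sets_restrict_space_iff)
      have "emeasure ?\<nu> S = emeasure (lebesgue_on D) (X -` S \<inter> space (lebesgue_on D))"
        by (rule emeasure_distr[OF Xm S])
      also have "\<dots> = emeasure lebesgue (inv_into D X ` (S \<inter> X ` D))"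
        using D by (simp add: emeasure_restrict_space pre[symmetric])
      also have "\<dots> \<le> ennreal C * emeasure lebesgue S"
        unfolding C_def
        by (rule lipschitz_image_emeasure_le[OF X(3) S'(1)])
          (use S' E(2) meas bounded_subset pre in auto)
      also have "\<dots> = emeasure ?\<mu> S"
        using Em S' by (simp add: emeasure_restrict_space)
      finally show "emeasure ?\<nu> S \<le> emeasure ?\<mu> S" .
    qed
  qed
  have um: "u \<in> borel_measurable (lebesgue_on E)" by (rule L2_spaceD(1)[OF u])
  have uXm: "(\<lambda>s. u (X s)) \<in> borel_measurable (lebesgue_on D)" by (rule measurable_compose[OF Xm um])
  have sq: "(\<lambda>x. ennreal ((norm (u x))\<^sup>2)) \<in> borel_measurable (lebesgue_on E)" using um by measurable
  have "(\<integral>\<^sup>+s. ennreal ((norm (u (X s)))\<^sup>2) \<partial>lebesgue_on D) = (\<integral>\<^sup>+x. ennreal ((norm (u x))\<^sup>2) \<partial>?\<nu>)"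
    by (rule nn_integral_distr[symmetric, OF Xm]) (use sq in simp)
  also have "\<dots> \<le> (\<integral>\<^sup>+x. ennreal ((norm (u x))\<^sup>2) \<partial>?\<mu>)"
    by (rule nn_integral_mono_measure[OF _ le]) simp
  also have "\<dots> = ennreal C * (\<integral>\<^sup>+x. ennreal ((norm (u x))\<^sup>2) \<partial>lebesgue_on E)"
    by (rule nn_integral_scale_measure[OF sq])
  also have "(\<integral>\<^sup>+x. ennreal ((norm (u x))\<^sup>2) \<partial>lebesgue_on E) = ennreal (L2_inner E u u)"
    unfolding L2_inner_self by (rule nn_integral_eq_integral[OF L2_spaceD(2)[OF u]]) simp
  also have "ennreal C * \<dots> = ennreal (C * L2_inner E u u)"
    using C by (simp add: ennreal_mult L2_inner_self_nonneg)
  finally have nn: "(\<integral>\<^sup>+s. ennreal ((norm (u (X s)))\<^sup>2) \<partial>lebesgue_on D) \<le> ennreal (C * L2_inner E u u)" .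
  have "integrable (lebesgue_on D) (\<lambda>s. (norm (u (X s)))\<^sup>2)"
  proof (rule integrableI_bounded)
    show "(\<integral>\<^sup>+s. ennreal (norm ((norm (u (X s)))\<^sup>2)) \<partial>lebesgue_on D) < \<infinity>"
      using nn by (simp add: le_less_trans[OF _ ennreal_less_top])
  qed (use uXm in measurable)
  then show uX: "(\<lambda>s. u (X s)) \<in> L2_space D" using uXm by (simp add: L2_space_def)
  have "L2_inner D (\<lambda>s. u (X s)) (\<lambda>s. u (X s)) \<le> C * L2_inner E u u"
    using nn nn_integral_eq_integral[OF L2_spaceD(2)[OF uX]] C
    by (simp add: L2_inner_self[of D] ennreal_le_iff L2_inner_self_nonneg)
  then have "L2_norm D (\<lambda>s. u (X s)) \<le> sqrt (C * L2_inner E u u)"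
    unfolding L2_norm_def by (rule real_sqrt_le_mono)
  then show "L2_norm D (\<lambda>s. u (X s)) \<le> sqrt ((L * CARD('n)) ^ CARD('n) * measure lborel (ball (0 :: real^'n) 1)) * L2_norm E u"
    by (simp add: C_def real_sqrt_mult L2_norm_def)
qed

section \<open>Projection onto piecewise affine functions\<close>

lemma L2_inner_zero_left: "L2_inner D (\<lambda>x. 0) g = 0"
  by (simp add: L2_inner_def)

text \<open>Finite dimension is encoded by a finite set \<open>M\<close> of functionals that
  separate \<open>S\<close> up to functions of norm 0, since representatives differing on null sets
  are distinct elements. The kernel of one functional has codimension at most 1, and a Gram-Schmidt
  step extends the projection from it to \<open>S\<close>.\<close>

lemma L2_projection_onto_subspace_exists:
  fixes v :: "real^'n \<Rightarrow> 'b::euclidean_space"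
  assumes "finite M" "M \<subseteq> L2_space D" "S \<subseteq> L2_space D" "v \<in> L2_space D"
    and "(\<lambda>x. 0) \<in> S" "\<And>Y Z. Y \<in> S \<Longrightarrow> Z \<in> S \<Longrightarrow> (\<lambda>x. Y x + Z x) \<in> S"
    and "\<And>c Y. Y \<in> S \<Longrightarrow> (\<lambda>x. c *\<^sub>R Y x) \<in> S"
    and "\<And>Y. Y \<in> S \<Longrightarrow> (\<forall>m\<in>M. L2_inner D Y m = 0) \<Longrightarrow> L2_inner D Y Y = 0"
  shows "\<exists>p\<in>S. \<forall>Y\<in>S. L2_inner D p Y = L2_inner D v Y"
  using assms
proof (induction M arbitrary: S v rule: finite_induct)
  case empty
  have "L2_inner D v Y = 0" if "Y \<in> S" for Y
    using L2_inner_Cauchy_Schwarz[of v D Y] empty that by (auto simp: L2_norm_def)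
  then show ?case using empty.prems(4) by (intro bexI[of _ "\<lambda>x. 0"]) (simp_all add: L2_inner_zero_left)
next
  case (insert m M)
  note S = insert.prems
  define S0 where "S0 = {Y \<in> S. L2_inner D Y m = 0}"
  have mL: "m \<in> L2_space D" using S(1) by simp
  have SL: "Y \<in> L2_space D" if "Y \<in> S" for Y using S(2) that by blast
  have S0: "\<exists>p\<in>S0. \<forall>Y\<in>S0. L2_inner D p Y = L2_inner D w Y" if "w \<in> L2_space D" for w
  proof (rule insert.IH)
    show "(\<lambda>x. Y x + Z x) \<in> S0" if "Y \<in> S0" "Z \<in> S0" for Y Z
      using that S(5) SL mL by (auto simp: S0_def L2_inner_add_left)
    show "(\<lambda>x. c *\<^sub>R Y x) \<in> S0" if "Y \<in> S0" for c Y
      using that S(6) by (auto simp: S0_def L2_inner_scaleR_left)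
  qed (use S that in \<open>auto simp: S0_def L2_inner_zero_left\<close>)
  show ?case
  proof (cases "S0 = S")
    case True
    then show ?thesis using S0[OF S(3)] by simp
  next
    case False
    then obtain w where w: "w \<in> S" "L2_inner D w m \<noteq> 0" by (auto simp: S0_def)
    obtain q where q: "q \<in> S0" "\<forall>Y\<in>S0. L2_inner D q Y = L2_inner D w Y" using S0[OF SL[OF w(1)]] by blast
    obtain p0 where p0: "p0 \<in> S0" "\<forall>Y\<in>S0. L2_inner D p0 Y = L2_inner D v Y" using S0[OF S(3)] by blast
    have qS: "q \<in> S" "L2_inner D q m = 0" and p0S: "p0 \<in> S" using q p0 by (auto simp: S0_def)
    have diff: "(\<lambda>x. Y x - c *\<^sub>R Z x) \<in> S" if "Y \<in> S" "Z \<in> S" for Y Z c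
      using S(5)[OF that(1) S(6)[OF that(2), of "-c"]] by simp
    \<comment> \<open>This function is orthogonal to \<open>S0\<close> and generates
      \<open>S\<close> together with it. Its norm is not 0 because its product with \<open>m\<close>
      is not.\<close>
    define w0 where "w0 x = w x - q x" for x
    have w0S: "w0 \<in> S" using diff[OF w(1) qS(1), of 1] by (simp add: w0_def[abs_def])
    have w0m: "L2_inner D w0 m \<noteq> 0"
      using w qS by (simp add: w0_def[abs_def] L2_inner_diff_left SL mL)
    have w0orth: "L2_inner D w0 Y = 0" if "Y \<in> S0" for Y
      using that q(2) w qS by (simp add: w0_def[abs_def] L2_inner_diff_left SL S0_def)
    have "L2_inner D w0 w0 \<noteq> 0"
      using L2_inner_Cauchy_Schwarz[OF SL[OF w0S] mL] w0m by (auto simp: L2_norm_def)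
    \<comment> \<open>The coefficient makes the sum match \<open>v\<close> against
      \<open>w0\<close>; against \<open>S0\<close> the function \<open>p0\<close> matches already,
      and \<open>w0\<close> contributes nothing there.\<close>
    define k where "k = (L2_inner D v w0 - L2_inner D p0 w0) / L2_inner D w0 w0"
    let ?p = "\<lambda>x. p0 x + k *\<^sub>R w0 x"
    have "L2_inner D ?p Y = L2_inner D v Y" if Y: "Y \<in> S" for Y
    proof -
      \<comment> \<open>The multiple of \<open>w0\<close> that carries the whole product with
        \<open>m\<close>, so that the remainder falls into \<open>S0\<close>.\<close>
      define c where "c = L2_inner D Y m / L2_inner D w0 m"
      define Y0 where "Y0 x = Y x - c *\<^sub>R w0 x" for x
      have Y0S: "Y0 \<in> S" unfolding Y0_def[abs_def] by (rule diff[OF Y w0S])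
      have "L2_inner D Y0 m = 0"
        using w0m by (simp add: Y0_def[abs_def] L2_inner_diff_left L2_inner_scaleR_left SL Y w0S mL
            L2_space_scaleR c_def)
      then have Y0: "Y0 \<in> S0" using Y0S by (simp add: S0_def)
      have Yeq: "Y = (\<lambda>x. Y0 x + c *\<^sub>R w0 x)" by (simp add: Y0_def)
      have split: "L2_inner D z Y = L2_inner D z Y0 + c * L2_inner D z w0" if "z \<in> L2_space D" for z
        unfolding Yeq using that Y0S w0S
        by (simp add: L2_inner_add_right L2_inner_scaleR_right SL L2_space_scaleR)
      have "L2_inner D ?p Y = L2_inner D p0 Y + k * L2_inner D w0 Y"
        using Y p0S w0S by (simp add: L2_inner_add_left L2_inner_scaleR_left SL L2_space_scaleR)
      also have "\<dots> = L2_inner D v Y0 + c * L2_inner D v w0"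
        using p0(2) Y0 w0orth[OF Y0] \<open>L2_inner D w0 w0 \<noteq> 0\<close>
        by (simp add: split SL p0S w0S k_def field_simps)
      also have "\<dots> = L2_inner D v Y" by (simp add: split S(3))
      finally show ?thesis .
    qed
    moreover have "?p \<in> S" by (intro S(5) S(6) p0S w0S)
    ultimately show ?thesis by blast
  qed
qed

section \<open>Piecewise affine functions and their L2 projection\<close>

lemma P1_space_H1: "Y \<in> P1_space D T \<Longrightarrow> Y \<in> H1_space D"
  by (simp add: P1_space_def)

lemma P1_space_L2: "Y \<in> P1_space D T \<Longrightarrow> Y \<in> L2_space D"
  using P1_space_H1 H1_spaceD(1) by blast

lemma P1_space_const:
  assumes "open D" "bounded D"
  shows "(\<lambda>x. c) \<in> P1_space D T"
  unfolding P1_space_def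
  by (auto intro!: H1_space_const assms exI[of _ 0] exI[of _ c])

lemma P1_space_add:
  assumes "open D" and Y: "Y \<in> P1_space D T" and Z: "Z \<in> P1_space D T"
  shows "(\<lambda>x. Y x + Z x) \<in> P1_space D T"
  unfolding P1_space_def
proof (intro CollectI conjI ballI)
  show "(\<lambda>x. Y x + Z x) \<in> H1_space D"
    using assms by (intro H1_space_add P1_space_H1)
  fix K assume "K \<in> T"
  obtain A b where 1: "AE x in lebesgue_on K. Y x = A *v x + b"
    using Y \<open>K \<in> T\<close> unfolding P1_space_def by blast
  obtain A' b' where 2: "AE x in lebesgue_on K. Z x = A' *v x + b'"
    using Z \<open>K \<in> T\<close> unfolding P1_space_def by blast
  have "AE x in lebesgue_on K. Y x + Z x = (A + A') *v x + (b + b')"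
    using 1 2 by eventually_elim (simp add: matrix_vector_mult_add_rdistrib)
  then show "\<exists>A b. AE x in lebesgue_on K. Y x + Z x = A *v x + b" by blast
qed

lemma P1_space_scaleR:
  assumes Y: "Y \<in> P1_space D T"
  shows "(\<lambda>x. c *\<^sub>R Y x) \<in> P1_space D T"
  unfolding P1_space_def
proof (intro CollectI conjI ballI)
  show "(\<lambda>x. c *\<^sub>R Y x) \<in> H1_space D"
    using assms by (intro H1_space_scaleR P1_space_H1)
  fix K assume "K \<in> T"
  obtain A b where 1: "AE x in lebesgue_on K. Y x = A *v x + b"
    using Y \<open>K \<in> T\<close> unfolding P1_space_def by blast
  have "AE x in lebesgue_on K. c *\<^sub>R Y x = (c *\<^sub>R A) *v x + c *\<^sub>R b"
    using 1 by eventually_elim (simp add: scaleR_right_distrib scaleR_matrix_vector_assoc)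
  then show "\<exists>A b. AE x in lebesgue_on K. c *\<^sub>R Y x = A *v x + b" by blast
qed

lemma P1_space_minus: "Y \<in> P1_space D T \<Longrightarrow> (\<lambda>x. - Y x) \<in> P1_space D T"
  using P1_space_scaleR[of Y D T "-1"] by simp

text \<open>A piecewise affine function is determined by its moments against the piecewise affine
  functions that need not be continuous; these are finitely many functionals, so the projection
  exists although \<open>P1_space\<close> consists of representatives and is not a finite-dimensional type.\<close>

lemma P1_projection_exists:
  fixes D :: "(real^'n) set"
  assumes D: "open D" "bounded D" and T: "simplicial_mesh D T" and v: "v \<in> L2_space D"
  shows "\<exists>p\<in>P1_space D T. \<forall>Y\<in>P1_space D T. L2_inner D p Y = L2_inner D v Y"
proof -
  have Dm: "D \<in> sets lebesgue" using D by simp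
  have fin: "finite T" and cover: "\<Union>T = closure D" and simp: "\<And>K. K \<in> T \<Longrightarrow> int CARD('n) simplex K"
    using T by (auto simp: simplicial_mesh_def triangulation_def)
  have Km: "K \<in> sets lebesgue" if "K \<in> T" for K
    using compact_simplex[OF simp[OF that]] lmeasurable_compact fmeasurableD by blast
  define aff :: "(real^'n^'n) \<times> (real^'n) \<Rightarrow> real^'n \<Rightarrow> real^'n" where "aff z x = fst z *v x + snd z" for z x
  obtain R where R: "\<And>x. x \<in> D \<Longrightarrow> norm x \<le> R" using D(2) by (auto simp: bounded_iff)
  have "(\<lambda>x. x) \<in> L2_space D"
    by (rule L2_space_bounded[OF D(2) Dm _ R]) (intro measurable_restrict_space1 measurable_completion, simp)
  then have affL: "aff z \<in> L2_space D" for z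
    unfolding aff_def[abs_def]
    by (intro L2_space_add L2_space_const[OF D(2) Dm] L2_space_linear[where l = "(*v) (fst z)"]
        matrix_vector_mul_linear)
  define mom where "mom K z x = indicator K x *\<^sub>R aff z x" for K z x
  have momL: "mom K z \<in> L2_space D" if "K \<in> T" for K z
    unfolding mom_def[abs_def] by (rule L2_space_indicator[OF Km[OF that] affL])
  let ?M = "(\<lambda>(K, z). mom K z) ` (T \<times> Basis)"
  show ?thesis
  proof (rule L2_projection_onto_subspace_exists[of ?M])
    show "finite ?M" using fin by simp
    show "?M \<subseteq> L2_space D" using momL by auto
    fix Y assume Y: "Y \<in> P1_space D T" and zero: "\<forall>m\<in>?M. L2_inner D Y m = 0"
    note YL = P1_space_L2[OF Y]
    have "AE x in lebesgue_on D. x \<in> K \<longrightarrow> Y x = 0" if K: "K \<in> T" for K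
    proof -
      obtain A b where Ab: "AE x in lebesgue_on K. Y x = A *v x + b"
        using Y K unfolding P1_space_def by blast
      define z where "z = (A, b)"
      have "AE x in lebesgue. x \<in> K \<longrightarrow> Y x = aff z x"
        using Ab Km[OF K] by (simp add: AE_restrict_space_iff aff_def z_def)
      then have AEK: "AE x in lebesgue_on D. x \<in> K \<longrightarrow> Y x = aff z x"
        using Dm by (simp add: AE_restrict_space_iff) (auto elim: eventually_mono)
      have lin: "linear (\<lambda>z. aff z x)" for x
        by (rule linearI) (auto simp: aff_def matrix_vector_mult_add_rdistrib scaleR_right_distrib
            scaleR_matrix_vector_assoc)
      have "aff z x = (\<Sum>e\<in>Basis. (z \<bullet> e) *\<^sub>R aff e x)" for x
        using linear_sum[OF lin, of "\<lambda>e. (z \<bullet> e) *\<^sub>R e" Basis x] linear_cmul[OF lin]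
        by (simp add: euclidean_representation)
      \<comment> \<open>On \<open>K\<close> the function \<open>Y\<close> agrees with
        \<open>aff z\<close>. Its product with \<open>mom K z\<close> is thus the integral of |Y|^2
        over the part of \<open>K\<close> in D, and by linearity also a combination of the vanishing
        moments.\<close>
      then have "L2_inner D Y (mom K z) = (\<integral>x. (\<Sum>e\<in>Basis. (z \<bullet> e) * (Y x \<bullet> mom K e x)) \<partial>lebesgue_on D)"
        by (simp add: L2_inner_def mom_def inner_sum_right sum_distrib_left mult_ac)
      also have "\<dots> = (\<Sum>e\<in>Basis. (z \<bullet> e) * L2_inner D Y (mom K e))"
        using L2_inner_integrable[OF YL momL[OF K]] by (simp add: L2_inner_def)
      also have "\<dots> = 0" using zero K by (auto intro!: sum.neutral)
      finally have 0: "(\<integral>x. Y x \<bullet> mom K z x \<partial>lebesgue_on D) = 0" by (simp add: L2_inner_def)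
      have eq: "AE x in lebesgue_on D. Y x \<bullet> mom K z x = indicator K x * (norm (Y x))\<^sup>2"
        using AEK by eventually_elim (auto simp: mom_def indicator_def power2_norm_eq_inner)
      have "AE x in lebesgue_on D. 0 \<le> Y x \<bullet> mom K z x" using eq by eventually_elim auto
      then have "AE x in lebesgue_on D. Y x \<bullet> mom K z x = 0"
        using integral_nonneg_eq_0_iff_AE[OF L2_inner_integrable[OF YL momL[OF K]]] 0 by blast
      then show ?thesis using eq by eventually_elim (auto simp: indicator_def)
    qed
    then have "AE x in lebesgue_on D. \<forall>K\<in>T. x \<in> K \<longrightarrow> Y x = 0"
      by (intro AE_finite_allI[OF fin])
    moreover have "AE x in lebesgue_on D. x \<in> D" using Dm by (intro AE_I2) (simp add: space_restrict_space)
    ultimately have "AE x in lebesgue_on D. Y x = 0"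
    proof eventually_elim
      case (elim x)
      then have "x \<in> \<Union>T" unfolding cover using closure_subset by blast
      then show ?case using elim by blast
    qed
    then show "L2_inner D Y Y = 0" by (rule L2_inner_AE_zero_left)
  qed (use v P1_space_L2 P1_space_const[OF D] P1_space_add[OF D(1)] P1_space_scaleR in auto)
qed

text \<open>Existence justifies the choice in \<open>L2_projection\<close>; testing the defining
  identity with \<open>p\<close> itself shows that the projection does not increase the
  norm.\<close>

lemma L2_projection_P1:
  fixes D :: "(real^'n) set"
  assumes "open D" "bounded D" "simplicial_mesh D T" "v \<in> L2_space D"
  defines "p \<equiv> L2_projection D (P1_space D T) v"
  shows "p \<in> P1_space D T" "\<And>Y. Y \<in> P1_space D T \<Longrightarrow> L2_inner D p Y = L2_inner D v Y"
    "L2_norm D p \<le> L2_norm D v"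
proof -
  have "\<exists>p. p \<in> P1_space D T \<and> (\<forall>Y\<in>P1_space D T. L2_inner D p Y = L2_inner D v Y)"
    using P1_projection_exists[OF assms(1-4)] by blast
  from someI_ex[OF this] show p: "p \<in> P1_space D T"
    "\<And>Y. Y \<in> P1_space D T \<Longrightarrow> L2_inner D p Y = L2_inner D v Y"
    by (auto simp: p_def L2_projection_def)
  have "L2_norm D p * L2_norm D p = L2_inner D v p"
    unfolding power2_eq_square[symmetric] L2_norm_power2 by (rule p(2)[OF p(1)])
  also have "\<dots> \<le> L2_norm D v * L2_norm D p"
    using L2_inner_Cauchy_Schwarz[OF assms(4) P1_space_L2[OF p(1)]] by linarith
  finally have *: "L2_norm D p * L2_norm D p \<le> L2_norm D v * L2_norm D p" .
  show "L2_norm D p \<le> L2_norm D v"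
  proof (cases "L2_norm D p = 0")
    case False
    then have "L2_norm D p > 0" using L2_norm_nonneg[of D p] by linarith
    then show ?thesis using mult_right_le_imp_le[OF *] by blast
  qed (simp add: L2_norm_nonneg)
qed

lemma L2_norm_const:
  fixes c :: "'b::euclidean_space"
  assumes "D \<in> lmeasurable"
  shows "L2_norm D (\<lambda>x. c) = norm c * sqrt (measure lebesgue D)"
proof -
  have "L2_inner D (\<lambda>x. c) (\<lambda>x. c) = measure lebesgue D * (norm c)\<^sup>2"
    using assms by (simp add: L2_inner_def measure_restrict_space fmeasurableD power2_norm_eq_inner)
  then show ?thesis by (simp add: L2_norm_def real_sqrt_mult)
qed

section \<open>Multiplier norms and coupling forms on one domain\<close>

context
  fixes D :: "(real^'n) set"
  assumes D: "open D" "bounded D" "D \<noteq> {}"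
begin

lemma domain_measure: "D \<in> sets lebesgue" "D \<in> lmeasurable" "measure lebesgue D > 0"
  using D lmeasurable_open[of D] measure_open_pos[OF D] by auto

text \<open>The dual norm is a supremum of reals, which can be used only once it is known to be
  bounded; Cauchy-Schwarz provides the L2 norm as a bound.\<close>

lemma dual_norm_bdd_above:
  assumes \<mu>: "\<mu> \<in> L2_space D"
  shows "bdd_above ((\<lambda>Y. \<bar>L2_inner D \<mu> Y\<bar> / H1_norm D Y) ` {Y \<in> H1_space D. H1_norm D Y \<noteq> 0})"
    and "Y \<in> H1_space D \<Longrightarrow> \<bar>L2_inner D \<mu> Y\<bar> / H1_norm D Y \<le> L2_norm D \<mu>"
proof -
  show le: "\<bar>L2_inner D \<mu> Y\<bar> / H1_norm D Y \<le> L2_norm D \<mu>" if Y: "Y \<in> H1_space D" for Y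
  proof (cases "H1_norm D Y = 0")
    case False
    then have pos: "H1_norm D Y > 0" using H1_norm_nonneg[of D Y] by linarith
    have "\<bar>L2_inner D \<mu> Y\<bar> \<le> L2_norm D \<mu> * L2_norm D Y"
      by (rule L2_inner_Cauchy_Schwarz[OF \<mu> H1_spaceD(1)[OF Y]])
    also have "\<dots> \<le> L2_norm D \<mu> * H1_norm D Y"
      by (intro mult_left_mono L2_norm_le_H1_norm L2_norm_nonneg)
    finally show ?thesis using pos by (simp add: divide_le_eq)
  qed (simp add: L2_norm_nonneg)
  then show "bdd_above ((\<lambda>Y. \<bar>L2_inner D \<mu> Y\<bar> / H1_norm D Y) ` {Y \<in> H1_space D. H1_norm D Y \<noteq> 0})"
    by (intro bdd_aboveI[of _ "L2_norm D \<mu>"]) auto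
qed

lemma H1_norm_const_eq: "H1_norm D (\<lambda>x. c) = norm c * sqrt (measure lebesgue D)"
  using H1_norm_const[OF D(1,2)] L2_norm_const[OF domain_measure(2)] by simp

lemma dual_norm_index_nonempty: "{Y \<in> H1_space D. H1_norm D Y \<noteq> 0} \<noteq> {}"
proof -
  have "(\<lambda>x. axis undefined 1) \<in> {Y \<in> H1_space D. H1_norm D Y \<noteq> 0}"
    using H1_space_const[OF D(1,2)] domain_measure(3) by (simp add: H1_norm_const_eq)
  then show ?thesis by blast
qed

lemma dual_norm_upper:
  "\<mu> \<in> L2_space D \<Longrightarrow> Y \<in> H1_space D \<Longrightarrow> H1_norm D Y \<noteq> 0 \<Longrightarrow>
   \<bar>L2_inner D \<mu> Y\<bar> / H1_norm D Y \<le> dual_norm D (L2_inner D \<mu>)"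
  unfolding dual_norm_def by (rule cSUP_upper[OF _ dual_norm_bdd_above(1)]) auto

lemma dual_norm_le: "\<mu> \<in> L2_space D \<Longrightarrow> dual_norm D (L2_inner D \<mu>) \<le> L2_norm D \<mu>"
  unfolding dual_norm_def
  by (rule cSUP_least[OF dual_norm_index_nonempty]) (use dual_norm_bdd_above(2) in auto)

lemma multiplier_norm_nonneg:
  assumes "\<mu> \<in> L2_space D"
  shows "multiplier_norm ch D \<mu> \<ge> 0"
proof (cases ch)
  case Dual_Pairing
  obtain Y where Y: "Y \<in> H1_space D" "H1_norm D Y \<noteq> 0" using dual_norm_index_nonempty by blast
  have "0 \<le> \<bar>L2_inner D \<mu> Y\<bar> / H1_norm D Y" by (simp add: H1_norm_nonneg)
  then show ?thesis using dual_norm_upper[OF assms Y] Dual_Pairing by simp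
qed (simp add: H1_norm_nonneg)

text \<open>Testing with the constant itself attains the Cauchy-Schwarz bound, so the dual norm and
  the H1 norm both equal the L2 norm on constants.\<close>

lemma multiplier_norm_const: "multiplier_norm ch D (\<lambda>x. c) = norm c * sqrt (measure lebesgue D)"
proof (cases ch)
  case Dual_Pairing
  let ?N = "norm c * sqrt (measure lebesgue D)"
  have cL: "(\<lambda>x. c) \<in> L2_space D" by (rule L2_space_const[OF D(2) domain_measure(1)])
  note cH = H1_space_const[OF D(1,2), of c]
  have le: "dual_norm D (L2_inner D (\<lambda>x. c)) \<le> ?N"
    using dual_norm_le[OF cL] L2_norm_const[OF domain_measure(2), of c] by simp
  have "dual_norm D (L2_inner D (\<lambda>x. c)) \<ge> ?N"
  proof (cases "c = 0")
    case True
    then show ?thesis using multiplier_norm_nonneg[OF cL, of Dual_Pairing] by simp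
  next
    case False
    then have N: "?N > 0" using domain_measure(3) by simp
    have "\<bar>L2_inner D (\<lambda>x. c) (\<lambda>x. c)\<bar> / H1_norm D (\<lambda>x. c) = ?N"
      using N by (simp add: L2_norm_power2[symmetric] L2_norm_const[OF domain_measure(2)]
          H1_norm_const_eq power2_eq_square)
    moreover have "H1_norm D (\<lambda>x. c) \<noteq> 0"
      using False domain_measure(3) by (simp add: H1_norm_const_eq)
    ultimately show ?thesis using dual_norm_upper[OF cL cH] by simp
  qed
  with le Dual_Pairing show ?thesis by simp
qed (simp add: H1_norm_const_eq)

lemma coupling_form_const_left: "coupling_form ch D (\<lambda>x. c) w = L2_inner D (\<lambda>x. c) w"
  by (cases ch) (simp_all add: H1_inner_def L2_inner_AE_zero_left[OF weak_grad_const_AE[OF D(1,2)]])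

lemma coupling_form_zero_right: "coupling_form ch D \<mu> (\<lambda>x. 0) = 0"
  by (cases ch) (simp_all add: H1_inner_def L2_inner_AE_zero_right[OF weak_grad_const_AE[OF D(1,2)]]
      L2_inner_AE_zero_right)

lemma a_s_bound:
  assumes "X \<in> H1_space D" "Y \<in> H1_space D" "\<beta> \<ge> 0" "\<gamma> \<ge> 0"
  shows "\<bar>a_s D \<beta> \<gamma> X Y\<bar> \<le> (\<beta> + \<gamma>) * H1_norm D X * H1_norm D Y"
proof -
  have "\<bar>L2_inner D X Y\<bar> \<le> H1_norm D X * H1_norm D Y"
    using L2_inner_Cauchy_Schwarz[OF H1_spaceD(1)[OF assms(1)] H1_spaceD(1)[OF assms(2)]]
      mult_mono[OF L2_norm_le_H1_norm[of D X] L2_norm_le_H1_norm[of D Y] H1_norm_nonneg L2_norm_nonneg]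
    by linarith
  moreover have "\<bar>L2_inner D (weak_grad D X) (weak_grad D Y)\<bar> \<le> H1_norm D X * H1_norm D Y"
    using L2_inner_Cauchy_Schwarz[OF H1_spaceD(2)[OF assms(1)] H1_spaceD(2)[OF assms(2)]]
      mult_mono[OF H1_seminorm_le_H1_norm[of D X] H1_seminorm_le_H1_norm[of D Y] H1_norm_nonneg H1_seminorm_nonneg]
    unfolding H1_seminorm_def by linarith
  ultimately have "\<beta> * \<bar>L2_inner D X Y\<bar> + \<gamma> * \<bar>L2_inner D (weak_grad D X) (weak_grad D Y)\<bar> \<le>
      \<beta> * (H1_norm D X * H1_norm D Y) + \<gamma> * (H1_norm D X * H1_norm D Y)"
    using assms by (intro add_mono mult_left_mono)
  moreover have "\<bar>a_s D \<beta> \<gamma> X Y\<bar> \<le> \<beta> * \<bar>L2_inner D X Y\<bar> + \<gamma> * \<bar>L2_inner D (weak_grad D X) (weak_grad D Y)\<bar>"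
    unfolding a_s_def using assms(3,4)
    by (intro order_trans[OF abs_triangle_ineq]) (simp add: abs_mult)
  ultimately show ?thesis by (simp add: algebra_simps)
qed

text \<open>The test function is \<open>-\<kappa>\<close> for the \<open>H\<^sup>1\<close> product and the projection of an almost maximizer of the
  dual norm for the duality pairing.\<close>

lemma multiplier_inf_sup:
  fixes TB :: "'j \<Rightarrow> (real^'n) set set"
  assumes mesh: "\<And>j. simplicial_mesh D (TB j)"
    and stable: "ch = Dual_Pairing \<Longrightarrow> \<exists>c. \<forall>j. \<forall>v \<in> H1_space D.
        H1_seminorm D (L2_projection D (P1_space D (TB j)) v) \<le> c * H1_seminorm D v"
  shows "\<exists>C>0. \<forall>j. \<forall>\<kappa>\<in>P1_space D (TB j). multiplier_norm ch D \<kappa> > 0 \<longrightarrow>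
    (\<exists>Y\<in>P1_space D (TB j). H1_norm D Y > 0 \<and>
       multiplier_norm ch D \<kappa> * H1_norm D Y \<le> C * coupling_form ch D \<kappa> (\<lambda>s. 0 - Y s))"
proof (cases ch)
  case H1_Product
  have "\<exists>Y\<in>P1_space D (TB j). H1_norm D Y > 0 \<and>
      multiplier_norm ch D \<kappa> * H1_norm D Y \<le> 1 * coupling_form ch D \<kappa> (\<lambda>s. 0 - Y s)"
    if \<kappa>: "\<kappa> \<in> P1_space D (TB j)" "multiplier_norm ch D \<kappa> > 0" for j \<kappa>
  proof (intro bexI[of _ "\<lambda>s. - \<kappa> s"] conjI)
    note n = H1_norm_minus[OF D(1,2) P1_space_H1[OF \<kappa>(1)]]
    show "H1_norm D (\<lambda>s. - \<kappa> s) > 0" using \<kappa>(2) H1_Product by (simp add: n)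
    have "H1_norm D \<kappa> * H1_norm D \<kappa> = H1_inner D \<kappa> \<kappa>"
      by (simp add: H1_norm_def H1_inner_self)
    then show "multiplier_norm ch D \<kappa> * H1_norm D (\<lambda>s. - \<kappa> s) \<le>
        1 * coupling_form ch D \<kappa> (\<lambda>s. 0 - - \<kappa> s)"
      by (simp add: n H1_Product)
    show "(\<lambda>s. - \<kappa> s) \<in> P1_space D (TB j)" by (rule P1_space_minus[OF \<kappa>(1)])
  qed
  then show ?thesis by (intro exI[of _ 1]) auto
next
  case Dual_Pairing
  then obtain c where c: "\<forall>j. \<forall>v \<in> H1_space D.
      H1_seminorm D (L2_projection D (P1_space D (TB j)) v) \<le> c * H1_seminorm D v"
    using stable by blast
  \<comment> \<open>Projection multiplies the seminorm by at most \<open>c\<close> and does not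
    increase the L2 norm; 1 + c^2 dominates both squared factors.\<close>
  define C where "C = sqrt (1 + c\<^sup>2)"
  have C: "C > 0" by (simp add: C_def add_pos_nonneg)
  have "\<exists>Y\<in>P1_space D (TB j). H1_norm D Y > 0 \<and>
      multiplier_norm ch D \<kappa> * H1_norm D Y \<le> 2 * C * coupling_form ch D \<kappa> (\<lambda>s. 0 - Y s)"
    if \<kappa>: "\<kappa> \<in> P1_space D (TB j)" "multiplier_norm ch D \<kappa> > 0" for j \<kappa>
  proof -
    define l where "l = dual_norm D (L2_inner D \<kappa>)"
    have l: "l > 0" using \<kappa>(2) Dual_Pairing by (simp add: l_def)
    note \<kappa>L = P1_space_L2[OF \<kappa>(1)]
    \<comment> \<open>The supremum need not be attained. Settling for half of it costs the factor 2
      in the final constant.\<close>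
    have "l / 2 < l" using l by simp
    then obtain w where w: "w \<in> H1_space D" "H1_norm D w \<noteq> 0" "l / 2 < \<bar>L2_inner D \<kappa> w\<bar> / H1_norm D w"
      unfolding l_def dual_norm_def
      using less_cSUP_iff[OF dual_norm_index_nonempty dual_norm_bdd_above(1)[OF \<kappa>L]] by auto
    have wpos: "H1_norm D w > 0" using w(2) H1_norm_nonneg[of D w] by linarith
    define p where "p = L2_projection D (P1_space D (TB j)) w"
    note p = L2_projection_P1[OF D(1,2) mesh[of j] H1_spaceD(1)[OF w(1)], folded p_def]
    have pH: "p \<in> H1_space D" by (rule P1_space_H1[OF p(1)])
    \<comment> \<open>Since \<kappa> belongs to the space projected onto, replacing the maximizer by
      its projection leaves the pairing unchanged.\<close>
    have pw: "L2_inner D \<kappa> p = L2_inner D \<kappa> w"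
      using p(2)[OF \<kappa>(1)] by (simp add: L2_inner_commute)
    have lw: "l * H1_norm D w \<le> 2 * \<bar>L2_inner D \<kappa> p\<bar>"
      using w(3) wpos by (simp add: pos_less_divide_eq pw)
    have "(H1_seminorm D p)\<^sup>2 \<le> (c * H1_seminorm D w)\<^sup>2"
      using c w(1) by (intro power_mono H1_seminorm_nonneg) (auto simp: p_def)
    moreover have "(L2_norm D p)\<^sup>2 \<le> (L2_norm D w)\<^sup>2"
      by (rule power_mono[OF p(3) L2_norm_nonneg])
    ultimately have "(H1_norm D p)\<^sup>2 \<le> c\<^sup>2 * (H1_seminorm D w)\<^sup>2 + (L2_norm D w)\<^sup>2"
      by (simp add: H1_norm_power2 power_mult_distrib)
    also have "\<dots> \<le> (1 + c\<^sup>2) * (H1_norm D w)\<^sup>2"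
      by (simp add: H1_norm_power2 algebra_simps)
    also have "\<dots> = (C * H1_norm D w)\<^sup>2"
      by (simp add: C_def power_mult_distrib add_nonneg_nonneg)
    finally have pC: "H1_norm D p \<le> C * H1_norm D w"
      by (rule power2_le_imp_le) (use C in \<open>simp add: H1_norm_nonneg\<close>)
    have "\<bar>L2_inner D \<kappa> p\<bar> > 0"
    proof -
      have "0 < l * H1_norm D w" using l wpos by simp
      then show ?thesis using lw by linarith
    qed
    have ppos: "H1_norm D p > 0"
    proof (rule ccontr)
      assume "\<not> H1_norm D p > 0"
      then have "L2_norm D p \<le> 0" using L2_norm_le_H1_norm[of D p] by linarith
      then have "L2_norm D p = 0" using L2_norm_nonneg[of D p] by linarith
      then show False
        using L2_inner_Cauchy_Schwarz[OF \<kappa>L P1_space_L2[OF p(1)]] \<open>\<bar>L2_inner D \<kappa> p\<bar> > 0\<close> by simp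
    qed
    have main: "l * H1_norm D p \<le> 2 * C * \<bar>L2_inner D \<kappa> p\<bar>"
    proof -
      have "l * H1_norm D p \<le> C * (l * H1_norm D w)"
        using mult_left_mono[OF pC, of l] l by (simp add: mult_ac)
      also have "\<dots> \<le> C * (2 * \<bar>L2_inner D \<kappa> p\<bar>)" using lw C by (intro mult_left_mono) auto
      finally show ?thesis by simp
    qed
    show ?thesis
    \<comment> \<open>The coupling is taken with 0 - Y, so \<open>Y\<close> is \<open>p\<close> with
      the sign that makes the result the absolute value.\<close>
    proof (cases "L2_inner D \<kappa> p \<ge> 0")
      case True
      then show ?thesis
        using main ppos Dual_Pairing H1_norm_minus[OF D(1,2) pH] P1_space_minus[OF p(1)]
        by (intro bexI[of _ "\<lambda>s. - p s"]) (simp_all add: l_def)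
    next
      case False
      then show ?thesis
        using main ppos Dual_Pairing p(1)
        by (intro bexI[of _ p]) (simp_all add: l_def L2_inner_minus_right)
    qed
  qed
  then show ?thesis using C by (intro exI[of _ "2 * C"]) auto
qed

end

text \<open>The letters \<open>a\<close>, \<open>s\<close>, \<open>x\<close>, \<open>l\<close>,
  \<open>M\<close>, \<open>N\<close> stand for the H1 norm of u, the seminorm and the norm of X, the
  multiplier norm of lambda, the length of the integral of X and the norm of the triple. The
  inequalities bound a^2, M^2, x^2 and l^2, in this order, by constants times k N^2. Adding up gives
  N^2 \<le> K k N^2, which fails for small \<open>k\<close>.\<close>

lemma inf_sup_arithmetic:
  fixes c1 C2 C3 Cp d1 g :: real
  assumes pos: "c1 > 0" "C2 \<ge> 0" "C3 \<ge> 0" "Cp \<ge> 0" "d1 \<ge> 0" "g \<ge> 0"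
  shows "\<exists>k>0. \<forall>a s x l M N :: real. 0 \<le> a \<longrightarrow> 0 \<le> x \<longrightarrow> 0 \<le> l \<longrightarrow> 0 \<le> M \<longrightarrow> 0 < N \<longrightarrow>
    N\<^sup>2 = a\<^sup>2 + x\<^sup>2 + l\<^sup>2 \<longrightarrow> c1 * (a\<^sup>2 + s\<^sup>2) \<le> k * N\<^sup>2 \<longrightarrow> M \<le> d1 * (C3 * a + k * N) \<longrightarrow>
    x\<^sup>2 \<le> s\<^sup>2 + Cp * (s\<^sup>2 + M\<^sup>2) \<longrightarrow> l \<le> C2 * (k * N + g * x) \<longrightarrow> False"
proof -
  \<comment> \<open>In units of k N^2, the bounds for a^2, M^2, x^2 and l^2 are 1/c1, K1, K2 and K3;
    the factors 2 come from squaring sums.\<close>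
  define K1 where "K1 = 2 * d1\<^sup>2 * (C3\<^sup>2 / c1 + 1)"
  define K2 where "K2 = (1 + Cp) / c1 + Cp * K1"
  define K3 where "K3 = 2 * C2\<^sup>2 * (1 + g\<^sup>2 * K2)"
  define K where "K = 1 / c1 + K2 + K3"
  have K1: "K1 \<ge> 0" using pos by (simp add: K1_def)
  have K2: "K2 \<ge> 0" using pos K1 by (simp add: K2_def)
  have K3: "K3 \<ge> 0" using pos K2 by (simp add: K3_def)
  have K: "K > 0" using pos K2 K3 by (simp add: K_def add_pos_nonneg)
  \<comment> \<open>The bound 1 makes (k N)^2 at most k N^2, and the other one leads to N^2 \<le>
    N^2 / 2.\<close>
  define k where "k = min 1 (1 / (2 * K))"
  have k: "k > 0" "k \<le> 1" "K * k \<le> 1 / 2" using K by (auto simp: k_def min_def field_simps)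
  have sq: "(p + q)\<^sup>2 \<le> 2 * p\<^sup>2 + 2 * q\<^sup>2" for p q :: real
    using sum_squares_bound[of p q] by (simp add: power2_sum)
  have "False"
    if a: "0 \<le> a" and x: "0 \<le> x" and l: "0 \<le> l" and M: "0 \<le> M" and N: "0 < N" "N\<^sup>2 = a\<^sup>2 + x\<^sup>2 + l\<^sup>2"
      and 1: "c1 * (a\<^sup>2 + s\<^sup>2) \<le> k * N\<^sup>2" and 2: "M \<le> d1 * (C3 * a + k * N)"
      and 3: "x\<^sup>2 \<le> s\<^sup>2 + Cp * (s\<^sup>2 + M\<^sup>2)" and 4: "l \<le> C2 * (k * N + g * x)"
    for a s x l M N :: real
  proof -
    define n where "n = k * N\<^sup>2"
    have n: "n \<ge> 0" using k by (simp add: n_def)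
    have kN: "(k * N)\<^sup>2 \<le> n"
    proof -
      have "k * k \<le> 1 * k" using k by (intro mult_right_mono) auto
      then show ?thesis
        using mult_right_mono[of "k * k" k "N\<^sup>2"] by (simp add: n_def power2_eq_square mult_ac)
    qed
    have as: "a\<^sup>2 + s\<^sup>2 \<le> n / c1" using 1 pos(1) by (simp add: n_def pos_le_divide_eq mult.commute)
    then have a2: "a\<^sup>2 \<le> n / c1" and s2: "s\<^sup>2 \<le> n / c1"
      using zero_le_power2[of a] zero_le_power2[of s] by linarith+
    have "M\<^sup>2 \<le> (d1 * (C3 * a + k * N))\<^sup>2" by (rule power_mono[OF 2 M])
    also have "\<dots> \<le> d1\<^sup>2 * (2 * (C3 * a)\<^sup>2 + 2 * (k * N)\<^sup>2)"
      unfolding power_mult_distrib[of d1] by (intro mult_left_mono sq) simp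
    also have "\<dots> \<le> d1\<^sup>2 * (2 * (C3\<^sup>2 * (n / c1)) + 2 * n)"
      unfolding power_mult_distrib[of C3] by (intro mult_left_mono add_mono a2 kN) auto
    also have "\<dots> = K1 * n" by (simp add: K1_def algebra_simps)
    finally have M2: "M\<^sup>2 \<le> K1 * n" .
    have "x\<^sup>2 \<le> n / c1 + Cp * (n / c1 + K1 * n)"
      using 3 s2 mult_left_mono[OF add_mono[OF s2 M2] pos(4)] by linarith
    also have "\<dots> = K2 * n" by (simp add: K2_def algebra_simps add_divide_distrib)
    finally have x2: "x\<^sup>2 \<le> K2 * n" .
    have "l\<^sup>2 \<le> (C2 * (k * N + g * x))\<^sup>2" by (rule power_mono[OF 4 l])
    also have "\<dots> \<le> C2\<^sup>2 * (2 * (k * N)\<^sup>2 + 2 * (g * x)\<^sup>2)"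
      unfolding power_mult_distrib[of C2] by (intro mult_left_mono sq) simp
    also have "\<dots> \<le> C2\<^sup>2 * (2 * n + 2 * (g\<^sup>2 * (K2 * n)))"
      unfolding power_mult_distrib[of g] by (intro mult_left_mono add_mono x2 kN) auto
    also have "\<dots> = K3 * n" by (simp add: K3_def algebra_simps)
    finally have l2: "l\<^sup>2 \<le> K3 * n" .
    have "N\<^sup>2 \<le> n / c1 + K2 * n + K3 * n" using N(2) a2 x2 l2 by linarith
    also have "\<dots> = (K * k) * N\<^sup>2" by (simp add: K_def n_def algebra_simps add_divide_distrib)
    also have "\<dots> \<le> 1 / 2 * N\<^sup>2" using k(3) by (intro mult_right_mono) auto
    finally show False using N(1) by simp
  qed
  then show ?thesis using k(1) by blast
qed

section \<open>Inf-sup condition\<close>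

theorem proposition9:
  fixes \<Omega> B :: "(real^'n) set"
    and Xbar :: "real^'n \<Rightarrow> real^'n"
    and \<alpha> \<nu> \<beta> \<gamma> \<beta>div :: real
    and T :: "'i \<Rightarrow> (real^'n) set set"
    and TB :: "'j \<Rightarrow> (real^'n) set set"
    and V :: "'i \<Rightarrow> (real^'n \<Rightarrow> real^'n) set"
    and Q :: "'i \<Rightarrow> (real^'n \<Rightarrow> real) set"
    and ch :: coupling
  assumes dim: "CARD('n) \<in> {2, 3}"
    and domains: "lipschitz_polytopal_domain \<Omega>" "lipschitz_polytopal_domain B"
    and Xbar: "Xbar \<in> W1inf_space B" "inj_on Xbar B"
      "\<exists>L. L-lipschitz_on (Xbar ` B) (inv_into B Xbar)"
      "closure (Xbar ` B) \<subseteq> \<Omega>"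
    and coefficients: "\<alpha> > 0" "\<nu> > 0" "\<gamma> > 0" "\<beta> \<ge> 0"
    and meshes: "\<And>i. simplicial_mesh \<Omega> (T i)" "shape_regular_family T"
      "\<And>j. simplicial_mesh B (TB j)" "shape_regular_family TB"
    and V: "\<And>i. finite_element_space \<Omega> (T i) (V i)" "\<And>i. V i \<subseteq> H10_space \<Omega>"
    and Q: "\<And>i. finite_element_space \<Omega> (T i) (Q i)" "\<And>i. Q i \<subseteq> L2_zero_mean \<Omega>"
    and stokes: "\<beta>div > 0" "\<And>i. stokes_inf_sup \<Omega> \<beta>div (V i) (Q i)"
    and P0_stable: "ch = Dual_Pairing \<Longrightarrow>
      \<exists>c. \<forall>j. \<forall>v \<in> H1_space B.
        H1_seminorm B (L2_projection B (P1_space B (TB j)) v) \<le> c * H1_seminorm B v"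
  shows "\<exists>\<kappa>1 > 0. \<forall>i j.
    ereal \<kappa>1 \<le>
      (INF U_h \<in> {U \<in> kernel_B \<Omega> (V i) (Q i) (P1_space B (TB j)). norm_V ch \<Omega> B U \<noteq> 0}.
       SUP V_h \<in> {U \<in> kernel_B \<Omega> (V i) (Q i) (P1_space B (TB j)). norm_V ch \<Omega> B U \<noteq> 0}.
         ereal (form_A ch \<Omega> B Xbar \<alpha> \<nu> \<beta> \<gamma> U_h V_h / (norm_V ch \<Omega> B U_h * norm_V ch \<Omega> B V_h)))"
proof -
  have \<Omega>: "open \<Omega>" "bounded \<Omega>" and B: "open B" "bounded B" "B \<noteq> {}"
    using domains by (auto simp: lipschitz_polytopal_domain_def)
  note Bm = domain_measure[OF B]
  obtain L where L: "L-lipschitz_on (Xbar ` B) (inv_into B Xbar)" using Xbar(3) by blast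
  have Xm: "Xbar \<in> borel_measurable (lebesgue_on B)"
    using Xbar(1) by (simp add: W1inf_space_def Linf_space_def)
  have XB: "Xbar ` B \<subseteq> \<Omega>" using Xbar(4) closure_subset by blast
  define C3 where "C3 = sqrt ((L * CARD('n)) ^ CARD('n) * measure lborel (ball (0 :: real^'n) 1))"
  have C3: "C3 \<ge> 0" using lipschitz_on_nonneg[OF L] by (simp add: C3_def)
  note comp = lipschitz_inverse_composition[OF Bm(1) \<Omega> Xm Xbar(2) L XB, folded C3_def]
  obtain Cp where Cp: "Cp \<ge> 0" "\<forall>X\<in>H1_space B.
      (L2_norm B X)\<^sup>2 \<le> Cp * ((H1_seminorm B X)\<^sup>2 + (norm (\<integral>x. X x \<partial>lebesgue_on B))\<^sup>2)"
    using poincare[OF domains(2)] by blast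
  obtain C2 where C2: "C2 > 0" "\<forall>j. \<forall>\<kappa>\<in>P1_space B (TB j). multiplier_norm ch B \<kappa> > 0 \<longrightarrow>
      (\<exists>Y\<in>P1_space B (TB j). H1_norm B Y > 0 \<and>
         multiplier_norm ch B \<kappa> * H1_norm B Y \<le> C2 * coupling_form ch B \<kappa> (\<lambda>s. 0 - Y s))"
    using multiplier_inf_sup[OF B meshes(3) P0_stable] by blast
  \<comment> \<open>Here \<alpha> controls the L2 norm of u, \<nu>/2 its gradient because of the
    factor 2 in Korn's inequality, and \<gamma> the gradient of X.\<close>
  define c1 where "c1 = min (min \<alpha> (\<nu> / 2)) \<gamma>"
  have c1: "c1 > 0" "c1 \<le> \<alpha>" "c1 \<le> \<nu> / 2" "c1 \<le> \<gamma>" using coefficients by (auto simp: c1_def)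
  define d1 where "d1 = sqrt (measure lebesgue B)"
  have d1: "d1 > 0" using Bm(3) by (simp add: d1_def)
  \<comment> \<open>All constants so far come from the domains, \<open>Xbar\<close>, the
    coefficients and the bound of the projection, so \<open>k\<close> is fixed before the meshes
    \<open>i\<close> and \<open>j\<close>.\<close>
  obtain k where k: "k > 0" and contr: "\<forall>a s x l M N :: real. 0 \<le> a \<longrightarrow> 0 \<le> x \<longrightarrow> 0 \<le> l \<longrightarrow> 0 \<le> M \<longrightarrow> 0 < N \<longrightarrow>
    N\<^sup>2 = a\<^sup>2 + x\<^sup>2 + l\<^sup>2 \<longrightarrow> c1 * (a\<^sup>2 + s\<^sup>2) \<le> k * N\<^sup>2 \<longrightarrow> M \<le> d1 * (C3 * a + k * N) \<longrightarrow>
    x\<^sup>2 \<le> s\<^sup>2 + Cp * (s\<^sup>2 + M\<^sup>2) \<longrightarrow> l \<le> C2 * (k * N + (\<beta> + \<gamma>) * x) \<longrightarrow> False"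
    using inf_sup_arithmetic[of c1 C2 C3 Cp d1 "\<beta> + \<gamma>"] c1 C2 C3 Cp d1 coefficients by auto
  let ?A = "form_A ch \<Omega> B Xbar \<alpha> \<nu> \<beta> \<gamma>" and ?norm = "norm_V ch \<Omega> B"
  have "ereal k \<le> (SUP V_h \<in> {U \<in> kernel_B \<Omega> (V i) (Q i) (P1_space B (TB j)). ?norm U \<noteq> 0}.
      ereal (?A U_h V_h / (?norm U_h * ?norm V_h)))"
    if "U_h \<in> {U \<in> kernel_B \<Omega> (V i) (Q i) (P1_space B (TB j)). ?norm U \<noteq> 0}" for i j U_h
  proof (rule ccontr)
    let ?K = "kernel_B \<Omega> (V i) (Q i) (P1_space B (TB j))" and ?S = "P1_space B (TB j)"
    assume "\<not> ereal k \<le> (SUP V_h \<in> {U \<in> ?K. ?norm U \<noteq> 0}. ereal (?A U_h V_h / (?norm U_h * ?norm V_h)))"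
    then have sup: "(SUP V_h \<in> {U \<in> ?K. ?norm U \<noteq> 0}. ereal (?A U_h V_h / (?norm U_h * ?norm V_h))) < ereal k"
      by simp
    obtain u X lam where U: "U_h = (u, X, lam)" by (cases U_h)
    have UK: "(u, X, lam) \<in> ?K" "?norm (u, X, lam) \<noteq> 0" using that U by auto
    have u: "u \<in> V i" and X: "X \<in> ?S" and lam: "lam \<in> ?S" using UK(1) by (auto simp: kernel_B_def)
    have u10: "u \<in> H10_space \<Omega>" using u V(2) by blast
    then have uL: "u \<in> L2_space \<Omega>" by (simp add: H10_space_def H1_space_def)
    note XH = P1_space_H1[OF X] and XL = P1_space_L2[OF X] and lamL = P1_space_L2[OF lam]
    define a where "a = H1_norm \<Omega> u"
    define s where "s = H1_seminorm B X"
    define x where "x = H1_norm B X"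
    define l where "l = multiplier_norm ch B lam"
    define m where "m = (\<integral>x. X x \<partial>lebesgue_on B)"
    define N where "N = ?norm (u, X, lam)"
    have N2: "N\<^sup>2 = a\<^sup>2 + x\<^sup>2 + l\<^sup>2" by (simp add: N_def norm_V_def a_def x_def l_def)
    have N: "N > 0" using UK(2) by (simp add: N_def norm_V_def less_le)
    have test: "?A (u, X, lam) W \<le> k * N * ?norm W" if W: "W \<in> ?K" "?norm W > 0" for W
    proof -
      have "ereal (?A (u, X, lam) W / (N * ?norm W)) \<le>
          (SUP V_h \<in> {U \<in> ?K. ?norm U \<noteq> 0}. ereal (?A U_h V_h / (?norm U_h * ?norm V_h)))"
        unfolding N_def U using W by (intro SUP_upper) auto
      then have "ereal (?A (u, X, lam) W / (N * ?norm W)) < ereal k" using sup by (rule le_less_trans)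
      then have "?A (u, X, lam) W / (N * ?norm W) < k" by simp
      then show ?thesis using N W(2) by (simp add: pos_divide_less_eq mult_ac)
    qed
    have V0: "(\<lambda>x. 0) \<in> V i" using V(1)[of i] by (simp add: finite_element_space_def)
    \<comment> \<open>Even for the zero field \<open>weak_grad\<close> is a choice that vanishes
      only almost everywhere, so each form has to be evaluated at it separately.\<close>
    have grad0: "AE x in lebesgue_on \<Omega>. weak_grad \<Omega> (\<lambda>x. 0) x = 0"
      by (rule weak_grad_const_AE[OF \<Omega>])
    have af0: "a_f \<Omega> \<alpha> \<nu> u (\<lambda>x. 0) = 0"
    proof -
      have "AE x in lebesgue_on \<Omega>. sym_grad \<Omega> (\<lambda>x. 0) x = 0"
        using grad0 by eventually_elim (simp add: sym_grad_def transpose_def vec_eq_iff)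
      then show ?thesis by (simp add: a_f_def L2_inner_AE_zero_right)
    qed
    have as0: "a_s B \<beta> \<gamma> X (\<lambda>x. 0) = 0"
      by (simp add: a_s_def L2_inner_AE_zero_right L2_inner_AE_zero_right[OF weak_grad_const_AE[OF B(1,2)]])
    have div0: "L2_inner \<Omega> (weak_div \<Omega> (\<lambda>x. 0)) q = 0" for q
    proof (rule L2_inner_AE_zero_left)
      show "AE x in lebesgue_on \<Omega>. weak_div \<Omega> (\<lambda>x. 0) x = 0"
        using grad0 by eventually_elim (simp add: weak_div_def trace_def)
    qed
    have S0: "(\<lambda>x. c) \<in> ?S" for c by (rule P1_space_const[OF B(1,2)])
    have H0: "H1_norm \<Omega> (\<lambda>x. 0) = 0"
      unfolding H1_norm_const[OF \<Omega>] by (simp add: L2_norm_def L2_inner_zero_left)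
    have HB0: "H1_norm B (\<lambda>x. 0) = 0" and mult0: "multiplier_norm ch B (\<lambda>x. 0) = 0"
      by (simp_all add: H1_norm_const_eq[OF B] multiplier_norm_const[OF B])
    have E1: "c1 * (a\<^sup>2 + s\<^sup>2) \<le> k * N\<^sup>2"
    proof -
      have "?A (u, X, lam) (u, X, lam) = a_f \<Omega> \<alpha> \<nu> u u + a_s B \<beta> \<gamma> X X" by (simp add: form_A_def)
      moreover have "?A (u, X, lam) (u, X, lam) \<le> k * N\<^sup>2"
        using test[OF UK(1)] N by (simp add: N_def power2_eq_square mult.assoc)
      moreover have "c1 * a\<^sup>2 \<le> a_f \<Omega> \<alpha> \<nu> u u"
      proof -
        have "c1 * (H1_seminorm \<Omega> u)\<^sup>2 \<le> \<nu> / 2 * (H1_seminorm \<Omega> u)\<^sup>2"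
          using c1(3) by (rule mult_right_mono) simp
        also have "\<dots> \<le> \<nu> * L2_inner \<Omega> (sym_grad \<Omega> u) (sym_grad \<Omega> u)"
          using mult_left_mono[OF korn_H10[OF \<Omega> u10], of "\<nu> / 2"] coefficients(2) by simp
        finally have "c1 * (H1_seminorm \<Omega> u)\<^sup>2 \<le> \<dots>" .
        moreover have "c1 * (L2_norm \<Omega> u)\<^sup>2 \<le> \<alpha> * L2_inner \<Omega> u u"
          unfolding L2_norm_power2 using c1(2) L2_inner_self_nonneg by (rule mult_right_mono)
        ultimately show ?thesis by (simp add: a_def H1_norm_power2 a_f_def distrib_left)
      qed
      moreover have "c1 * s\<^sup>2 \<le> a_s B \<beta> \<gamma> X X"
      proof -
        have "c1 * s\<^sup>2 \<le> \<gamma> * L2_inner B (weak_grad B X) (weak_grad B X)"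
          unfolding s_def H1_seminorm_def L2_norm_power2
          using c1(4) L2_inner_self_nonneg by (rule mult_right_mono)
        moreover have "0 \<le> \<beta> * L2_inner B X X" using coefficients(4) L2_inner_self_nonneg by (rule mult_nonneg_nonneg)
        ultimately show ?thesis by (simp add: a_s_def)
      qed
      ultimately show ?thesis by (simp add: distrib_left)
    qed
    have E2: "norm m \<le> d1 * (C3 * a + k * N)"
    \<comment> \<open>For m = 0 the test function below would have norm 0 and be excluded from the
      supremum.\<close>
    proof (cases "m = 0")
      case True
      then show ?thesis using C3 k N d1 H1_norm_nonneg[of \<Omega> u] by (simp add: a_def)
    next
      case False
      let ?W = "((\<lambda>x. 0), (\<lambda>x. 0), (\<lambda>x. m))"
      have mL: "(\<lambda>x. m) \<in> L2_space B" by (rule L2_space_const[OF B(2) Bm(1)])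
      have normW: "?norm ?W = norm m * d1"
        using d1 by (simp add: norm_V_def H0 HB0 multiplier_norm_const[OF B] d1_def)
      have "?W \<in> ?K" using V0 S0 div0 by (simp add: kernel_B_def)
      then have "?A (u, X, lam) ?W \<le> k * N * (norm m * d1)"
        using test[of ?W] False d1 by (simp add: normW)
      \<comment> \<open>Only the term - c(m, u o Xbar - X) survives. As \<open>m\<close> is the
        integral of X, the product of \<open>m\<close> with X is |m|^2, and the other product is
        bounded through u.\<close>
      moreover have "?A (u, X, lam) ?W = L2_inner B (\<lambda>x. m) X - L2_inner B (\<lambda>x. m) (\<lambda>s. u (Xbar s))"
        using L2_inner_diff_right[OF mL comp(1)[OF uL] XL]
        by (simp add: form_A_def af0 as0 coupling_form_zero_right[OF B] coupling_form_const_left[OF B])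
      moreover have "L2_inner B (\<lambda>x. m) X = (norm m)\<^sup>2"
        using L2_space_integrable[OF B(2) Bm(1) XL]
        by (simp add: L2_inner_def m_def[symmetric] power2_norm_eq_inner)
      moreover have "L2_inner B (\<lambda>x. m) (\<lambda>s. u (Xbar s)) \<le> (norm m * d1) * (C3 * a)"
      proof -
        have "L2_inner B (\<lambda>x. m) (\<lambda>s. u (Xbar s)) \<le> L2_norm B (\<lambda>x. m) * L2_norm B (\<lambda>s. u (Xbar s))"
          using L2_inner_Cauchy_Schwarz[OF mL comp(1)[OF uL]] by linarith
        also have "L2_norm B (\<lambda>s. u (Xbar s)) \<le> C3 * a"
          using comp(2)[OF uL] mult_left_mono[OF L2_norm_le_H1_norm[of \<Omega> u] C3] by (simp add: a_def)
        finally show ?thesis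
          by (simp add: L2_norm_const[OF Bm(2)] d1_def L2_norm_nonneg mult_left_mono)
      qed
      ultimately have "norm m * norm m \<le> norm m * (d1 * (C3 * a + k * N))"
        by (simp add: power2_eq_square algebra_simps)
      then show ?thesis using False by (simp add: mult_le_cancel_left)
    qed
    have E3: "x\<^sup>2 \<le> s\<^sup>2 + Cp * (s\<^sup>2 + (norm m)\<^sup>2)"
      using Cp(2) XH by (simp add: x_def s_def m_def H1_norm_power2)
    have E4: "l \<le> C2 * (k * N + (\<beta> + \<gamma>) * x)"
    proof (cases "l > 0")
      case False
      have "0 \<le> C2 * (k * N + (\<beta> + \<gamma>) * x)"
        using C2 k N coefficients H1_norm_nonneg[of B X]
        by (intro mult_nonneg_nonneg add_nonneg_nonneg) (auto simp: x_def)
      then show ?thesis using False by simp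
    next
      case True
      then obtain Y where Y: "Y \<in> ?S" "H1_norm B Y > 0"
        "l * H1_norm B Y \<le> C2 * coupling_form ch B lam (\<lambda>s. 0 - Y s)"
        using C2(2) lam unfolding l_def by blast
      let ?W = "((\<lambda>x. 0), Y, (\<lambda>x. 0))"
      have normW: "?norm ?W = H1_norm B Y"
        using Y(2) by (simp add: norm_V_def H0 mult0)
      have "?W \<in> ?K" using V0 S0 Y(1) div0 by (simp add: kernel_B_def)
      then have "?A (u, X, lam) ?W \<le> k * N * H1_norm B Y"
        using test[of ?W] Y(2) by (simp add: normW)
      \<comment> \<open>With zero velocity the coupling argument is 0 - Y s, the form in which
        \<open>multiplier_inf_sup\<close> is stated. The term with the zero multiplier vanishes by
        \<open>coupling_form_const_left\<close>, whose second argument may contain the composition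
        with \<open>Xbar\<close>.\<close>
      moreover have "?A (u, X, lam) ?W = a_s B \<beta> \<gamma> X Y + coupling_form ch B lam (\<lambda>s. 0 - Y s)"
        by (simp add: form_A_def af0 coupling_form_const_left[OF B] L2_inner_zero_left)
      moreover have "- a_s B \<beta> \<gamma> X Y \<le> (\<beta> + \<gamma>) * x * H1_norm B Y"
        using a_s_bound[OF B XH P1_space_H1[OF Y(1)], of \<beta> \<gamma>] coefficients by (simp add: x_def)
      ultimately have "coupling_form ch B lam (\<lambda>s. 0 - Y s) \<le> (k * N + (\<beta> + \<gamma>) * x) * H1_norm B Y"
        by (simp add: distrib_right)
      then have "C2 * coupling_form ch B lam (\<lambda>s. 0 - Y s) \<le> C2 * ((k * N + (\<beta> + \<gamma>) * x) * H1_norm B Y)"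
        using C2(1) by (intro mult_left_mono) auto
      then have "l * H1_norm B Y \<le> (C2 * (k * N + (\<beta> + \<gamma>) * x)) * H1_norm B Y"
        using Y(3) by (simp add: mult.assoc)
      then show ?thesis using Y(2) by (rule mult_right_le_imp_le)
    qed
    have "0 \<le> a" "0 \<le> x" "0 \<le> l" "0 \<le> norm m"
      using multiplier_norm_nonneg[OF B lamL] by (simp_all add: a_def x_def l_def H1_norm_nonneg)
    then show False using contr N N2 E1 E2 E3 E4 by blast
  qed
  then show ?thesis
    using k by (intro exI[of _ k] conjI allI INF_greatest) auto
qed

end
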